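(* Fix a finite token set $\Sigma$. Encoder--decoder transformers over $\Sigma$ without the final $\mathrm{softmax}$ (over arbitrary floating-point formats), tuples of $\Sigma$-formulae of $\mathrm{GPTL}^{-}$, and $\mathrm{CPG}$-automata over $\Sigma$ have the same expressive power: for any two of these three classes, every object of the first class has an equivalent object in the second.
   Context: Floating-point numbers: for $p,q\in\mathbb{Z}_+$ a float over $p,q$ is a bit string $b_0b_1\cdots b_{q+p}$ (sign $b_0$, exponent $b_1\cdots b_q$ with value $e$, significand $b_{q+1}\cdots b_{q+p}$ with value $s$) representing $(-1)^{b_0}\frac{s}{2^{p-1}}2^{e-(2^{q-1}-1)}$, except that significand $0^p$ with exponent $1^q$ represents $\pm\infty$. The format $\mathcal F(p,q)$ consists of normalised and subnormalised floats and $\infty,-\infty,\mathrm{NaN}$; arithmetic rounds exact results to the nearest element (overflow to $\pm\infty$, NaN for undefined operations); $\exp$ is approximated within the format; sums of multisets are computed in increasing order. Two-sorted graphs: $\mathrm{BOS}\notin\Sigma$; $\mathcal{G}=(V,E,\lambda)$ with $V=[n]$, $E=\{(i,i+1)\}$, $\lambda:V\to\Sigma\cup\{\mathrm{BOS}\}$, exactly one vertex $w$ labelled $\mathrm{BOS}$; prefix $\mathcal G_p$ = vertices $1,\dots,w-1$, suffix $\mathcal G_s$ = vertices $w,\dots,n$. Encoder--decoder transformer over $\mathcal F$, dimensions $(d,d_k,d_v,d_{ff},d_{\text{out}})$, all arithmetic in $\mathcal F$: embedding $\mathrm{em}:\Sigma\cup\{\mathrm{BOS}\}\to\mathcal F^d$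 vertex-wise; strict causal mask sets entry $(i,j)$ to $-\infty$ if $j\ge i$; $\mathrm{softmax}(\mathbf x)_i=e^{x_i-\beta}/\sum_je^{x_j-\beta}$, $\beta=\max x_j$, $\mathrm{softmax}(-\infty,\dots,-\infty)=0$; attention head $(X,Y)\mapsto\mathrm{softmax}((YW^Q)(XW^K)^\top/\sqrt{d_k})(XW^V)$ row-wise (masked heads mask before softmax); multi-head $\mathrm{concat}(H^{(1)},\dots,H^{(h)})W^O$; self-attention $X=Y$, cross-attention unmasked; MLP $M(\mathbf x)=\mathrm{ReLU}(\mathbf xW_1+b_1)W_2+b_2$ row-wise; encoder layer $\mathsf{EL}(X)=M(X')+X'$, $X'=\mathsf{MHSA}(X)+X$ (unmasked); decoder layer $\mathsf{DL}(X,Y)=M(Y'')+Y''$, $Y''=\mathsf{MHCA}(X,Y')+Y'$, $Y'=\mathsf{MHSA}_{\mathrm{mask}}(Y)+Y$; encoder = composition of encoder layers; decoder $\mathsf D(X,Y)=\mathsf{DL}_{L_2}(X,\dots\mathsf{DL}_1(X,Y)\dots)$; output head $\mathrm{Out}(Y)=YW^{\mathrm{out}}+b^{\mathrm{out}}$; $T(\mathcal G)=\mathrm{Out}(\mathsf D(\mathsf E(\mathrm{em}(\mathcal G_p)),\mathrm{em}(\mathcal G_s)))$, whose row for a suffix vertex $v$ is the output of $T$ at $v$. Bit-wise interpretation of an output vector: concatenation of the bit strings of its floats; feature-wise interpretation (when each entry represents $0$ or $1$): the bit string with $i$-th bit $1$ iff the $i$-th entry represents $1$. Logic $\mathrm{GPTL}^{-}$: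 $\varphi::=\bot\mid p\mid\neg\varphi\mid(\varphi\wedge\varphi)\mid\langle G\rangle^{\text{pre}}_{\ge k}\varphi\mid\langle P\rangle^{\text{suf}}\varphi$; $\langle G\rangle^{\text{pre}}_{\ge k}\varphi$ holds iff at least $k$ prefix vertices satisfy $\varphi$; $\langle P\rangle^{\text{suf}}\varphi$ holds at $w'$ iff some suffix vertex $u<w'$ satisfies $\varphi$; $p$ holds iff the label is $p$. The output of a tuple $(\varphi_1,\dots,\varphi_m)$ at $(\mathcal G,v)$ is the bit string of their truth values. $\mathrm{CPG}$-automaton: $(Q,\pi,\delta,n,b)$, finite nonempty $Q\subseteq\{0,1\}^m$, $\pi:\Sigma\cup\{\mathrm{BOS}\}\to Q$, $\delta:Q\times\mathcal M_k(Q)\times\mathcal M_k(Q)\to Q$ ($k$-capped multisets), $n\in\mathbb N$, $b\in\mathbb Z_+$; $x^0_v=\pi(\lambda(v))$, $x^{t+1}_v=\delta(x^t_v,\{\{x^t_u\mid u<w\}\}_{|k},\{\{x^t_u\mid w\le u<v\}\}_{|k})$; output at $(\mathcal G,v)$ is the length-$b$ prefix of $x^n_v$. Equivalence: two objects are equivalent if for every two-sorted graph $\mathcal G$ and every suffix vertex $v$ they give the same output at $(\mathcal G,v)$, where a transformer's output is interpreted bit-wise when the transformer is the object being translated (into a formula tuple or automaton) and feature-wise when the transformer is the target of the translation.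
   Formalization: In masked heads, masked positions contribute no summand to the product with XW^V, rather than the float product 0·v; read literally, 0·∞ = NaN (or −0) would let later suffix vertices influence earlier outputs and the claim would be false. *)

theory Defs
  imports Complex_Main "HOL-Library.Multiset" "Jordan_Normal_Form.Matrix"
begin

section \<open>Floating-point formats\<close>

text \<open>\<open>Fl b e s\<close> is the bit string with sign bit \<open>b\<close>, exponent value \<open>e\<close> and significand value \<open>s\<close>.
  The significand has no hidden bit.\<close>

datatype flt = Fl bool nat nat | Infty bool | NaN

text \<open>Normalised: leading significand bit 1. Subnormalised: leading significand bit 0 and exponent
  \<open>0\<^sup>q\<close>.\<close>

definition normalised :: "nat \<Rightarrow> nat \<Rightarrow> nat \<Rightarrow> nat \<Rightarrow> bool" where
  "normalised p q e s \<longleftrightarrow> e < 2 ^ q \<and> 2 ^ (p - 1) \<le> s \<and> s < 2 ^ p"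

definition subnormalised :: "nat \<Rightarrow> nat \<Rightarrow> nat \<Rightarrow> nat \<Rightarrow> bool" where
  "subnormalised p q e s \<longleftrightarrow> e = 0 \<and> s < 2 ^ (p - 1)"

definition fl_ok :: "nat \<Rightarrow> nat \<Rightarrow> nat \<Rightarrow> nat \<Rightarrow> bool" where
  "fl_ok p q e s \<longleftrightarrow> normalised p q e s \<or> subnormalised p q e s"

definition flts :: "nat \<Rightarrow> nat \<Rightarrow> flt set" where
  "flts p q = {Fl b e s | b e s. fl_ok p q e s} \<union> {Infty True, Infty False, NaN}"

definition bias :: "nat \<Rightarrow> int" where
  "bias q = 2 ^ (q - 1) - 1"

definition mag :: "nat \<Rightarrow> nat \<Rightarrow> nat \<Rightarrow> nat \<Rightarrow> real" where
  "mag p q e s = real s / 2 ^ (p - 1) * 2 powi (int e - bias q)"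

definition fval :: "nat \<Rightarrow> nat \<Rightarrow> bool \<Rightarrow> nat \<Rightarrow> nat \<Rightarrow> real" where
  "fval p q b e s = (- 1) ^ of_bool b * mag p q e s"

definition represents :: "nat \<Rightarrow> nat \<Rightarrow> flt \<Rightarrow> real \<Rightarrow> bool" where
  "represents p q x r \<longleftrightarrow> (\<exists>b e s. x = Fl b e s \<and> fval p q b e s = r)"

definition fzero :: "bool \<Rightarrow> flt" where
  "fzero b = Fl b 0 0"

definition fone :: "nat \<Rightarrow> nat \<Rightarrow> flt" where
  "fone p q = Fl False (2 ^ (q - 1) - 1) (2 ^ (p - 1))"

definition bin :: "nat \<Rightarrow> nat \<Rightarrow> bool list" where
  "bin w n = rev (map (bit n) [0..<w])"

text \<open>The bit string of NaN is a parameter \<open>nan\<close>: for \<open>p = q = 1\<close> all strings of length \<open>1 + q + p\<close>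
  already denote other elements of the format.\<close>

fun flt_bits :: "(nat \<Rightarrow> nat \<Rightarrow> bool list) \<Rightarrow> nat \<Rightarrow> nat \<Rightarrow> flt \<Rightarrow> bool list" where
  "flt_bits nan p q (Fl b e s) = b # bin q e @ bin p s"
| "flt_bits nan p q (Infty b) = b # replicate q True @ replicate p False"
| "flt_bits nan p q NaN = nan p q"


section \<open>Arithmetic\<close>

text \<open>Rounding of a non-negative real to the nearest element, with the IEEE 754 conventions: ties go
  to an even significand, or to the larger magnitude if neither candidate has one (possible only for
  \<open>p = 1\<close>); a value at least half a unit in the last place above the largest finite float
  overflows.\<close>

definition nearest :: "nat \<Rightarrow> nat \<Rightarrow> real \<Rightarrow> (nat \<times> nat) set" where
  "nearest p q r = {(e, s). fl_ok p q e s \<and>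
     (\<forall>e' s'. fl_ok p q e' s' \<longrightarrow> \<bar>mag p q e s - r\<bar> \<le> \<bar>mag p q e' s' - r\<bar>)}"

definition overflow_bound :: "nat \<Rightarrow> nat \<Rightarrow> real" where
  "overflow_bound p q = (2 - 1 / 2 ^ p) * 2 powi (2 ^ q - 1 - bias q)"

definition fround :: "nat \<Rightarrow> nat \<Rightarrow> bool \<Rightarrow> real \<Rightarrow> flt" where
  "fround p q b r =
     (if r < overflow_bound p q
      then case (SOME (e, s). (e, s) \<in> nearest p q r \<and>
             (\<forall>(e', s') \<in> nearest p q r.
                (even s' \<longrightarrow> even s) \<and> (even s' = even s \<longrightarrow> mag p q e' s' \<le> mag p q e s)))
           of (e, s) \<Rightarrow> Fl b e s
      else Infty b)"

text \<open>Signs of zero results follow IEEE 754.\<close>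

fun fadd :: "nat \<Rightarrow> nat \<Rightarrow> flt \<Rightarrow> flt \<Rightarrow> flt" where
  "fadd p q (Fl b e s) (Fl b' e' s') =
     (let r = fval p q b e s + fval p q b' e' s'
      in if r = 0 then fzero (b \<and> b') else fround p q (r < 0) \<bar>r\<bar>)"
| "fadd p q (Infty b) (Infty b') = (if b = b' then Infty b else NaN)"
| "fadd p q (Infty b) (Fl _ _ _) = Infty b"
| "fadd p q (Fl _ _ _) (Infty b) = Infty b"
| "fadd p q NaN _ = NaN"
| "fadd p q _ NaN = NaN"

fun fneg :: "flt \<Rightarrow> flt" where
  "fneg (Fl b e s) = Fl (\<not> b) e s"
| "fneg (Infty b) = Infty (\<not> b)"
| "fneg NaN = NaN"

definition fsub :: "nat \<Rightarrow> nat \<Rightarrow> flt \<Rightarrow> flt \<Rightarrow> flt" where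
  "fsub p q x y = fadd p q x (fneg y)"

fun fmul :: "nat \<Rightarrow> nat \<Rightarrow> flt \<Rightarrow> flt \<Rightarrow> flt" where
  "fmul p q (Fl b e s) (Fl b' e' s') = fround p q (b \<noteq> b') (mag p q e s * mag p q e' s')"
| "fmul p q (Infty b) (Infty b') = Infty (b \<noteq> b')"
| "fmul p q (Infty b) (Fl b' e s) = (if s = 0 then NaN else Infty (b \<noteq> b'))"
| "fmul p q (Fl b e s) (Infty b') = (if s = 0 then NaN else Infty (b \<noteq> b'))"
| "fmul p q NaN _ = NaN"
| "fmul p q _ NaN = NaN"

fun fdiv :: "nat \<Rightarrow> nat \<Rightarrow> flt \<Rightarrow> flt \<Rightarrow> flt" where
  "fdiv p q (Fl b e s) (Fl b' e' s') =
     (if s' = 0 then (if s = 0 then NaN else Infty (b \<noteq> b'))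
      else fround p q (b \<noteq> b') (mag p q e s / mag p q e' s'))"
| "fdiv p q (Infty b) (Infty b') = NaN"
| "fdiv p q (Infty b) (Fl b' _ _) = Infty (b \<noteq> b')"
| "fdiv p q (Fl b _ _) (Infty b') = fzero (b \<noteq> b')"
| "fdiv p q NaN _ = NaN"
| "fdiv p q _ NaN = NaN"

fun frelu :: "flt \<Rightarrow> flt" where
  "frelu (Fl b e s) = (if b then fzero False else Fl b e s)"
| "frelu (Infty b) = (if b then fzero False else Infty b)"
| "frelu NaN = NaN"

text \<open>Position in the increasing enumeration of the format. Since representations are normalised,
  magnitudes are ordered as the concatenated exponent and significand bits. Conventions:
  -0 precedes +0, and NaN comes last.\<close>

fun rank :: "nat \<Rightarrow> nat \<Rightarrow> flt \<Rightarrow> int" where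
  "rank p q (Fl b e s) = (if b then - 1 - int (e * 2 ^ p + s) else int (e * 2 ^ p + s))"
| "rank p q (Infty b) = (if b then - 1 - 2 ^ (p + q) else 2 ^ (p + q))"
| "rank p q NaN = 2 ^ (p + q) + 1"

text \<open>Depends only on the multiset of summands, as \<open>rank\<close> is injective on the format.\<close>

definition fsum :: "nat \<Rightarrow> nat \<Rightarrow> flt list \<Rightarrow> flt" where
  "fsum p q xs =
     (case sort_key (rank p q) xs of [] \<Rightarrow> fzero False | y # ys \<Rightarrow> foldl (fadd p q) y ys)"

text \<open>The in-format approximation of the exponential function is a parameter \<open>E\<close>, one function for each
  format. It has to be exact where the result belongs to the format; no accuracy is prescribed
  elsewhere.\<close>

definition exp_approximation :: "(nat \<Rightarrow> nat \<Rightarrow> flt \<Rightarrow> flt) \<Rightarrow> bool" where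
  "exp_approximation E \<longleftrightarrow> (\<forall>p q. p \<ge> 1 \<longrightarrow> q \<ge> 1 \<longrightarrow>
     (\<forall>x \<in> flts p q. E p q x \<in> flts p q) \<and>
     (\<forall>b. E p q (fzero b) = fone p q) \<and>
     E p q (Infty True) = fzero False \<and>
     E p q (Infty False) = Infty False \<and>
     E p q NaN = NaN)"


section \<open>Two-sorted graphs\<close>

text \<open>A graph is the list of its labels: vertex \<open>i\<close> of \<open>[n]\<close> is index \<open>i - 1\<close>, and the edges are the pairs
  of consecutive positions. \<open>None\<close> is \<open>BOS\<close>.\<close>

type_synonym 'a graph = "'a option list"

definition labels :: "'a set \<Rightarrow> 'a option set" where
  "labels \<Sigma> = insert None (Some ` \<Sigma>)"

definition two_sorted :: "'a set \<Rightarrow> 'a graph \<Rightarrow> bool" where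
  "two_sorted \<Sigma> G \<longleftrightarrow> set G \<subseteq> labels \<Sigma> \<and> (\<exists>!w. w < length G \<and> G ! w = None)"

definition bos :: "'a graph \<Rightarrow> nat" where
  "bos G = (THE w. w < length G \<and> G ! w = None)"

definition prefix_vertices :: "'a graph \<Rightarrow> nat set" where
  "prefix_vertices G = {..<bos G}"

definition suffix_vertices :: "'a graph \<Rightarrow> nat set" where
  "suffix_vertices G = {bos G..<length G}"


section \<open>Encoder--decoder transformers\<close>

definition fmat_mult :: "nat \<Rightarrow> nat \<Rightarrow> flt mat \<Rightarrow> flt mat \<Rightarrow> flt mat" where
  "fmat_mult p q A B = mat (dim_row A) (dim_col B)
     (\<lambda>(i, j). fsum p q (map (\<lambda>k. fmul p q (A $$ (i, k)) (B $$ (k, j))) [0..<dim_col A]))"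

definition fmat_add :: "nat \<Rightarrow> nat \<Rightarrow> flt mat \<Rightarrow> flt mat \<Rightarrow> flt mat" where
  "fmat_add p q A B = mat (dim_row A) (dim_col A) (\<lambda>ij. fadd p q (A $$ ij) (B $$ ij))"

definition fmat_add_bias :: "nat \<Rightarrow> nat \<Rightarrow> flt mat \<Rightarrow> flt vec \<Rightarrow> flt mat" where
  "fmat_add_bias p q A b = mat (dim_row A) (dim_col A) (\<lambda>(i, j). fadd p q (A $$ (i, j)) (b $ j))"

definition softmax :: "(nat \<Rightarrow> nat \<Rightarrow> flt \<Rightarrow> flt) \<Rightarrow> nat \<Rightarrow> nat \<Rightarrow> flt vec \<Rightarrow> flt vec" where
  "softmax E p q x =
     (if \<forall>i < dim_vec x. x $ i = Infty True then vec (dim_vec x) (\<lambda>_. fzero False)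
      else let \<beta> = (ARG_MAX (rank p q) y. \<exists>i < dim_vec x. y = x $ i);
               ex = (\<lambda>i. E p q (fsub p q (x $ i) \<beta>));
               den = fsum p q (map ex [0..<dim_vec x])
           in vec (dim_vec x) (\<lambda>i. fdiv p q (ex i) den))"

definition softmax_rows :: "(nat \<Rightarrow> nat \<Rightarrow> flt \<Rightarrow> flt) \<Rightarrow> nat \<Rightarrow> nat \<Rightarrow> flt mat \<Rightarrow> flt mat" where
  "softmax_rows E p q A =
     mat (dim_row A) (dim_col A) (\<lambda>(i, j). softmax E p q (row A i) $ j)"

definition causal_mask :: "flt mat \<Rightarrow> flt mat" where
  "causal_mask A =
     mat (dim_row A) (dim_col A) (\<lambda>(i, j). if j \<ge> i then Infty True else A $$ (i, j))"

text \<open>Product of masked attention weights with the values: a masked position (whose weight is 0)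
  contributes no summand. It must not contribute the float \<open>0 \<cdot> v\<close>, which is NaN for an infinite or
  undefined value \<open>v\<close> and -0 for a negative one: later positions could then influence the result in
  spite of the mask.\<close>

definition fmat_mult_causal :: "nat \<Rightarrow> nat \<Rightarrow> flt mat \<Rightarrow> flt mat \<Rightarrow> flt mat" where
  "fmat_mult_causal p q A B = mat (dim_row A) (dim_col B)
     (\<lambda>(i, j). fsum p q (map (\<lambda>k. fmul p q (A $$ (i, k)) (B $$ (k, j)))
                           (filter (\<lambda>k. k < i) [0..<dim_col A])))"

record head =
  WQ :: "flt mat"
  WK :: "flt mat"
  WV :: "flt mat"

record mha =
  heads :: "head list"
  WO :: "flt mat"

record mlp =
  W1 :: "flt mat"
  b1 :: "flt vec"
  W2 :: "flt mat"
  b2 :: "flt vec"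

record enc_layer =
  enc_self :: mha
  enc_mlp :: mlp

record dec_layer =
  dec_self :: mha
  dec_cross :: mha
  dec_mlp :: mlp

record dims =
  dmodel :: nat
  dkey :: nat
  dval :: nat
  dff :: nat
  dout :: nat

record 'a transformer =
  prec :: nat
  expo :: nat
  tdims :: dims
  emb :: "'a option \<Rightarrow> flt vec"
  enc :: "enc_layer list"
  dec :: "dec_layer list"
  Wout :: "flt mat"
  bout :: "flt vec"

definition fmats :: "nat \<Rightarrow> nat \<Rightarrow> nat \<Rightarrow> nat \<Rightarrow> flt mat set" where
  "fmats p q m n = {A \<in> carrier_mat m n. \<forall>i < m. \<forall>j < n. A $$ (i, j) \<in> flts p q}"

definition fvecs :: "nat \<Rightarrow> nat \<Rightarrow> nat \<Rightarrow> flt vec set" where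
  "fvecs p q n = {x \<in> carrier_vec n. \<forall>i < n. x $ i \<in> flts p q}"

definition wf_mha :: "nat \<Rightarrow> nat \<Rightarrow> dims \<Rightarrow> mha \<Rightarrow> bool" where
  "wf_mha p q D M \<longleftrightarrow> heads M \<noteq> [] \<and>
     (\<forall>H \<in> set (heads M). WQ H \<in> fmats p q (dmodel D) (dkey D) \<and>
        WK H \<in> fmats p q (dmodel D) (dkey D) \<and> WV H \<in> fmats p q (dmodel D) (dval D)) \<and>
     WO M \<in> fmats p q (length (heads M) * dval D) (dmodel D)"

definition wf_mlp :: "nat \<Rightarrow> nat \<Rightarrow> dims \<Rightarrow> mlp \<Rightarrow> bool" where
  "wf_mlp p q D N \<longleftrightarrow>
     W1 N \<in> fmats p q (dmodel D) (dff D) \<and> b1 N \<in> fvecs p q (dff D) \<and>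
     W2 N \<in> fmats p q (dff D) (dmodel D) \<and> b2 N \<in> fvecs p q (dmodel D)"

definition wf_transformer :: "'a set \<Rightarrow> 'a transformer \<Rightarrow> bool" where
  "wf_transformer \<Sigma> T \<longleftrightarrow> (let p = prec T; q = expo T; D = tdims T in
     p \<ge> 1 \<and> q \<ge> 1 \<and>
     dmodel D \<ge> 1 \<and> dkey D \<ge> 1 \<and> dval D \<ge> 1 \<and> dff D \<ge> 1 \<and> dout D \<ge> 1 \<and>
     (\<forall>l \<in> labels \<Sigma>. emb T l \<in> fvecs p q (dmodel D)) \<and>
     enc T \<noteq> [] \<and> (\<forall>L \<in> set (enc T). wf_mha p q D (enc_self L) \<and> wf_mlp p q D (enc_mlp L)) \<and>
     dec T \<noteq> [] \<and> (\<forall>L \<in> set (dec T). wf_mha p q D (dec_self L) \<and> wf_mha p q D (dec_cross L) \<and>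
                                    wf_mlp p q D (dec_mlp L)) \<and>
     Wout T \<in> fmats p q (dmodel D) (dout D) \<and> bout T \<in> fvecs p q (dout D))"

definition attention ::
  "(nat \<Rightarrow> nat \<Rightarrow> flt \<Rightarrow> flt) \<Rightarrow> nat \<Rightarrow> nat \<Rightarrow> dims \<Rightarrow> bool \<Rightarrow> head \<Rightarrow> flt mat \<Rightarrow> flt mat \<Rightarrow> flt mat" where
  "attention E p q D masked H X Y =
     (let S = map_mat (\<lambda>x. fdiv p q x (fround p q False (sqrt (real (dkey D)))))
                (fmat_mult p q (fmat_mult p q Y (WQ H)) (transpose_mat (fmat_mult p q X (WK H))));
          V = fmat_mult p q X (WV H)
      in if masked then fmat_mult_causal p q (softmax_rows E p q (causal_mask S)) V
         else fmat_mult p q (softmax_rows E p q S) V)"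

text \<open>The head outputs, each with \<open>w\<close> columns and \<open>n\<close> rows, side by side.\<close>

definition concat_cols :: "nat \<Rightarrow> nat \<Rightarrow> flt mat list \<Rightarrow> flt mat" where
  "concat_cols n w As = mat n (length As * w) (\<lambda>(i, j). (As ! (j div w)) $$ (i, j mod w))"

definition multi_head ::
  "(nat \<Rightarrow> nat \<Rightarrow> flt \<Rightarrow> flt) \<Rightarrow> nat \<Rightarrow> nat \<Rightarrow> dims \<Rightarrow> bool \<Rightarrow> mha \<Rightarrow> flt mat \<Rightarrow> flt mat \<Rightarrow> flt mat" where
  "multi_head E p q D masked M X Y =
     fmat_mult p q
       (concat_cols (dim_row Y) (dval D) (map (\<lambda>H. attention E p q D masked H X Y) (heads M)))
       (WO M)"

definition mlp_apply :: "nat \<Rightarrow> nat \<Rightarrow> mlp \<Rightarrow> flt mat \<Rightarrow> flt mat" where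
  "mlp_apply p q N X =
     fmat_add_bias p q
       (fmat_mult p q (map_mat frelu (fmat_add_bias p q (fmat_mult p q X (W1 N)) (b1 N))) (W2 N))
       (b2 N)"

definition encoder_layer ::
  "(nat \<Rightarrow> nat \<Rightarrow> flt \<Rightarrow> flt) \<Rightarrow> nat \<Rightarrow> nat \<Rightarrow> dims \<Rightarrow> enc_layer \<Rightarrow> flt mat \<Rightarrow> flt mat" where
  "encoder_layer E p q D L X =
     (let X' = fmat_add p q (multi_head E p q D False (enc_self L) X X) X
      in fmat_add p q (mlp_apply p q (enc_mlp L) X') X')"

definition decoder_layer ::
  "(nat \<Rightarrow> nat \<Rightarrow> flt \<Rightarrow> flt) \<Rightarrow> nat \<Rightarrow> nat \<Rightarrow> dims \<Rightarrow> dec_layer \<Rightarrow> flt mat \<Rightarrow> flt mat \<Rightarrow> flt mat" where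
  "decoder_layer E p q D L X Y =
     (let Y' = fmat_add p q (multi_head E p q D True (dec_self L) Y Y) Y;
          Y'' = fmat_add p q (multi_head E p q D False (dec_cross L) X Y') Y'
      in fmat_add p q (mlp_apply p q (dec_mlp L) Y'') Y'')"

definition transformer_matrix ::
  "(nat \<Rightarrow> nat \<Rightarrow> flt \<Rightarrow> flt) \<Rightarrow> 'a transformer \<Rightarrow> 'a graph \<Rightarrow> flt mat" where
  "transformer_matrix E T G =
     (let p = prec T; q = expo T; D = tdims T; w = bos G;
          X = fold (encoder_layer E p q D) (enc T)
                (mat_of_rows (dmodel D) (map (emb T) (take w G)));
          Y = fold (\<lambda>L. decoder_layer E p q D L X) (dec T)
                (mat_of_rows (dmodel D) (map (emb T) (drop w G)))
      in fmat_add_bias p q (fmat_mult p q Y (Wout T)) (bout T))"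

definition transformer_row ::
  "(nat \<Rightarrow> nat \<Rightarrow> flt \<Rightarrow> flt) \<Rightarrow> 'a transformer \<Rightarrow> 'a graph \<Rightarrow> nat \<Rightarrow> flt list" where
  "transformer_row E T G v = list_of_vec (row (transformer_matrix E T G) (v - bos G))"

definition bitwise_output ::
  "(nat \<Rightarrow> nat \<Rightarrow> flt \<Rightarrow> flt) \<Rightarrow> (nat \<Rightarrow> nat \<Rightarrow> bool list) \<Rightarrow> 'a transformer \<Rightarrow>
   'a graph \<Rightarrow> nat \<Rightarrow> bool list option" where
  "bitwise_output E nan T G v =
     Some (concat (map (flt_bits nan (prec T) (expo T)) (transformer_row E T G v)))"

text \<open>\<open>None\<close> when some entry represents neither 0 nor 1.\<close>

definition featurewise_output ::
  "(nat \<Rightarrow> nat \<Rightarrow> flt \<Rightarrow> flt) \<Rightarrow> 'a transformer \<Rightarrow> 'a graph \<Rightarrow> nat \<Rightarrow> bool list option" where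
  "featurewise_output E T G v =
     (let p = prec T; q = expo T; xs = transformer_row E T G v
      in if \<forall>x \<in> set xs. represents p q x 0 \<or> represents p q x 1
         then Some (map (\<lambda>x. represents p q x 1) xs) else None)"


section \<open>The logic\<close>

datatype 'a gptl =
    Bot
  | Prop 'a
  | Neg "'a gptl"
  | Conj "'a gptl" "'a gptl"
  | GPre nat "'a gptl"
  | PSuf "'a gptl"

primrec sat :: "'a graph \<Rightarrow> nat \<Rightarrow> 'a gptl \<Rightarrow> bool" where
  "sat G v Bot \<longleftrightarrow> False"
| "sat G v (Prop a) \<longleftrightarrow> G ! v = Some a"
| "sat G v (Neg \<phi>) \<longleftrightarrow> \<not> sat G v \<phi>"
| "sat G v (Conj \<phi> \<psi>) \<longleftrightarrow> sat G v \<phi> \<and> sat G v \<psi>"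
| "sat G v (GPre k \<phi>) \<longleftrightarrow> card {u \<in> prefix_vertices G. sat G u \<phi>} \<ge> k"
| "sat G v (PSuf \<phi>) \<longleftrightarrow> (\<exists>u \<in> suffix_vertices G. u < v \<and> sat G u \<phi>)"

definition wf_formulas :: "'a set \<Rightarrow> 'a gptl list \<Rightarrow> bool" where
  "wf_formulas \<Sigma> \<phi>s \<longleftrightarrow> \<phi>s \<noteq> [] \<and> (\<forall>\<phi> \<in> set \<phi>s. set_gptl \<phi> \<subseteq> \<Sigma>)"

definition formulas_output :: "'a gptl list \<Rightarrow> 'a graph \<Rightarrow> nat \<Rightarrow> bool list option" where
  "formulas_output \<phi>s G v = Some (map (sat G v) \<phi>s)"


section \<open>CPG-automata\<close>

type_synonym state = "bool list"

record 'a cpg =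
  width :: nat
  cap :: nat
  states :: "state set"
  initial :: "'a option \<Rightarrow> state"
  delta :: "state \<Rightarrow> state multiset \<Rightarrow> state multiset \<Rightarrow> state"
  rounds :: nat
  outlen :: nat

definition capped :: "nat \<Rightarrow> 'b multiset \<Rightarrow> 'b multiset" where
  "capped k M = M \<inter># repeat_mset k (mset_set (set_mset M))"

definition capped_msets :: "nat \<Rightarrow> 'b set \<Rightarrow> 'b multiset set" where
  "capped_msets k Q = {M. set_mset M \<subseteq> Q \<and> (\<forall>x. count M x \<le> k)}"

definition wf_cpg :: "'a set \<Rightarrow> 'a cpg \<Rightarrow> bool" where
  "wf_cpg \<Sigma> A \<longleftrightarrow>
     finite (states A) \<and> states A \<noteq> {} \<and> (\<forall>x \<in> states A. length x = width A) \<and>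
     (\<forall>l \<in> labels \<Sigma>. initial A l \<in> states A) \<and>
     (\<forall>x \<in> states A. \<forall>M \<in> capped_msets (cap A) (states A). \<forall>N \<in> capped_msets (cap A) (states A).
        delta A x M N \<in> states A) \<and>
     1 \<le> outlen A \<and> outlen A \<le> width A"

primrec cpg_state :: "'a cpg \<Rightarrow> 'a graph \<Rightarrow> nat \<Rightarrow> nat \<Rightarrow> state" where
  "cpg_state A G 0 = (\<lambda>v. initial A (G ! v))"
| "cpg_state A G (Suc t) = (\<lambda>v. delta A (cpg_state A G t v)
     (capped (cap A) (image_mset (cpg_state A G t) (mset_set (prefix_vertices G))))
     (capped (cap A) (image_mset (cpg_state A G t) (mset_set {u \<in> suffix_vertices G. u < v}))))"

definition cpg_output :: "'a cpg \<Rightarrow> 'a graph \<Rightarrow> nat \<Rightarrow> bool list option" where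
  "cpg_output A G v = Some (take (outlen A) (cpg_state A G (rounds A) v))"


section \<open>Equivalence\<close>

definition equivalent ::
  "'a set \<Rightarrow> ('a graph \<Rightarrow> nat \<Rightarrow> bool list option) \<Rightarrow>
   ('a graph \<Rightarrow> nat \<Rightarrow> bool list option) \<Rightarrow> bool" where
  "equivalent \<Sigma> f g \<longleftrightarrow> (\<forall>G v. two_sorted \<Sigma> G \<longrightarrow> v \<in> suffix_vertices G \<longrightarrow> f G v = g G v)"

end

theory Submission
  imports Defs
begin

text \<open>
  \<^bold>\<open>From transformers and automata to formulas.\<close> A float sum taken in increasing order adds equal summands
  consecutively. Since the format is finite and adding a fixed float is monotone in the accumulator,
  repeating a summand eventually has no effect. Hence attention depends only on the multiset of keys up
  to a fixed cap, and the only counting that is needed, ``at least \<open>k\<close> prefix vertices'' and ``at least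
  \<open>k\<close> earlier suffix vertices'', is expressible. The latter reduces to iterated \<open>PSuf\<close> because the past is
  linearly ordered.

  \<^bold>\<open>From formulas to transformers.\<close> One layer per subformula. Only \<open>exp 0 = 1\<close> and \<open>exp (- \<infinity>) = 0\<close> are known,
  so scores are arranged to differ by \<open>0\<close> or by an overflow to \<open>- \<infinity>\<close>. For \<open>PSuf \<phi>\<close>, vertices satisfying \<open>\<phi>\<close>
  suppress the BOS vertex, whose weight is otherwise exactly \<open>1\<close>. For \<open>GPre k \<phi>\<close>, each of the \<open>m\<close> vertices
  satisfying \<open>\<phi>\<close> has weight about \<open>1 / m\<close> and value \<open>x = \<lceil>k / 2\<rceil>\<close> in units of the least positive float, so
  that the head outputs \<open>z = m \<cdot> round (x / m)\<close> units. Then \<open>1 \<le> z < k\<close> if \<open>1 \<le> m < k\<close>, while \<open>z = 0\<close> or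
  \<open>z \<ge> k\<close> if \<open>m \<ge> k\<close>; a second, large value coordinate tells \<open>m = 0\<close> apart.
\<close>

section \<open>Floating-point formats\<close>

text \<open>Softmax averages, so a count cancels against the normalisation of the weights. For
  \<open>GPre\<close> it is recovered from rounding. Products at the bottom of the format are
  rounded to multiples of the least positive float with an absolute error of half a unit; further up
  the error is relative and no quotient \<open>x / m\<close> of moderate size would vanish. Since
  \<open>x / m\<close> exceeds 1/2 just for \<open>m < 2 * x\<close>, and \<open>2 * x\<close> is
  \<open>k\<close> or \<open>k + 1\<close>, each of the \<open>m\<close> contributions is positive
  below the threshold and zero well above it. Around the threshold the weight is itself rounded and
  a contribution may go either way, which is harmless: if positive, \<open>m\<close> of them amount
  to at least \<open>m \<ge> k\<close> units. The target format may be chosen, so its precision is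
  taken large enough for the errors of the weights to stay negligible.

  In the opposite direction the format is given and the obstacle is the mask: the number of masked
  positions of a row is unbounded and depends on later vertices. Each of them adds the same 0 or NaN
  to the softmax denominator, and both are idempotent, so that only the presence of a masked
  position matters.\<close>

locale format =
  fixes p q :: nat
  assumes p_pos: "1 \<le> p" and q_pos: "1 \<le> q"
begin

text \<open>The least positive float, with exponent 0 and significand 1. Every finite float is an
  integer multiple of it, and all later computations are in this unit.\<close>

definition eta :: real where
  "eta = 2 powi (1 - int p - bias q)"

lemma eta_pos: "0 < eta"
  by (simp add: eta_def)

lemma two_powi_nat: "(2::real) powi (int n) = 2 ^ n"
  by (simp add: power_int_def)

lemma mag_eq: "mag p q e s = real s * 2 ^ e * eta"
proof -
  have "(2::real) ^ (p - 1) = 2 powi (int p - 1)"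
    using two_powi_nat[of "p - 1"] p_pos by (simp add: of_nat_diff)
  moreover have "(2::real) powi (int e - bias q) = 2 powi (int p - 1) * (2 ^ e * eta)"
  proof -
    have "int e - bias q = int p - 1 + (int e + (1 - int p - bias q))"
      by simp
    then show ?thesis
      unfolding eta_def two_powi_nat[symmetric] by (metis power_int_add zero_neq_numeral)
  qed
  ultimately show ?thesis
    unfolding mag_def by (simp add: field_simps)
qed

text \<open>In units of \<open>eta\<close> the largest finite magnitude is
  \<open>(2 ^ p - 1) * 2 ^ (2 ^ q - 1)\<close>; the bound lies half a unit in the last place above
  it.\<close>

lemma overflow_bound_eq: "overflow_bound p q = (2 ^ p - 1 / 2) * 2 ^ (2 ^ q - 1) * eta"
proof -
  have "(2::real) powi (2 ^ q - 1 - bias q) = 2 powi (int (2 ^ q - 1)) * 2 powi (int p - 1) * eta"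
    unfolding eta_def by (simp add: of_nat_diff algebra_simps flip: power_int_add)
  also have "\<dots> = 2 ^ (2 ^ q - 1) * 2 ^ (p - 1) * eta"
  proof -
    have "int p - 1 = int (p - 1)"
      using p_pos by simp
    then show ?thesis
      by (simp only: two_powi_nat)
  qed
  finally have *: "(2::real) powi (2 ^ q - 1 - bias q) = 2 ^ (2 ^ q - 1) * 2 ^ (p - 1) * eta" .
  have "(2::real) ^ p = 2 * 2 ^ (p - 1)"
    using p_pos by (cases p) auto
  then show ?thesis
    unfolding overflow_bound_def * by (simp add: field_simps)
qed

lemma ok_zero: "fl_ok p q 0 0"
  by (simp add: fl_ok_def subnormalised_def)

lemma ok_bound: "fl_ok p q e s \<Longrightarrow> e < 2 ^ q \<and> s < 2 ^ p"
proof -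
  have "(2::nat) ^ (p - 1) \<le> 2 ^ p"
    by (rule power_increasing) auto
  then show "fl_ok p q e s \<Longrightarrow> e < 2 ^ q \<and> s < 2 ^ p"
    unfolding fl_ok_def normalised_def subnormalised_def by (meson less_le_trans zero_less_power pos2)
qed

lemma finite_ok: "finite {(e, s). fl_ok p q e s}"
  by (rule finite_subset[of _ "{..<2 ^ q} \<times> {..<2 ^ p}"]) (auto dest: ok_bound)

lemma finite_flts: "finite (flts p q)"
proof -
  have "flts p q \<subseteq> (\<lambda>(b, e, s). Fl b e s) ` (UNIV \<times> {..<2 ^ q} \<times> {..<2 ^ p}) \<union> {Infty True, Infty False, NaN}"
    unfolding flts_def by (auto dest: ok_bound intro!: image_eqI)
  then show ?thesis
    by (rule finite_subset) auto
qed

lemma Fl_in_flts [simp]: "Fl b e s \<in> flts p q \<longleftrightarrow> fl_ok p q e s"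
  and Infty_in_flts [simp]: "Infty b \<in> flts p q"
  and NaN_in_flts [simp]: "NaN \<in> flts p q"
  and fzero_in_flts [simp]: "fzero b \<in> flts p q"
  by (cases b; auto simp: flts_def fzero_def ok_zero)+

text \<open>A positive exponent forces a leading bit 1, so the float with the larger exponent has
  \<open>s' \<ge> 2 ^ (p - 1)\<close>, which outweighs every significand below \<open>2 ^ p\<close>
  at a smaller exponent. Unnormalised pairs would break this.\<close>

lemma code_less_imp_mag_less:
  assumes "fl_ok p q e s" "fl_ok p q e' s'" "e * 2 ^ p + s < e' * 2 ^ p + s'"
  shows "mag p q e s < mag p q e' s'"
proof -
  have b: "s < 2 ^ p" "s' < 2 ^ p"
    using assms ok_bound by auto
  have "\<not> e' < e"
  proof
    assume "e' < e"
    then have "(e' + 1) * 2 ^ p \<le> e * 2 ^ p"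
      by (intro mult_right_mono) auto
    then show False
      using assms(3) b by simp
  qed
  then consider "e = e'" "s < s'" | "e < e'"
    using assms(3) by fastforce
  then show ?thesis
  proof cases
    case 1
    then show ?thesis
      using eta_pos by (simp add: mag_eq)
  next
    case 2
    then have s': "2 ^ (p - 1) \<le> s'"
      using assms(2) by (auto simp: fl_ok_def normalised_def subnormalised_def)
    have "s * 2 ^ e < 2 ^ p * 2 ^ e"
      using b by simp
    also have "\<dots> = 2 ^ (p - 1) * 2 ^ (e + 1)"
      using p_pos by (cases p) auto
    also have "\<dots> \<le> s' * 2 ^ e'"
      using s' 2 by (intro mult_mono power_increasing) auto
    finally have "real (s * 2 ^ e) < real (s' * 2 ^ e')"
      by (rule iffD2[OF of_nat_less_iff])
    then show ?thesis
      using eta_pos by (simp add: mag_eq)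
  qed
qed

lemma code_inj:
  assumes "fl_ok p q e s" "fl_ok p q e' s'" "e * 2 ^ p + s = e' * 2 ^ p + s'"
  shows "e = e' \<and> s = s'"
proof -
  have b: "s < 2 ^ p" "s' < 2 ^ p"
    using assms ok_bound by auto
  then have "e = (e * 2 ^ p + s) div 2 ^ p" "e' = (e' * 2 ^ p + s') div 2 ^ p"
    by auto
  then show ?thesis
    using assms(3) by simp
qed

lemma mag_le_imp_code_le:
  assumes "fl_ok p q e s" "fl_ok p q e' s'" "mag p q e s \<le> mag p q e' s'"
  shows "e * 2 ^ p + s \<le> e' * 2 ^ p + s'"
  using code_less_imp_mag_less[OF assms(2,1)] assms(3) by linarith

lemma mag_inj:
  assumes "fl_ok p q e s" "fl_ok p q e' s'" "mag p q e s = mag p q e' s'"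
  shows "e = e' \<and> s = s'"
  using mag_le_imp_code_le[OF assms(1,2)] mag_le_imp_code_le[OF assms(2,1)] assms code_inj by force

lemma mag_nonneg: "0 \<le> mag p q e s"
  using eta_pos by (simp add: mag_eq)

lemma mag_zero_iff: "mag p q e s = 0 \<longleftrightarrow> s = 0"
  using eta_pos by (simp add: mag_eq)

lemma mag_less_overflow:
  assumes "fl_ok p q e s"
  shows "mag p q e s < overflow_bound p q"
proof -
  have b: "e \<le> 2 ^ q - 1" "s + 1 \<le> 2 ^ p"
    using ok_bound[OF assms] by auto
  have "real (s + 1) \<le> real (2 ^ p)"
    using b(2) by (rule of_nat_mono)
  then have s: "real s < 2 ^ p - 1 / 2"
    by simp
  have "real s * 2 ^ e \<le> real s * 2 ^ (2 ^ q - 1)"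
    using b by (intro mult_left_mono power_increasing) auto
  also have "\<dots> < (2 ^ p - 1 / 2) * 2 ^ (2 ^ q - 1)"
    using s by simp
  finally show ?thesis
    using eta_pos by (simp add: mag_eq overflow_bound_eq)
qed

lemma nearest_nonempty: "nearest p q r \<noteq> {}"
proof -
  let ?f = "\<lambda>(e, s). \<bar>mag p q e s - r\<bar>"
  obtain x where "is_arg_min ?f (\<lambda>x. x \<in> {(e, s). fl_ok p q e s}) x"
    using ex_is_arg_min_if_finite[OF finite_ok, of ?f] ok_zero by blast
  then have "x \<in> nearest p q r"
    unfolding is_arg_min_linorder nearest_def by (cases x) auto
  then show ?thesis
    by blast
qed

lemma nearest_ok: "(e, s) \<in> nearest p q r \<Longrightarrow> fl_ok p q e s"
  by (simp add: nearest_def)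

text \<open>The choice operator in \<open>fround\<close> needs a witness: among the nearest
  candidates with even significand, or among all of them if there is none, one of the largest
  magnitude.\<close>

lemma fround_nearest:
  assumes "r < overflow_bound p q"
  obtains e s where "fround p q b r = Fl b e s" "(e, s) \<in> nearest p q r"
proof -
  let ?N = "nearest p q r"
  let ?P = "\<lambda>(e, s). (e, s) \<in> ?N \<and> (\<forall>(e', s') \<in> ?N.
      (even s' \<longrightarrow> even s) \<and> (even s' = even s \<longrightarrow> mag p q e' s' \<le> mag p q e s))"
  have fin: "finite ?N"
    by (rule finite_subset[OF _ finite_ok]) (auto simp: nearest_def)
  have "\<exists>x. ?P x"
  proof -
    define M where "M = (if \<exists>(e, s) \<in> ?N. even s then {(e, s) \<in> ?N. even s} else ?N)"
    have "M \<noteq> {}" and sub: "M \<subseteq> ?N"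
      using nearest_nonempty[of r] by (auto simp: M_def)
    moreover have "finite M"
      using finite_subset[OF sub fin] .
    ultimately obtain x where x: "is_arg_min (\<lambda>(e, s). - mag p q e s) (\<lambda>x. x \<in> M) x"
      using ex_is_arg_min_if_finite by blast
    then have "x \<in> M" "\<And>e s. (e, s) \<in> M \<Longrightarrow> mag p q e s \<le> mag p q (fst x) (snd x)"
      unfolding is_arg_min_linorder by (auto split: prod.splits)
    then have "?P x"
      unfolding M_def by (cases x) (auto split: if_splits)
    then show ?thesis ..
  qed
  then have "?P (SOME x. ?P x)"
    by (rule someI_ex)
  then show thesis
    using that assms unfolding fround_def by (auto split: prod.splits)
qed

lemma fround_in_flts [simp]: "fround p q b r \<in> flts p q"
proof (cases "r < overflow_bound p q")
  case True
  then show ?thesis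
    by (rule fround_nearest[of r b]) (simp add: nearest_def)
qed (simp add: fround_def)

text \<open>Rounding cannot cross an element of the format, because that element competes for being
  nearest and would win. With \<open>nearest_le\<close> this is the monotonicity on which both
  directions rest.\<close>

lemma nearest_ge:
  assumes "(e, s) \<in> nearest p q r" "fl_ok p q e' s'" "mag p q e' s' \<le> r"
  shows "mag p q e' s' \<le> mag p q e s"
proof -
  have "\<bar>mag p q e s - r\<bar> \<le> \<bar>mag p q e' s' - r\<bar>"
    using assms by (simp add: nearest_def del: abs_of_nonneg abs_of_nonpos)
  then show ?thesis
    using assms(3) by linarith
qed

lemma nearest_le:
  assumes "(e, s) \<in> nearest p q r" "fl_ok p q e' s'" "r \<le> mag p q e' s'"
  shows "mag p q e s \<le> mag p q e' s'"
proof -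
  have "\<bar>mag p q e s - r\<bar> \<le> \<bar>mag p q e' s' - r\<bar>"
    using assms by (simp add: nearest_def del: abs_of_nonneg abs_of_nonpos)
  then show ?thesis
    using assms(3) by linarith
qed

lemma fround_mag:
  assumes "fl_ok p q e s"
  shows "fround p q b (mag p q e s) = Fl b e s"
proof (rule fround_nearest[OF mag_less_overflow[OF assms], of b])
  fix e' s'
  assume *: "fround p q b (mag p q e s) = Fl b e' s'" "(e', s') \<in> nearest p q (mag p q e s)"
  have "mag p q e' s' = mag p q e s"
    using nearest_le[OF *(2) assms order_refl] nearest_ge[OF *(2) assms order_refl] by (rule antisym)
  then have "e' = e \<and> s' = s"
    by (rule mag_inj[OF nearest_ok[OF *(2)] assms])
  then show ?thesis
    using * by simp
qed

lemma fadd_in_flts [simp]: "fadd p q x y \<in> flts p q"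
  by (cases "(p, q, x, y)" rule: fadd.cases) (auto simp: Let_def)

lemma fsub_in_flts [simp]: "fsub p q x y \<in> flts p q"
  by (simp add: fsub_def)

lemma fmul_in_flts [simp]: "fmul p q x y \<in> flts p q"
  by (cases "(p, q, x, y)" rule: fmul.cases) auto

lemma fdiv_in_flts [simp]: "fdiv p q x y \<in> flts p q"
  by (cases "(p, q, x, y)" rule: fdiv.cases) auto

section \<open>Codes and the injectivity of the rank\<close>

definition code :: "nat \<Rightarrow> nat \<Rightarrow> int" where
  "code e s = int (e * 2 ^ p + s)"

lemma code_nonneg: "0 \<le> code e s"
  by (simp add: code_def)

lemma code_less: "fl_ok p q e s \<Longrightarrow> code e s < 2 ^ (p + q)"
proof -
  assume "fl_ok p q e s"
  note b = ok_bound[OF this]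
  have "(e + 1) * 2 ^ p \<le> 2 ^ q * 2 ^ p"
    using b by (intro mult_right_mono) auto
  then have "e * 2 ^ p + s < 2 ^ q * 2 ^ p"
    using b by simp
  then have "code e s < int (2 ^ q * 2 ^ p)"
    unfolding code_def by (rule iffD2[OF of_nat_less_iff])
  then show ?thesis
    by (simp add: power_add mult.commute)
qed

lemma rank_Fl: "rank p q (Fl b e s) = (if b then - 1 - code e s else code e s)"
  by (simp add: code_def)

lemmas rank_simps = rank_Fl rank.simps(2,3)

text \<open>Codes of finite floats fill part of the interval from 0 to
  \<open>2 ^ (p + q) - 1\<close>. The shift by -1 on the negative side separates the two zeros, and
  the infinities and NaN lie outside. Injectivity makes the sorted list, and hence a sum, a function
  of the multiset of summands.\<close>

lemma rank_inj: "inj_on (rank p q) (flts p q)"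
proof (rule inj_onI)
  fix x y
  assume xy: "x \<in> flts p q" "y \<in> flts p q" "rank p q x = rank p q y"
  have pp: "(0::int) < 2 ^ (p + q)"
    by simp
  show "x = y"
  proof (cases x; cases y)
    fix b e s b' e' s'
    assume *: "x = Fl b e s" "y = Fl b' e' s'"
    then have ok: "fl_ok p q e s" "fl_ok p q e' s'"
      using xy by auto
    have "b = b' \<and> code e s = code e' s'"
      using xy(3) code_nonneg[of e s] code_nonneg[of e' s'] unfolding * rank_Fl
      by (smt (verit, best))
    then show ?thesis
      using code_inj[OF ok] * unfolding code_def of_nat_eq_iff by simp
  next
    fix b e s b'
    assume *: "x = Fl b e s" "y = Infty b'"
    then show ?thesis
      using xy(1,3) code_nonneg[of e s] code_less[of e s] pp unfolding * rank_simps
      by (auto split: if_splits)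
  next
    fix b e s b'
    assume *: "y = Fl b e s" "x = Infty b'"
    then show ?thesis
      using xy(2,3) code_nonneg[of e s] code_less[of e s] pp unfolding * rank_simps
      by (auto split: if_splits)
  next
    fix b e s
    assume *: "x = Fl b e s" "y = NaN"
    then show ?thesis
      using xy(1,3) code_nonneg[of e s] code_less[of e s] pp unfolding * rank_simps
      by (auto split: if_splits)
  next
    fix b e s
    assume *: "y = Fl b e s" "x = NaN"
    then show ?thesis
      using xy(2,3) code_nonneg[of e s] code_less[of e s] pp unfolding * rank_simps
      by (auto split: if_splits)
  next
    fix b b'
    assume *: "x = Infty b" "y = Infty b'"
    have "- 1 - (2::int) ^ (p + q) \<noteq> 2 ^ (p + q)"
      using pp by linarith
    then show ?thesis
      using xy(3) unfolding * rank_simps by (cases b; cases b') force+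
  next
    fix b
    assume *: "x = Infty b" "y = NaN"
    then show ?thesis
      using xy(3) pp unfolding * rank_simps by (cases b; simp only: if_True if_False; linarith)
  next
    fix b
    assume *: "x = NaN" "y = Infty b"
    then show ?thesis
      using xy(3) pp unfolding * rank_simps by (cases b; simp only: if_True if_False; linarith)
  qed simp
qed

end

section \<open>Sums depend only on capped multiplicities\<close>

text \<open>Along an orbit \<mu> grows strictly until a fixed point is met. Without a fixed point
  within \<open>card S\<close> steps there would be more than \<open>card S\<close> distinct
  elements of \<open>S\<close>.\<close>

lemma funpow_stabilises:
  fixes f :: "'b \<Rightarrow> 'b" and \<mu> :: "'b \<Rightarrow> int"
  assumes "finite S" and closed: "\<And>s. s \<in> S \<Longrightarrow> f s \<in> S"
    and incr: "\<And>s. s \<in> S \<Longrightarrow> f s = s \<or> \<mu> s < \<mu> (f s)"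
    and "s \<in> S" "card S \<le> c"
  shows "(f ^^ c) s = (f ^^ card S) s"
proof -
  have inS: "(f ^^ n) s \<in> S" for n
    using \<open>s \<in> S\<close> closed by (induction n) auto
  have fixed: "(f ^^ (n + m)) s = (f ^^ n) s" if "f ((f ^^ n) s) = (f ^^ n) s" for n m
    using that by (induction m) auto
  have "\<exists>n \<le> card S. f ((f ^^ n) s) = (f ^^ n) s"
  proof (rule ccontr)
    assume "\<not> ?thesis"
    then have "\<mu> ((f ^^ n) s) < \<mu> ((f ^^ Suc n) s)" if "n \<le> card S" for n
      using incr[OF inS[of n]] that by auto
    then have mono: "\<mu> ((f ^^ n) s) < \<mu> ((f ^^ m) s)" if "n < m" "m \<le> Suc (card S)" for n m
      using that
    proof (induction m)
      case (Suc m)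
      then show ?case
        by (cases "n = m") (fastforce simp: less_Suc_eq)+
    qed simp
    have "inj_on (\<lambda>n. (f ^^ n) s) {..card S}"
    proof (rule inj_onI)
      fix m n
      assume *: "m \<in> {..card S}" "n \<in> {..card S}" "(f ^^ m) s = (f ^^ n) s"
      then show "m = n"
        using mono[of m n] mono[of n m] by (cases m n rule: linorder_cases) auto
    qed
    then have "card {..card S} \<le> card S"
      using inS \<open>finite S\<close> by (intro card_inj_on_le) auto
    then show False
      by simp
  qed
  then obtain n where n: "n \<le> card S" "f ((f ^^ n) s) = (f ^^ n) s"
    by blast
  then show ?thesis
    using fixed[of n "c - n"] fixed[of n "card S - n"] \<open>card S \<le> c\<close> by simp
qed

lemma count_concat_replicate:
  "distinct ys \<Longrightarrow> count (mset (concat (map (\<lambda>y. replicate (c y) y) ys))) a = (if a \<in> set ys then c a else 0)"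
  by (induction ys) auto

lemma sorted_concat_replicate:
  "sorted (map f ys) \<Longrightarrow> sorted (map f (concat (map (\<lambda>y. replicate (c y) y) ys)))"
  by (induction ys) (auto simp: sorted_append)

text \<open>The abstraction of a list that attention and automata can observe. Being a function, it
  turns the equivalence of lists into an equation.\<close>

definition capcount :: "nat \<Rightarrow> 'b list \<Rightarrow> 'b \<Rightarrow> nat" where
  "capcount K xs = (\<lambda>y. min K (count (mset xs) y))"

lemma capcount_set_eq:
  assumes "capcount K xs = capcount K ys" "1 \<le> K"
  shows "set xs = set ys"
proof -
  have "set zs = {x. capcount K zs x \<noteq> 0}" for zs :: "'a list"
  proof -
    have "min K n = 0 \<longleftrightarrow> n = 0" for n
      using assms(2) by (auto simp: min_def)
    then show ?thesis
      by (auto simp: capcount_def count_mset_0_iff)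
  qed
  then show ?thesis
    using assms(1) by simp
qed

lemma min_sum_min:
  fixes a :: "'b \<Rightarrow> nat"
  assumes "finite A"
  shows "min K (sum a A) = min K (\<Sum>i \<in> A. min K (a i))"
  using assms by (induction A rule: finite_induct) auto

text \<open>The multiplicity of \<open>y\<close> in the image is the sum of the multiplicities over
  its fibre, and capping the terms does not change the capped sum. For \<open>K = 0\<close> the two
  lists may have different elements, so that case is separate.\<close>

lemma capcount_map:
  assumes "capcount K xs = capcount K ys"
  shows "capcount K (map f xs) = capcount K (map f ys)"
proof (cases "K = 0")
  case False
  then have sets: "set xs = set ys"
    using capcount_set_eq[OF assms] by simp
  have "capcount K (map f zs) y = min K (\<Sum>x \<in> f -` {y} \<inter> set zs. capcount K zs x)" for zs :: "'a list" and y
    unfolding capcount_def mset_map count_image_mset by (simp add: min_sum_min[of _ _ "count (mset zs)"])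
  then show ?thesis
    unfolding fun_eq_iff using assms sets by simp
qed (simp add: capcount_def)

context format
begin

text \<open>The accumulator is an option because no float is neutral at the start of a sum: starting
  from +0 would turn a lone -0 into +0.\<close>

definition step :: "flt \<Rightarrow> flt option \<Rightarrow> flt option" where
  "step y s = Some (case s of None \<Rightarrow> y | Some a \<Rightarrow> fadd p q a y)"

definition psums :: "flt option set" where
  "psums = insert None (Some ` flts p q)"

lemma finite_psums: "finite psums"
  by (simp add: psums_def finite_flts)

lemma step_in_psums: "y \<in> flts p q \<Longrightarrow> step y s \<in> psums"
  by (auto simp: step_def psums_def split: option.splits)

lemma foldl_step: "foldl (\<lambda>s y. step y s) (Some a) ys = Some (foldl (fadd p q) a ys)"
  by (induction ys arbitrary: a) (auto simp: step_def)

lemma fsum_foldl_step: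
  "fsum p q xs = (case foldl (\<lambda>s y. step y s) None (sort_key (rank p q) xs) of
     None \<Rightarrow> fzero False | Some a \<Rightarrow> a)"
proof (cases "sort_key (rank p q) xs")
  case (Cons y ys)
  have "step y None = Some y"
    by (simp add: step_def)
  then show ?thesis
    by (simp add: fsum_def Cons foldl_step)
qed (simp add: fsum_def)

lemma foldl_step_replicate: "foldl (\<lambda>s y. step y s) s (replicate n y) = (step y ^^ n) s"
  by (induction n arbitrary: s) (auto simp: funpow_swap1)

text \<open>The sorted list consists of blocks of equal floats, in an order common to all lists. A
  sum is therefore a composition of iterates of \<open>step y\<close>, one for each float of the
  format, and may be compared block by block.\<close>

lemma fsum_cong_step:
  assumes "set xs \<subseteq> flts p q" "set xs' \<subseteq> flts p q"
    and eq: "\<And>y s. y \<in> flts p q \<Longrightarrow> s \<in> psums \<Longrightarrow>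
      (step y ^^ count (mset xs) y) s = (step y ^^ count (mset xs') y) s"
  shows "fsum p q xs = fsum p q xs'"
proof -
  obtain l where "set l = flts p q" "distinct l"
    using finite_distinct_list[OF finite_flts] by blast
  define ys where "ys = sort_key (rank p q) l"
  have ys: "set ys = flts p q" "distinct ys" "sorted (map (rank p q) ys)"
    unfolding ys_def using \<open>set l = _\<close> \<open>distinct l\<close> by auto
  have sort: "sort_key (rank p q) zs = concat (map (\<lambda>y. replicate (count (mset zs) y) y) ys)"
    if "set zs \<subseteq> flts p q" for zs
  proof (rule sort_key_inj_key_eq)
    show "mset zs = mset (concat (map (\<lambda>y. replicate (count (mset zs) y) y) ys))"
      by (rule multiset_eqI) (use that ys in \<open>auto simp: count_concat_replicate count_mset_0_iff\<close>)
    show "inj_on (rank p q) (set zs)"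
      using rank_inj that by (rule inj_on_subset)
    show "sorted (map (rank p q) (concat (map (\<lambda>y. replicate (count (mset zs) y) y) ys)))"
      using ys(3) by (rule sorted_concat_replicate)
  qed
  have fold: "foldl (\<lambda>s y. step y s) s (concat (map (\<lambda>y. replicate (c y) y) zs)) =
      foldl (\<lambda>s y. step y s) s (concat (map (\<lambda>y. replicate (c' y) y) zs))"
    if "s \<in> psums" "set zs \<subseteq> flts p q"
      "\<And>y s. y \<in> flts p q \<Longrightarrow> s \<in> psums \<Longrightarrow> (step y ^^ c y) s = (step y ^^ c' y) s"
    for s zs c c'
    using that(1,2)
  proof (induction zs arbitrary: s)
    case (Cons z zs)
    have "(step z ^^ n) s \<in> psums" for n
      using Cons.prems by (induction n) (auto intro: step_in_psums)
    then show ?case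
      using Cons that(3)[of z s] by (simp add: foldl_step_replicate)
  qed simp
  show ?thesis
    unfolding fsum_foldl_step sort[OF assms(1)] sort[OF assms(2)]
    using fold[OF _ _ eq, of None ys] ys(1) by (simp add: psums_def)
qed

text \<open>The accumulator itself is a float that rounding cannot cross, so adding a non-negative
  float leaves it unchanged or raises its rank. The empty sum gets a value below all ranks.\<close>

lemma step_pos_increases:
  assumes "fl_ok p q e s" "t \<in> psums"
  shows "step (Fl False e s) t = t \<or>
    case_option (- 2 - 2 ^ (p + q)) (rank p q) t < case_option (- 2 - 2 ^ (p + q)) (rank p q) (step (Fl False e s) t)"
proof (cases t)
  case None
  have "(0::int) < 2 ^ (p + q)"
    by simp
  then show ?thesis
    using code_nonneg[of e s] unfolding None step_def by (simp add: rank_Fl del: rank.simps zero_less_power)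
next
  case (Some a)
  show ?thesis
  proof (cases a)
    case a: (Fl b e' s')
    have ok: "fl_ok p q e' s'"
      using assms(2) Some a by (auto simp: psums_def)
    let ?v = "fval p q b e' s'" and ?w = "mag p q e s"
    let ?r = "?v + ?w"
    have w: "fval p q False e s = ?w"
      by (simp add: fval_def)
    have w0: "0 \<le> ?w"
      by (rule mag_nonneg)
    have "fadd p q a (Fl False e s) = a \<or> rank p q a < rank p q (fadd p q a (Fl False e s))"
    proof (cases "?r = 0")
      case True
      then have sum: "fadd p q a (Fl False e s) = Fl False 0 0"
        by (simp add: a w Let_def fzero_def)
      show ?thesis
      proof (cases b)
        case True
        then show ?thesis
          using code_nonneg[of e' s'] code_nonneg[of 0 0] unfolding sum unfolding a rank_Fl by simp
      next
        case False
        then have "mag p q e' s' = 0"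
          using True w0 mag_nonneg[of e' s'] by (simp add: fval_def)
        then have "e' = 0 \<and> s' = 0"
          using mag_inj[OF ok ok_zero] mag_zero_iff[of 0 0] by simp
        then show ?thesis
          using False sum a by simp
      qed
    next
      case False
      then have sum: "fadd p q a (Fl False e s) = fround p q (?r < 0) \<bar>?r\<bar>"
        by (simp add: a w Let_def)
      have "0 \<le> ?v" if "\<not> b"
        using that mag_nonneg[of e' s'] by (simp add: fval_def)
      then consider "b" "?r < 0" | "b" "0 < ?r" | "\<not> b" "0 < ?r"
        using False w0 by (cases b; cases "?r < 0") force+
      then show ?thesis
      proof cases
        case 1
        then have le: "\<bar>?r\<bar> \<le> mag p q e' s'"
          using w0 by (simp add: fval_def)
        then have "\<bar>?r\<bar> < overflow_bound p q"
          using mag_less_overflow[OF ok] by linarith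
        then obtain e2 s2 where 2: "fround p q (?r < 0) \<bar>?r\<bar> = Fl (?r < 0) e2 s2" "(e2, s2) \<in> nearest p q \<bar>?r\<bar>"
          using fround_nearest by blast
        have "code e2 s2 \<le> code e' s'"
          using mag_le_imp_code_le[OF nearest_ok[OF 2(2)] ok nearest_le[OF 2(2) ok le]]
          unfolding code_def by (rule of_nat_mono)
        moreover have "e2 = e' \<and> s2 = s'" if "code e2 s2 = code e' s'"
          using code_inj[OF nearest_ok[OF 2(2)] ok] that unfolding code_def of_nat_eq_iff by simp
        ultimately have "e2 = e' \<and> s2 = s' \<or> code e2 s2 < code e' s'"
          by linarith
        moreover have "(?r < 0) = b"
          using 1 by simp
        ultimately show ?thesis
          unfolding sum unfolding 2 a rank_Fl using 1(1) by auto
      next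
        \<comment> \<open>The accumulator changes its sign; negative floats, -0 included, have
          negative rank.\<close>
        case 2
        have "rank p q a < 0"
          using 2 code_nonneg[of e' s'] unfolding a rank_Fl by simp
        moreover have "0 \<le> rank p q (fround p q False \<bar>?r\<bar>)"
        proof (cases "\<bar>?r\<bar> < overflow_bound p q")
          case True
          then show ?thesis
            by (rule fround_nearest[of _ False]) (simp only: rank_Fl if_False code_nonneg)
        qed (simp add: fround_def)
        ultimately show ?thesis
          unfolding sum using 2 by simp
      next
        case 3
        then have ge: "mag p q e' s' \<le> \<bar>?r\<bar>"
          using w0 by (simp add: fval_def)
        show ?thesis
        proof (cases "\<bar>?r\<bar> < overflow_bound p q")
          case True
          then obtain e2 s2 where 2: "fround p q (?r < 0) \<bar>?r\<bar> = Fl (?r < 0) e2 s2" "(e2, s2) \<in> nearest p q \<bar>?r\<bar>"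
            using fround_nearest by blast
          have "code e' s' \<le> code e2 s2"
            using mag_le_imp_code_le[OF ok nearest_ok[OF 2(2)] nearest_ge[OF 2(2) ok ge]]
            unfolding code_def by (rule of_nat_mono)
          moreover have "e2 = e' \<and> s2 = s'" if "code e2 s2 = code e' s'"
            using code_inj[OF nearest_ok[OF 2(2)] ok] that unfolding code_def of_nat_eq_iff by simp
          ultimately have "e2 = e' \<and> s2 = s' \<or> code e' s' < code e2 s2"
            by linarith
          moreover have "(?r < 0) = b"
            using 3 by simp
          ultimately show ?thesis
            unfolding sum unfolding 2 a rank_Fl using 3(1) by auto
        next
          case False
          then show ?thesis
            unfolding sum unfolding a using 3 code_less[OF ok] by (simp add: fround_def rank_Fl del: rank.simps(1))
        qed
      qed
    qed
    then show ?thesis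
      by (auto simp: Some step_def)
  qed (auto simp: Some step_def)
qed

text \<open>The mirror image with the rank negated, the empty sum now lying above all ranks. The
  signed zeros need care: an exact zero result is -0 only if the accumulator was already -0, and +0
  otherwise.\<close>

lemma step_neg_decreases:
  assumes "fl_ok p q e s" "t \<in> psums"
  shows "step (Fl True e s) t = t \<or>
    - case_option (2 + 2 ^ (p + q)) (rank p q) t < - case_option (2 + 2 ^ (p + q)) (rank p q) (step (Fl True e s) t)"
proof (cases t)
  case None
  have "(0::int) < 2 ^ (p + q)"
    by simp
  then show ?thesis
    using code_nonneg[of e s] unfolding None step_def by (simp add: rank_Fl del: rank.simps zero_less_power)
next
  case (Some a)
  show ?thesis
  proof (cases a)
    case a: (Fl b e' s')
    have ok: "fl_ok p q e' s'"
      using assms(2) Some a by (auto simp: psums_def)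
    let ?v = "fval p q b e' s'" and ?w = "mag p q e s"
    let ?r = "?v - ?w"
    have w: "fval p q True e s = - ?w"
      by (simp add: fval_def)
    have w0: "0 \<le> ?w"
      by (rule mag_nonneg)
    have "fadd p q a (Fl True e s) = a \<or> rank p q (fadd p q a (Fl True e s)) < rank p q a"
    proof (cases "?r = 0")
      case True
      then have sum: "fadd p q a (Fl True e s) = Fl b 0 0"
        by (simp add: a w Let_def fzero_def)
      show ?thesis
      proof (cases b)
        case True
        then have "mag p q e' s' = 0"
          using \<open>?r = 0\<close> w0 mag_nonneg[of e' s'] by (simp add: fval_def)
        then have "e' = 0 \<and> s' = 0"
          using mag_inj[OF ok ok_zero] mag_zero_iff[of 0 0] by simp
        then show ?thesis
          using True sum a by simp
      next
        case False
        have "code 0 0 = 0"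
          by (simp add: code_def)
        moreover have "e' = 0 \<and> s' = 0" if "code e' s' = 0"
          using code_inj[OF ok ok_zero] that unfolding code_def of_nat_eq_0_iff by simp
        ultimately show ?thesis
          using code_nonneg[of e' s'] False unfolding sum unfolding a rank_Fl by force
      qed
    next
      case False
      then have sum: "fadd p q a (Fl True e s) = fround p q (?r < 0) \<bar>?r\<bar>"
        by (simp add: a w Let_def)
      have "?v \<le> 0" if "b"
        using that mag_nonneg[of e' s'] by (simp add: fval_def)
      then consider "\<not> b" "0 < ?r" | "\<not> b" "?r < 0" | "b" "?r < 0"
        using False w0 by (cases b; cases "?r < 0") force+
      then show ?thesis
      proof cases
        case 1
        then have le: "\<bar>?r\<bar> \<le> mag p q e' s'"
          using w0 by (simp add: fval_def)
        then have "\<bar>?r\<bar> < overflow_bound p q"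
          using mag_less_overflow[OF ok] by linarith
        then obtain e2 s2 where 2: "fround p q (?r < 0) \<bar>?r\<bar> = Fl (?r < 0) e2 s2" "(e2, s2) \<in> nearest p q \<bar>?r\<bar>"
          using fround_nearest by blast
        have "code e2 s2 \<le> code e' s'"
          using mag_le_imp_code_le[OF nearest_ok[OF 2(2)] ok nearest_le[OF 2(2) ok le]]
          unfolding code_def by (rule of_nat_mono)
        moreover have "e2 = e' \<and> s2 = s'" if "code e2 s2 = code e' s'"
          using code_inj[OF nearest_ok[OF 2(2)] ok] that unfolding code_def of_nat_eq_iff by simp
        ultimately have "e2 = e' \<and> s2 = s' \<or> code e2 s2 < code e' s'"
          by linarith
        moreover have "(?r < 0) = b"
          using 1 by simp
        ultimately show ?thesis
          unfolding sum unfolding 2 a rank_Fl using 1(1) by auto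
      next
        case 2
        have "0 \<le> rank p q a"
          using 2 code_nonneg[of e' s'] unfolding a rank_Fl by simp
        moreover have "rank p q (fround p q True \<bar>?r\<bar>) < 0"
        proof (cases "\<bar>?r\<bar> < overflow_bound p q")
          case True
          then obtain e2 s2 where "fround p q True \<bar>?r\<bar> = Fl True e2 s2"
            using fround_nearest by blast
          then show ?thesis
            using code_nonneg[of e2 s2] by (simp only: rank_Fl if_True)
        next
          case False
          have "(0::int) < 2 ^ (p + q)"
            by simp
          then have "- 1 - (2::int) ^ (p + q) < 0"
            by linarith
          then show ?thesis
            using False by (simp add: fround_def)
        qed
        ultimately show ?thesis
          unfolding sum using 2 by simp
      next
        case 3
        then have ge: "mag p q e' s' \<le> \<bar>?r\<bar>"
          using w0 by (simp add: fval_def)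
        show ?thesis
        proof (cases "\<bar>?r\<bar> < overflow_bound p q")
          case True
          then obtain e2 s2 where 2: "fround p q (?r < 0) \<bar>?r\<bar> = Fl (?r < 0) e2 s2" "(e2, s2) \<in> nearest p q \<bar>?r\<bar>"
            using fround_nearest by blast
          have "code e' s' \<le> code e2 s2"
            using mag_le_imp_code_le[OF ok nearest_ok[OF 2(2)] nearest_ge[OF 2(2) ok ge]]
            unfolding code_def by (rule of_nat_mono)
          moreover have "e2 = e' \<and> s2 = s'" if "code e2 s2 = code e' s'"
            using code_inj[OF nearest_ok[OF 2(2)] ok] that unfolding code_def of_nat_eq_iff by simp
          ultimately have "e2 = e' \<and> s2 = s' \<or> code e' s' < code e2 s2"
            by linarith
          moreover have "(?r < 0) = b"
            using 3 by simp
          ultimately show ?thesis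
            unfolding sum unfolding 2 a rank_Fl using 3(1) by auto
        next
          case False
          then show ?thesis
            unfolding sum unfolding a using 3 code_less[OF ok] by (simp add: fround_def rank_Fl del: rank.simps(1))
        qed
      qed
    qed
    then show ?thesis
      by (auto simp: Some step_def)
  qed (auto simp: Some step_def)
qed

text \<open>An infinite summand can only move the accumulator up the chain empty, finite, infinite,
  NaN.\<close>

lemma step_Infty_increases:
  "step (Infty b) t = t \<or>
    case_option (0::int) (case_flt (\<lambda>_ _ _. 1) (\<lambda>_. 2) 3) t
      < case_option 0 (case_flt (\<lambda>_ _ _. 1) (\<lambda>_. 2) 3) (step (Infty b) t)"
  by (auto simp: step_def split: option.splits flt.splits)

lemma step_NaN_increases:
  "step NaN t = t \<or> of_bool (t = Some NaN) < (of_bool (step NaN t = Some NaN) :: int)"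
  by (cases t; cases "the t") (auto simp: step_def)

lemma step_stabilises:
  assumes "y \<in> flts p q" "t \<in> psums" "card psums \<le> c"
  shows "(step y ^^ c) t = (step y ^^ card psums) t"
proof -
  have "\<exists>\<mu>::flt option \<Rightarrow> int. \<forall>t \<in> psums. step y t = t \<or> \<mu> t < \<mu> (step y t)"
  proof (cases y)
    case (Fl b e s)
    then have "fl_ok p q e s"
      using assms by simp
    then show ?thesis
      unfolding Fl
      using step_pos_increases[of e s] step_neg_decreases[of e s]
      by (intro exI[of _ "if b then \<lambda>t. - case_option (2 + 2 ^ (p + q)) (rank p q) t
        else case_option (- 2 - 2 ^ (p + q)) (rank p q)"]) (cases b; simp del: rank.simps)
  next
    case (Infty b)
    then show ?thesis
      using step_Infty_increases
      by (intro exI[of _ "case_option 0 (case_flt (\<lambda>_ _ _. 1) (\<lambda>_. 2) 3)"]) simp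
  next
    case NaN
    then show ?thesis
      using step_NaN_increases by (intro exI[of _ "\<lambda>t. of_bool (t = Some NaN)"]) simp
  qed
  then obtain \<mu> :: "flt option \<Rightarrow> int" where "\<And>t. t \<in> psums \<Longrightarrow> step y t = t \<or> \<mu> t < \<mu> (step y t)"
    by blast
  then show ?thesis
    by (rule funpow_stabilises[OF finite_psums step_in_psums[OF assms(1)] _ assms(2,3)])
qed

lemma step_cong_min:
  assumes "y \<in> flts p q" "t \<in> psums" "min (card psums) c = min (card psums) c'"
  shows "(step y ^^ c) t = (step y ^^ c') t"
proof (cases "c = c'")
  case False
  then have "card psums \<le> c" "card psums \<le> c'"
    using assms(3) by (auto simp: min_def split: if_splits)
  then show ?thesis
    using step_stabilises[OF assms(1,2)] by metis
qed simp

text \<open>These two floats are what a masked position can add to a softmax denominator. The first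
  addition turns -0 into +0 or produces NaN; further ones change nothing.\<close>

lemma step_idempotent_cong:
  assumes "y \<in> {fzero False, NaN}" "t \<in> psums" "1 \<le> c" "1 \<le> c'"
  shows "(step y ^^ c) t = (step y ^^ c') t"
proof -
  have zero: "fadd p q (fadd p q a (fzero False)) (fzero False) = fadd p q a (fzero False)"
    if "a \<in> flts p q" for a
  proof (cases a)
    case (Fl b e s)
    then have ok: "fl_ok p q e s"
      using that by simp
    have z: "fval p q False 0 0 = 0"
      by (simp add: fval_def mag_def)
    show ?thesis
    proof (cases "fval p q b e s = 0")
      case True
      then show ?thesis
        by (simp add: Fl fzero_def z Let_def)
    next
      case False
      have "\<bar>fval p q b e s\<bar> = mag p q e s" "(fval p q b e s < 0) = b"
        using False mag_nonneg[of e s] by (auto simp: fval_def)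
      then have "fadd p q a (fzero False) = a"
        using False fround_mag[OF ok] by (simp add: Fl fzero_def z Let_def)
      then show ?thesis
        by simp
    qed
  qed (auto simp: fzero_def)
  have NaN: "fadd p q a NaN = NaN" for a
    by (cases a) auto
  have zz: "fadd p q (fzero False) (fzero False) = fzero False"
    by (simp add: fzero_def Let_def fval_def mag_def)
  have idem: "step y (step y t) = step y t" if "t \<in> psums" for t
    using assms(1) that zero NaN zz by (auto simp: step_def psums_def split: option.splits)
  have "y \<in> flts p q"
    using assms(1) by auto
  have "(step y ^^ Suc n) t = step y t" for n
    using idem[OF assms(2)] by (induction n) auto
  then show ?thesis
    using assms(3,4) by (cases c; cases c') (simp_all del: funpow.simps)
qed

lemma fsum_cong_capcount:
  assumes "set xs \<subseteq> flts p q" "set xs' \<subseteq> flts p q"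
    and "card psums \<le> K" "capcount K xs = capcount K xs'"
  shows "fsum p q xs = fsum p q xs'"
proof (rule fsum_cong_step[OF assms(1,2)])
  fix y s
  assume ys: "y \<in> flts p q" "s \<in> psums"
  have "min K (count (mset xs) y) = min K (count (mset xs') y)"
    using assms(4) by (metis capcount_def)
  then have "min (card psums) (count (mset xs) y) = min (card psums) (count (mset xs') y)"
    using assms(3) by linarith
  then show "(step y ^^ count (mset xs) y) s = (step y ^^ count (mset xs') y) s"
    by (rule step_cong_min[OF ys])
qed

text \<open>Replaces the unbounded number of masked positions by one.\<close>

lemma fsum_append_replicate:
  assumes "set xs \<subseteq> flts p q" "z \<in> {fzero False, NaN}" "1 \<le> c"
  shows "fsum p q (xs @ replicate c z) = fsum p q (xs @ [z])"
proof (rule fsum_cong_step)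
  have z: "z \<in> flts p q"
    using assms(2) by auto
  show "set (xs @ replicate c z) \<subseteq> flts p q" "set (xs @ [z]) \<subseteq> flts p q"
    using assms(1) z by auto
  fix y s
  assume "y \<in> flts p q" "s \<in> psums"
  then show "(step y ^^ count (mset (xs @ replicate c z)) y) s = (step y ^^ count (mset (xs @ [z])) y) s"
    using step_idempotent_cong[of z s "count (mset xs) z + c" "count (mset xs) z + 1"] assms(2,3)
    by (cases "y = z") (simp_all del: funpow.simps)
qed

end

section \<open>Definable functions of a vertex\<close>

lemma bos_props:
  assumes "two_sorted \<Sigma> G"
  shows "bos G < length G" "G ! bos G = None" "\<And>v. v < length G \<Longrightarrow> G ! v = None \<Longrightarrow> v = bos G"
proof -
  have ex: "\<exists>!w. w < length G \<and> G ! w = None"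
    using assms by (simp add: two_sorted_def)
  have "bos G < length G \<and> G ! bos G = None"
    unfolding bos_def by (rule theI'[OF ex])
  then show "bos G < length G" "G ! bos G = None" "\<And>v. v < length G \<Longrightarrow> G ! v = None \<Longrightarrow> v = bos G"
    using ex by blast+
qed

lemma label_in_labels: "two_sorted \<Sigma> G \<Longrightarrow> v < length G \<Longrightarrow> G ! v \<in> labels \<Sigma>"
  by (auto simp: two_sorted_def)

lemma count_map_upt: "count (mset (map f [a..<b])) y = card {u. a \<le> u \<and> u < b \<and> f u = y}"
proof -
  have "count (mset (map f [a..<b])) y = length (filter (\<lambda>u. f u = y) [a..<b])"
    by (induction b) auto
  also have "\<dots> = card (set (filter (\<lambda>u. f u = y) [a..<b]))"
    by (rule distinct_card[symmetric]) simp
  also have "set (filter (\<lambda>u. f u = y) [a..<b]) = {u. a \<le> u \<and> u < b \<and> f u = y}"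
    by auto
  finally show ?thesis .
qed

text \<open>All vertices are meant, not only those of the suffix where outputs are read: formulas
  are evaluated in the prefix below \<open>GPre\<close>.\<close>

definition expressible :: "'a set \<Rightarrow> ('a graph \<Rightarrow> nat \<Rightarrow> bool) \<Rightarrow> bool" where
  "expressible \<Sigma> P \<longleftrightarrow> (\<exists>\<phi>. set_gptl \<phi> \<subseteq> \<Sigma> \<and>
     (\<forall>G v. two_sorted \<Sigma> G \<longrightarrow> v < length G \<longrightarrow> sat G v \<phi> = P G v))"

definition attained :: "'a set \<Rightarrow> ('a graph \<Rightarrow> nat \<Rightarrow> 'b) \<Rightarrow> 'b set" where
  "attained \<Sigma> F = {F G v | G v. two_sorted \<Sigma> G \<and> v < length G}"

lemma attainedI: "two_sorted \<Sigma> G \<Longrightarrow> v < length G \<Longrightarrow> F G v \<in> attained \<Sigma> F"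
  by (auto simp: attained_def)

lemma attained_subsetI:
  "(\<And>G v. two_sorted \<Sigma> G \<Longrightarrow> v < length G \<Longrightarrow> F G v \<in> A) \<Longrightarrow> attained \<Sigma> F \<subseteq> A"
  by (auto simp: attained_def)

text \<open>The common invariant for rows of a transformer and states of an automaton. Finiteness of
  the range turns quantification over values into finite Boolean combinations.\<close>

definition definable :: "'a set \<Rightarrow> ('a graph \<Rightarrow> nat \<Rightarrow> 'b) \<Rightarrow> bool" where
  "definable \<Sigma> F \<longleftrightarrow> finite (attained \<Sigma> F) \<and>
     (\<forall>s. expressible \<Sigma> (\<lambda>G v. F G v = s))"

lemma expressible_cong:
  assumes "expressible \<Sigma> P" "\<And>G v. two_sorted \<Sigma> G \<Longrightarrow> v < length G \<Longrightarrow> P G v = P' G v"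
  shows "expressible \<Sigma> P'"
  using assms unfolding expressible_def by (metis (no_types, lifting))

lemma expressible_const: "expressible \<Sigma> (\<lambda>G v. c)"
proof (cases c)
  case True
  then show ?thesis
    unfolding expressible_def by (intro exI[of _ "Neg Bot"]) simp
next
  case False
  then show ?thesis
    unfolding expressible_def by (intro exI[of _ Bot]) simp
qed

lemma expressible_not: "expressible \<Sigma> P \<Longrightarrow> expressible \<Sigma> (\<lambda>G v. \<not> P G v)"
proof -
  assume "expressible \<Sigma> P"
  then obtain \<phi> where "set_gptl \<phi> \<subseteq> \<Sigma>" "\<And>G v. two_sorted \<Sigma> G \<Longrightarrow> v < length G \<Longrightarrow> sat G v \<phi> = P G v"
    unfolding expressible_def by blast
  then show ?thesis
    unfolding expressible_def by (intro exI[of _ "Neg \<phi>"]) simp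
qed

lemma expressible_and:
  assumes "expressible \<Sigma> P" "expressible \<Sigma> Q"
  shows "expressible \<Sigma> (\<lambda>G v. P G v \<and> Q G v)"
proof -
  obtain \<phi> where "set_gptl \<phi> \<subseteq> \<Sigma>" "\<And>G v. two_sorted \<Sigma> G \<Longrightarrow> v < length G \<Longrightarrow> sat G v \<phi> = P G v"
    using assms(1) unfolding expressible_def by blast
  moreover obtain \<psi> where "set_gptl \<psi> \<subseteq> \<Sigma>" "\<And>G v. two_sorted \<Sigma> G \<Longrightarrow> v < length G \<Longrightarrow> sat G v \<psi> = Q G v"
    using assms(2) unfolding expressible_def by blast
  ultimately show ?thesis
    unfolding expressible_def by (intro exI[of _ "Conj \<phi> \<psi>"]) simp
qed

lemma expressible_or:
  assumes "expressible \<Sigma> P" "expressible \<Sigma> Q"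
  shows "expressible \<Sigma> (\<lambda>G v. P G v \<or> Q G v)"
  using expressible_not[OF expressible_and[OF expressible_not[OF assms(1)] expressible_not[OF assms(2)]]]
  by simp

lemma expressible_ball:
  assumes "finite A" "\<And>t. t \<in> A \<Longrightarrow> expressible \<Sigma> (P t)"
  shows "expressible \<Sigma> (\<lambda>G v. \<forall>t \<in> A. P t G v)"
  using assms by (induction A rule: finite_induct) (auto intro: expressible_const expressible_and)

lemma expressible_bex:
  assumes "finite A" "\<And>t. t \<in> A \<Longrightarrow> expressible \<Sigma> (P t)"
  shows "expressible \<Sigma> (\<lambda>G v. \<exists>t \<in> A. P t G v)"
  using assms by (induction A rule: finite_induct) (auto intro: expressible_const expressible_or)

lemma expressible_prefix_ge:
  assumes "expressible \<Sigma> P"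
  shows "expressible \<Sigma> (\<lambda>G v. j \<le> card {u. u < bos G \<and> P G u})"
proof -
  obtain \<phi> where \<phi>: "set_gptl \<phi> \<subseteq> \<Sigma>" "\<And>G v. two_sorted \<Sigma> G \<Longrightarrow> v < length G \<Longrightarrow> sat G v \<phi> = P G v"
    using assms unfolding expressible_def by blast
  have "{u \<in> prefix_vertices G. sat G u \<phi>} = {u. u < bos G \<and> P G u}" if "two_sorted \<Sigma> G" for G
    using \<phi>(2)[OF that] bos_props(1)[OF that] by (auto simp: prefix_vertices_def)
  then show ?thesis
    using \<phi>(1) unfolding expressible_def by (intro exI[of _ "GPre j \<phi>"]) simp
qed

lemma expressible_past:
  assumes "expressible \<Sigma> P"
  shows "expressible \<Sigma> (\<lambda>G v. \<exists>u. bos G \<le> u \<and> u < v \<and> P G u)"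
proof -
  obtain \<phi> where \<phi>: "set_gptl \<phi> \<subseteq> \<Sigma>" "\<And>G v. two_sorted \<Sigma> G \<Longrightarrow> v < length G \<Longrightarrow> sat G v \<phi> = P G v"
    using assms unfolding expressible_def by blast
  have "sat G v (PSuf \<phi>) \<longleftrightarrow> (\<exists>u. bos G \<le> u \<and> u < v \<and> P G u)" if "two_sorted \<Sigma> G" "v < length G" for G v
    using \<phi>(2)[OF that(1)] that(2) by (auto simp: suffix_vertices_def)
  then show ?thesis
    using \<phi>(1) unfolding expressible_def by (intro exI[of _ "PSuf \<phi>"]) simp
qed

text \<open>Counting in the past reduces to existence in the past, as the strict order is total.\<close>

lemma expressible_past_ge:
  assumes "expressible \<Sigma> P"
  shows "expressible \<Sigma> (\<lambda>G v. j \<le> card {u. bos G \<le> u \<and> u < v \<and> P G u})"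
proof (induction j)
  case 0
  then show ?case
    by (simp add: expressible_const)
next
  case (Suc j)
  let ?S = "\<lambda>G v. {u. bos G \<le> u \<and> u < v \<and> P G u}"
  have iff: "(\<exists>u. bos G \<le> u \<and> u < v \<and> P G u \<and> j \<le> card (?S G u)) \<longleftrightarrow> Suc j \<le> card (?S G v)" for G v
  proof
    assume "\<exists>u. bos G \<le> u \<and> u < v \<and> P G u \<and> j \<le> card (?S G u)"
    then obtain u where u: "bos G \<le> u" "u < v" "P G u" "j \<le> card (?S G u)"
      by blast
    have "card (insert u (?S G u)) \<le> card (?S G v)"
      using u by (intro card_mono) auto
    then show "Suc j \<le> card (?S G v)"
      using u by simp
  next
    assume *: "Suc j \<le> card (?S G v)"
    then have ne: "?S G v \<noteq> {}"
      by (metis card.empty not_less_eq_eq zero_le)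
    have fin: "finite (?S G v)"
      by simp
    \<comment> \<open>The latest witness before \<open>v\<close>; all other witnesses precede it, so
      it has at least \<open>j\<close> of them in its own past.\<close>
    define u where "u = Max (?S G v)"
    have u: "u \<in> ?S G v"
      unfolding u_def by (rule Max_in[OF fin ne])
    have "?S G v \<subseteq> insert u (?S G u)"
      using Max_ge[OF fin] unfolding u_def by (auto simp: le_less)
    then have "card (?S G v) \<le> card (insert u (?S G u))"
      by (rule card_mono[rotated]) simp
    then have "j \<le> card (?S G u)"
      using * by simp
    then show "\<exists>u. bos G \<le> u \<and> u < v \<and> P G u \<and> j \<le> card (?S G u)"
      using u by blast
  qed
  show ?case
    using expressible_past[OF expressible_and[OF assms Suc.IH]] unfolding iff[symmetric] by simp
qed

lemma expressible_min_eq: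
  assumes "\<And>j. expressible \<Sigma> (\<lambda>G v. j \<le> (n G v :: nat))"
  shows "expressible \<Sigma> (\<lambda>G v. min K (n G v) = j)"
proof -
  have "expressible \<Sigma> (\<lambda>G v. j \<le> n G v \<and> (j \<le> K \<and> (j = K \<or> \<not> Suc j \<le> n G v)))"
    by (intro expressible_and expressible_or expressible_not expressible_const assms)
  then show ?thesis
    by (rule expressible_cong) (auto simp: min_def)
qed

lemma definable_comp:
  assumes "definable \<Sigma> F"
  shows "definable \<Sigma> (\<lambda>G v. h (F G v))"
proof -
  have fin: "finite (attained \<Sigma> F)"
    using assms by (simp add: definable_def)
  have "attained \<Sigma> (\<lambda>G v. h (F G v)) \<subseteq> h ` attained \<Sigma> F"
    by (rule attained_subsetI) (simp add: attainedI)
  then have "finite (attained \<Sigma> (\<lambda>G v. h (F G v)))"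
    using fin by (meson finite_imageI finite_subset)
  moreover have "expressible \<Sigma> (\<lambda>G v. h (F G v) = s)" for s
  proof -
    have "finite {t \<in> attained \<Sigma> F. h t = s}"
      using fin by simp
    then have "expressible \<Sigma> (\<lambda>G v. \<exists>t \<in> {t \<in> attained \<Sigma> F. h t = s}. F G v = t)"
      using assms by (intro expressible_bex) (simp_all add: definable_def)
    then show ?thesis
      by (rule expressible_cong) (auto simp: attainedI)
  qed
  ultimately show ?thesis
    by (simp add: definable_def)
qed

lemma definable_pair:
  assumes "definable \<Sigma> F" "definable \<Sigma> H"
  shows "definable \<Sigma> (\<lambda>G v. (F G v, H G v))"
proof -
  have "attained \<Sigma> (\<lambda>G v. (F G v, H G v)) \<subseteq> attained \<Sigma> F \<times> attained \<Sigma> H"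
    by (rule attained_subsetI) (simp add: attainedI)
  then have "finite (attained \<Sigma> (\<lambda>G v. (F G v, H G v)))"
    by (rule finite_subset) (use assms in \<open>simp add: definable_def\<close>)
  moreover have "expressible \<Sigma> (\<lambda>G v. (F G v, H G v) = s)" for s
    using assms by (cases s) (simp add: definable_def expressible_and)
  ultimately show ?thesis
    by (simp add: definable_def)
qed

lemma definable_cong:
  assumes "definable \<Sigma> F" "\<And>G v. two_sorted \<Sigma> G \<Longrightarrow> v < length G \<Longrightarrow> F G v = F' G v"
  shows "definable \<Sigma> F'"
proof -
  have "attained \<Sigma> F' \<subseteq> attained \<Sigma> F"
    by (rule attained_subsetI) (metis assms(2) attainedI)
  then have "finite (attained \<Sigma> F')"
    by (rule finite_subset) (use assms in \<open>simp add: definable_def\<close>)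
  moreover have "expressible \<Sigma> (\<lambda>G v. F' G v = s)" for s
  proof (rule expressible_cong)
    show "expressible \<Sigma> (\<lambda>G v. F G v = s)"
      using assms(1) by (simp add: definable_def)
  qed (simp add: assms(2))
  ultimately show ?thesis
    by (simp add: definable_def)
qed

lemma definable_label:
  assumes "finite \<Sigma>"
  shows "definable \<Sigma> (\<lambda>G v. G ! v)"
proof -
  have "attained \<Sigma> (\<lambda>G v. G ! v) \<subseteq> labels \<Sigma>"
    by (rule attained_subsetI) (rule label_in_labels)
  then have fin: "finite (attained \<Sigma> (\<lambda>G v. G ! v))"
    by (rule finite_subset) (simp add: labels_def assms)
  have atom: "expressible \<Sigma> (\<lambda>G v. G ! v = Some a)" if "a \<in> \<Sigma>" for a
    unfolding expressible_def using that by (intro exI[of _ "Prop a"]) simp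
  have "expressible \<Sigma> (\<lambda>G v. G ! v = s)" for s
  proof (cases "s \<in> labels \<Sigma>")
    case False
    show ?thesis
      by (rule expressible_cong[OF expressible_const[of _ False]]) (use False label_in_labels in blast)
  next
    case True
    show ?thesis
    proof (cases s)
      case (Some a)
      then show ?thesis
        using True atom by (auto simp: labels_def)
    next
      case None
      \<comment> \<open>\<open>BOS\<close> has no atom of its own: it is the label that is none of
        the finitely many letters.\<close>
      have "expressible \<Sigma> (\<lambda>G v. \<forall>a \<in> \<Sigma>. \<not> G ! v = Some a)"
        by (intro expressible_ball expressible_not atom assms)
      then show ?thesis
        unfolding None by (rule expressible_cong) (force dest: label_in_labels simp: labels_def)
    qed
  qed
  then show ?thesis
    using fin by (simp add: definable_def)
qed

text \<open>The capped counts vanish outside the finite set of attained values, so only finitely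
  many functions occur, and each is pinned down by one threshold condition for every attained value.
  The bounds \<open>a\<close> and \<open>b\<close> cover both the prefix and the past in the
  suffix.\<close>

lemma definable_capcount:
  fixes F :: "'a graph \<Rightarrow> nat \<Rightarrow> 'b"
  assumes F: "definable \<Sigma> F"
    and lt: "\<And>G v u. two_sorted \<Sigma> G \<Longrightarrow> v < length G \<Longrightarrow> u < b G v \<Longrightarrow> u < length G"
    and ge: "\<And>P j. expressible \<Sigma> P \<Longrightarrow>
      expressible \<Sigma> (\<lambda>G v. j \<le> card {u. a G \<le> u \<and> u < b G v \<and> P G u})"
  shows "definable \<Sigma> (\<lambda>G v. capcount K (map (F G) [a G..<b G v]))"
proof -
  let ?R = "attained \<Sigma> F"
  let ?C = "\<lambda>G v. capcount K (map (F G) [a G..<b G v])"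
  have fin: "finite ?R"
    using F by (simp add: definable_def)
  have outside: "?C G v y = 0" if "two_sorted \<Sigma> G" "v < length G" "y \<notin> ?R" for G v y
  proof -
    have "y \<notin> set (map (F G) [a G..<b G v])"
      using that(3) by (auto intro!: attainedI[OF that(1)] dest: lt[OF that(1,2)])
    then show ?thesis
      unfolding capcount_def by (metis count_mset_0_iff min_0R)
  qed
  have "attained \<Sigma> ?C \<subseteq>
      {f. \<forall>y. (y \<in> ?R \<longrightarrow> f y \<in> {..K}) \<and> (y \<notin> ?R \<longrightarrow> f y = 0)}"
    by (rule attained_subsetI) (simp add: outside, simp add: capcount_def)
  moreover have "finite {f. \<forall>y. (y \<in> ?R \<longrightarrow> f y \<in> {..K}) \<and> (y \<notin> ?R \<longrightarrow> f y = 0)}"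
    by (rule finite_set_of_finite_funs) (use fin in auto)
  ultimately have "finite (attained \<Sigma> ?C)"
    by (rule finite_subset)
  moreover have "expressible \<Sigma> (\<lambda>G v. ?C G v = c)" for c
  proof -
    have "expressible \<Sigma> (\<lambda>G v. (\<forall>y. y \<notin> ?R \<longrightarrow> c y = 0) \<and>
        (\<forall>y \<in> ?R. min K (card {u. a G \<le> u \<and> u < b G v \<and> F G u = y}) = c y))"
      using F by (intro expressible_and expressible_const expressible_ball fin expressible_min_eq ge)
        (simp add: definable_def)
    then show ?thesis
    proof (rule expressible_cong)
      fix G :: "'a graph" and v
      assume Gv: "two_sorted \<Sigma> G" "v < length G"
      show "((\<forall>y. y \<notin> ?R \<longrightarrow> c y = 0) \<and>
          (\<forall>y \<in> ?R. min K (card {u. a G \<le> u \<and> u < b G v \<and> F G u = y}) = c y)) = (?C G v = c)"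
        (is "?L = _")
      proof
        assume ?L
        show "?C G v = c"
        proof
          fix y
          show "?C G v y = c y"
            using \<open>?L\<close> outside[OF Gv, of y] by (cases "y \<in> ?R") (simp_all add: capcount_def count_map_upt del: mset_map)
        qed
      next
        assume "?C G v = c"
        then show ?L
          using outside[OF Gv] by (auto simp: capcount_def count_map_upt simp del: mset_map)
      qed
    qed
  qed
  ultimately show ?thesis
    by (simp add: definable_def)
qed

lemma capcount_some: "capcount K (SOME ys. capcount K ys = capcount K xs) = capcount K xs"
  by (rule someI) (rule refl)

text \<open>The induction step shared by encoder layers, decoder layers and automaton rounds: a new
  value computed from the own value and from the lists of values in the prefix and in the
  past.\<close>

lemma definable_step:
  assumes F: "definable \<Sigma> F" and H: "definable \<Sigma> H" and I: "definable \<Sigma> I"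
    and resp: "\<And>y xs xs' zs zs'. capcount K xs = capcount K xs' \<Longrightarrow> capcount K zs = capcount K zs' \<Longrightarrow>
      h y xs zs = h y xs' zs'"
  shows "definable \<Sigma> (\<lambda>G v. h (F G v) (map (H G) [0..<bos G]) (map (I G) [bos G..<v]))"
proof -
  \<comment> \<open>As \<open>h\<close> respects capped counts, it factors through them;
    \<open>SOME\<close> picks a list with the given counts.\<close>
  define g where "g = (\<lambda>(y, c, d). h y (SOME xs. capcount K xs = c) (SOME zs. capcount K zs = d))"
  have g: "g (y, capcount K xs, capcount K zs) = h y xs zs" for y xs zs
    unfolding g_def prod.case by (rule resp; rule capcount_some)
  have pre: "definable \<Sigma> (\<lambda>G v. capcount K (map (H G) [0..<bos G]))"
  proof (rule definable_capcount[OF H])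
    fix G :: "'a graph" and v u
    assume "two_sorted \<Sigma> G" "u < bos G"
    then show "u < length G"
      using bos_props(1) by fastforce
  next
    fix P j
    assume "expressible \<Sigma> P"
    then show "expressible \<Sigma> (\<lambda>G v. j \<le> card {u. 0 \<le> u \<and> u < bos G \<and> P G u})"
      using expressible_prefix_ge[of \<Sigma> P j] by simp
  qed
  have past: "definable \<Sigma> (\<lambda>G v. capcount K (map (I G) [bos G..<v]))"
    by (rule definable_capcount[OF I]) (simp, rule expressible_past_ge)
  show ?thesis
    using definable_comp[OF definable_pair[OF F definable_pair[OF pre past]], of g] by (simp add: g)
qed

lemma formulas_of_definable:
  assumes "definable \<Sigma> F" "1 \<le> L"
    and len: "\<And>G v. two_sorted \<Sigma> G \<Longrightarrow> v \<in> suffix_vertices G \<Longrightarrow> length (F G v) = L"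
  shows "\<exists>\<phi>s. wf_formulas \<Sigma> \<phi>s \<and> equivalent \<Sigma> (\<lambda>G v. Some (F G v)) (formulas_output \<phi>s)"
proof -
  have "\<exists>\<phi>. set_gptl \<phi> \<subseteq> \<Sigma> \<and> (\<forall>G v. two_sorted \<Sigma> G \<longrightarrow> v < length G \<longrightarrow> sat G v \<phi> = (F G v ! i))" for i
  proof -
    have "expressible \<Sigma> (\<lambda>G v. F G v ! i = True)"
      using definable_comp[OF assms(1), of "\<lambda>l. l ! i"] by (simp only: definable_def)
    then show ?thesis
      by (simp add: expressible_def)
  qed
  then obtain \<Phi> where \<Phi>: "\<And>i. set_gptl (\<Phi> i) \<subseteq> \<Sigma>"
    "\<And>i G v. two_sorted \<Sigma> G \<Longrightarrow> v < length G \<Longrightarrow> sat G v (\<Phi> i) = (F G v ! i)"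
    by metis
  have "wf_formulas \<Sigma> (map \<Phi> [0..<L])"
    using \<Phi>(1) assms(2) by (auto simp: wf_formulas_def)
  moreover have "F G v = map (sat G v) (map \<Phi> [0..<L])" if "two_sorted \<Sigma> G" "v \<in> suffix_vertices G" for G v
    using \<Phi>(2)[OF that(1)] len[OF that] that(2) by (intro nth_equalityI) (auto simp: suffix_vertices_def)
  ultimately show ?thesis
    unfolding equivalent_def formulas_output_def by (intro exI[of _ "map \<Phi> [0..<L]"]) simp
qed

section \<open>Automata are definable\<close>

lemma count_capped: "count (capped k M) x = min k (count M x)"
  by (auto simp: capped_def count_mset_set' not_in_iff)

lemma capped_in_capped_msets: "set_mset M \<subseteq> Q \<Longrightarrow> capped k M \<in> capped_msets k Q"
  by (auto simp: capped_msets_def count_capped) (auto simp: capped_def)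

lemma capped_eq_if_capcount_eq: "capcount k xs = capcount k ys \<Longrightarrow> capped k (mset xs) = capped k (mset ys)"
  by (rule multiset_eqI) (metis capcount_def count_capped)

lemma cpg_state_in_states:
  assumes "wf_cpg \<Sigma> A" "two_sorted \<Sigma> G"
  shows "v < length G \<Longrightarrow> cpg_state A G t v \<in> states A"
proof (induction t arbitrary: v)
  case 0
  then show ?case
    using assms(1) label_in_labels[OF assms(2)] by (simp add: wf_cpg_def)
next
  case (Suc t)
  have "capped (cap A) (image_mset (cpg_state A G t) (mset_set U)) \<in> capped_msets (cap A) (states A)"
    if "U \<subseteq> {..<length G}" for U
    using Suc.IH that by (intro capped_in_capped_msets) (auto simp: finite_subset[OF that])
  moreover have "prefix_vertices G \<subseteq> {..<length G}" "{u \<in> suffix_vertices G. u < v} \<subseteq> {..<length G}"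
    using bos_props(1)[OF assms(2)] by (auto simp: prefix_vertices_def suffix_vertices_def)
  ultimately show ?case
    using assms(1) Suc unfolding wf_cpg_def by simp
qed

text \<open>Each round is an instance of \<open>definable_step\<close> with the cap of the
  automaton. \<open>cpg_state_in_states\<close> supplies the constant length of the output.\<close>

lemma formulas_of_cpg:
  assumes "finite \<Sigma>" "wf_cpg \<Sigma> A"
  shows "\<exists>\<phi>s. wf_formulas \<Sigma> \<phi>s \<and> equivalent \<Sigma> (cpg_output A) (formulas_output \<phi>s)"
proof -
  have "definable \<Sigma> (\<lambda>G v. cpg_state A G t v)" for t
  proof (induction t)
    case 0
    then show ?case
      using definable_comp[OF definable_label[OF assms(1)], of "initial A"] by simp
  next
    case (Suc t)
    have "definable \<Sigma> (\<lambda>G v. delta A (cpg_state A G t v)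
        (capped (cap A) (mset (map (cpg_state A G t) [0..<bos G])))
        (capped (cap A) (mset (map (cpg_state A G t) [bos G..<v]))))"
    proof (rule definable_step[OF Suc Suc Suc, where K = "cap A" and
          h = "\<lambda>y xs zs. delta A y (capped (cap A) (mset xs)) (capped (cap A) (mset zs))"])
      fix y and xs xs' zs zs' :: "state list"
      assume "capcount (cap A) xs = capcount (cap A) xs'" "capcount (cap A) zs = capcount (cap A) zs'"
      note this[THEN capped_eq_if_capcount_eq]
      then show "delta A y (capped (cap A) (mset xs)) (capped (cap A) (mset zs)) =
          delta A y (capped (cap A) (mset xs')) (capped (cap A) (mset zs'))"
        by (simp only:)
    qed
    then show ?case
    proof (rule definable_cong)
      fix G :: "'a graph" and v
      assume "two_sorted \<Sigma> G" "v < length G"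
      then have "prefix_vertices G = {0..<bos G}" "{u \<in> suffix_vertices G. u < v} = {bos G..<v}"
        by (auto simp: prefix_vertices_def suffix_vertices_def)
      then show "delta A (cpg_state A G t v)
          (capped (cap A) (mset (map (cpg_state A G t) [0..<bos G])))
          (capped (cap A) (mset (map (cpg_state A G t) [bos G..<v]))) = cpg_state A G (Suc t) v"
        by simp
    qed
  qed
  then have "definable \<Sigma> (\<lambda>G v. take (outlen A) (cpg_state A G (rounds A) v))"
    by (rule definable_comp[where h = "take (outlen A)"])
  moreover have "length (take (outlen A) (cpg_state A G (rounds A) v)) = outlen A"
    if "two_sorted \<Sigma> G" "v \<in> suffix_vertices G" for G v
    using cpg_state_in_states[OF assms(2) that(1), of v "rounds A"] that(2) assms(2)
    by (auto simp: wf_cpg_def suffix_vertices_def)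
  moreover have "1 \<le> outlen A"
    using assms(2) by (simp add: wf_cpg_def)
  ultimately show ?thesis
    unfolding cpg_output_def by (intro formulas_of_definable)
qed

section \<open>Transformers row by row\<close>

locale arithmetic = format +
  fixes E :: "nat \<Rightarrow> nat \<Rightarrow> flt \<Rightarrow> flt"
  assumes exp_approx: "exp_approximation E"
begin

lemma exp_in_flts [simp]: "x \<in> flts p q \<Longrightarrow> E p q x \<in> flts p q"
  and exp_fzero: "E p q (fzero b) = fone p q"
  and exp_neg_Infty: "E p q (Infty True) = fzero False"
  and exp_NaN: "E p q NaN = NaN"
  using exp_approx p_pos q_pos unfolding exp_approximation_def by blast+

definition rmul :: "flt vec \<Rightarrow> flt mat \<Rightarrow> flt vec" where
  "rmul x B = vec (dim_col B) (\<lambda>j. fsum p q (map (\<lambda>k. fmul p q (x $ k) (B $$ (k, j))) [0..<dim_vec x]))"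

definition radd :: "flt vec \<Rightarrow> flt vec \<Rightarrow> flt vec" where
  "radd x y = vec (dim_vec x) (\<lambda>j. fadd p q (x $ j) (y $ j))"

definition score :: "dims \<Rightarrow> head \<Rightarrow> flt vec \<Rightarrow> flt vec \<Rightarrow> flt" where
  "score D H y x = fdiv p q
     (fsum p q (map (\<lambda>k. fmul p q (rmul y (WQ H) $ k) (rmul x (WK H) $ k)) [0..<dim_col (WQ H)]))
     (fround p q False (sqrt (real (dkey D))))"

text \<open>Softmax gives equal scores equal weights, so a weight is a function of the score and of
  the list of all scores, not of a position.\<close>

definition weight :: "flt list \<Rightarrow> flt \<Rightarrow> flt" where
  "weight ss s =
     (if \<forall>t \<in> set ss. t = Infty True then fzero False
      else let \<beta> = (ARG_MAX (rank p q) y. y \<in> set ss)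
           in fdiv p q (E p q (fsub p q s \<beta>)) (fsum p q (map (\<lambda>t. E p q (fsub p q t \<beta>)) ss)))"

text \<open>The parameter \<open>c\<close> is the number of masked positions.\<close>

definition head_row :: "dims \<Rightarrow> head \<Rightarrow> flt vec list \<Rightarrow> nat \<Rightarrow> flt vec \<Rightarrow> flt vec" where
  "head_row D H xs c y = vec (dim_col (WV H)) (\<lambda>j. fsum p q (map
     (\<lambda>x. fmul p q (weight (map (score D H y) xs @ replicate c (Infty True)) (score D H y x))
       (rmul x (WV H) $ j)) xs))"

definition multi_row :: "dims \<Rightarrow> mha \<Rightarrow> flt vec list \<Rightarrow> nat \<Rightarrow> flt vec \<Rightarrow> flt vec" where
  "multi_row D M xs c y = rmul (vec (length (heads M) * dval D)
     (\<lambda>j. head_row D (heads M ! (j div dval D)) xs c y $ (j mod dval D))) (WO M)"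

definition mlp_row :: "mlp \<Rightarrow> flt vec \<Rightarrow> flt vec" where
  "mlp_row N x = radd (rmul (map_vec frelu (radd (rmul x (W1 N)) (b1 N))) (W2 N)) (b2 N)"

definition enc_row :: "dims \<Rightarrow> enc_layer \<Rightarrow> flt vec list \<Rightarrow> flt vec \<Rightarrow> flt vec" where
  "enc_row D L xs y =
     (let y' = radd (multi_row D (enc_self L) xs 0 y) y in radd (mlp_row (enc_mlp L) y') y')"

definition dec_row :: "dims \<Rightarrow> dec_layer \<Rightarrow> flt vec list \<Rightarrow> flt vec list \<Rightarrow> nat \<Rightarrow> flt vec \<Rightarrow> flt vec" where
  "dec_row D L xs zs c y =
     (let y' = radd (multi_row D (dec_self L) zs c y) y;
          y'' = radd (multi_row D (dec_cross L) xs 0 y') y'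
      in radd (mlp_row (dec_mlp L) y'') y'')"

lemma fmat_mult_entry:
  "i < dim_row A \<Longrightarrow> j < dim_col B \<Longrightarrow> fmat_mult p q A B $$ (i, j) =
     fsum p q (map (\<lambda>k. fmul p q (A $$ (i, k)) (B $$ (k, j))) [0..<dim_col A])"
  by (simp add: fmat_mult_def)

lemma row_fmat_mult: "i < dim_row A \<Longrightarrow> row (fmat_mult p q A B) i = rmul (row A i) B"
  by (rule eq_vecI) (auto simp: fmat_mult_def rmul_def intro!: arg_cong[of _ _ "fsum p q"])

lemma row_fmat_add:
  "i < dim_row A \<Longrightarrow> dim_row B = dim_row A \<Longrightarrow> dim_col B = dim_col A \<Longrightarrow>
   row (fmat_add p q A B) i = radd (row A i) (row B i)"
  by (rule eq_vecI) (auto simp: fmat_add_def radd_def)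

lemma row_fmat_add_bias: "i < dim_row A \<Longrightarrow> row (fmat_add_bias p q A b) i = radd (row A i) b"
  by (rule eq_vecI) (auto simp: fmat_add_bias_def radd_def)

lemma dims_simps [simp]:
  "dim_row (fmat_mult p q A B) = dim_row A" "dim_col (fmat_mult p q A B) = dim_col B"
  "dim_row (fmat_add p q A B) = dim_row A" "dim_col (fmat_add p q A B) = dim_col A"
  "dim_row (fmat_add_bias p q A b) = dim_row A" "dim_col (fmat_add_bias p q A b) = dim_col A"
  by (auto simp: fmat_mult_def fmat_add_def fmat_add_bias_def)

lemma row_mlp_apply: "i < dim_row X \<Longrightarrow> row (mlp_apply p q N X) i = mlp_row N (row X i)"
proof -
  assume i: "i < dim_row X"
  have "row (map_mat frelu A) i = map_vec frelu (row A i)" if "i < dim_row A" for A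
    using that by (intro eq_vecI) auto
  then show ?thesis
    using i by (simp add: mlp_apply_def mlp_row_def row_fmat_mult row_fmat_add_bias)
qed

lemma dims_mlp_apply [simp]:
  "dim_row (mlp_apply p q N X) = dim_row X" "dim_col (mlp_apply p q N X) = dim_col (W2 N)"
  by (simp_all add: mlp_apply_def)

lemma softmax_weight:
  "j < dim_vec x \<Longrightarrow> softmax E p q x $ j = weight (map (($) x) [0..<dim_vec x]) (x $ j)"
proof -
  assume j: "j < dim_vec x"
  have "(\<lambda>y. \<exists>i < dim_vec x. y = x $ i) = (\<lambda>y. y \<in> set (map (($) x) [0..<dim_vec x]))"
    by (auto simp: fun_eq_iff)
  moreover have "(\<forall>i < dim_vec x. x $ i = Infty True) = (\<forall>t \<in> set (map (($) x) [0..<dim_vec x]). t = Infty True)"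
    by auto
  ultimately show ?thesis
    using j unfolding softmax_def weight_def Let_def by (simp only: map_map comp_def) (simp add: comp_def)
qed

lemma attention_dims [simp]:
  "dim_row (attention E p q D m H X Y) = dim_row Y" "dim_col (attention E p q D m H X Y) = dim_col (WV H)"
  by (auto simp: attention_def Let_def softmax_rows_def causal_mask_def fmat_mult_causal_def)

lemma softmax_rows_dims [simp]:
  "dim_row (softmax_rows E p q A) = dim_row A" "dim_col (softmax_rows E p q A) = dim_col A"
  by (simp_all add: softmax_rows_def)

lemma score_entry:
  assumes "i < dim_row Y" "j < dim_row X" "dim_col (WK H) = dim_col (WQ H)"
  shows "map_mat (\<lambda>x. fdiv p q x (fround p q False (sqrt (real (dkey D)))))
    (fmat_mult p q (fmat_mult p q Y (WQ H)) (transpose_mat (fmat_mult p q X (WK H)))) $$ (i, j) =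
    score D H (row Y i) (row X j)"
proof -
  have "fmat_mult p q Y (WQ H) $$ (i, k) = rmul (row Y i) (WQ H) $ k" if "k < dim_col (WQ H)" for k
    using row_fmat_mult[OF assms(1), of "WQ H", symmetric] that assms(1) by simp
  moreover have "transpose_mat (fmat_mult p q X (WK H)) $$ (k, j) = rmul (row X j) (WK H) $ k"
    if "k < dim_col (WQ H)" for k
    using row_fmat_mult[OF assms(2), of "WK H", symmetric] that assms(2,3) by simp
  ultimately have *: "map (\<lambda>k. fmul p q (fmat_mult p q Y (WQ H) $$ (i, k)) (transpose_mat (fmat_mult p q X (WK H)) $$ (k, j)))
      [0..<dim_col (WQ H)] =
    map (\<lambda>k. fmul p q (rmul (row Y i) (WQ H) $ k) (rmul (row X j) (WK H) $ k)) [0..<dim_col (WQ H)]"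
    by (intro map_cong) simp_all
  have "fmat_mult p q (fmat_mult p q Y (WQ H)) (transpose_mat (fmat_mult p q X (WK H))) $$ (i, j) =
      fsum p q (map (\<lambda>k. fmul p q (rmul (row Y i) (WQ H) $ k) (rmul (row X j) (WK H) $ k)) [0..<dim_col (WQ H)])"
    unfolding *[symmetric] using assms(1,2) by (subst fmat_mult_entry) simp_all
  then show ?thesis
    using assms(1,2) unfolding score_def by simp
qed

lemma row_attention:
  assumes i: "i < dim_row Y" and "dim_col (WK H) = dim_col (WQ H)"
  shows "row (attention E p q D False H X Y) i = head_row D H (rows X) 0 (row Y i)"
proof -
  define S where "S = map_mat (\<lambda>x. fdiv p q x (fround p q False (sqrt (real (dkey D)))))
    (fmat_mult p q (fmat_mult p q Y (WQ H)) (transpose_mat (fmat_mult p q X (WK H))))"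
  let ?n = "dim_row X"
  have dims: "dim_row S = dim_row Y" "dim_col S = ?n"
    by (simp_all add: S_def)
  have S: "S $$ (i, j) = score D H (row Y i) (row X j)" if "j < ?n" for j
    unfolding S_def using i that assms(2) by (rule score_entry)
  have "map (($) (row S i)) [0..<dim_vec (row S i)] = map (score D H (row Y i)) (rows X)"
    using i dims S by (auto simp: rows_def)
  then have sm: "softmax E p q (row S i) $ j = weight (map (score D H (row Y i)) (rows X)) (score D H (row Y i) (row X j))"
    if "j < ?n" for j
    using softmax_weight[of j "row S i"] i dims S that by simp
  have "row (attention E p q D False H X Y) i = row (fmat_mult p q (softmax_rows E p q S) (fmat_mult p q X (WV H))) i"
    by (simp add: attention_def S_def Let_def)
  also have "\<dots> = head_row D H (rows X) 0 (row Y i)"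
  proof (rule eq_vecI)
    fix j
    assume "j < dim_vec (head_row D H (rows X) 0 (row Y i))"
    then have j: "j < dim_col (WV H)"
      by (simp add: head_row_def)
    have "map (\<lambda>k. fmul p q (softmax_rows E p q S $$ (i, k)) (fmat_mult p q X (WV H) $$ (k, j))) [0..<?n] =
      map (\<lambda>x. fmul p q (weight (map (score D H (row Y i)) (rows X)) (score D H (row Y i) x)) (rmul x (WV H) $ j)) (rows X)"
    proof -
      have "fmat_mult p q X (WV H) $$ (k, j) = rmul (row X k) (WV H) $ j" if "k < ?n" for k
        using row_fmat_mult[OF that, of "WV H", symmetric] that j by simp
      then show ?thesis
        using i dims sm unfolding rows_def by (auto simp: softmax_rows_def)
    qed
    then show "row (fmat_mult p q (softmax_rows E p q S) (fmat_mult p q X (WV H))) i $ j =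
        head_row D H (rows X) 0 (row Y i) $ j"
      using i j dims by (simp add: fmat_mult_entry head_row_def)
  qed (simp add: head_row_def)
  finally show ?thesis .
qed

text \<open>The mask hides row \<open>i\<close> itself and all later rows,
  \<open>dim_row X - i\<close> in number. They keep their place in the softmax as scores
  \<open>Infty True\<close>, while the causal product drops them from the sum of values.\<close>

lemma row_masked_attention:
  assumes i: "i < dim_row X" and "dim_col (WK H) = dim_col (WQ H)"
  shows "row (attention E p q D True H X X) i = head_row D H (take i (rows X)) (dim_row X - i) (row X i)"
proof -
  define S where "S = map_mat (\<lambda>x. fdiv p q x (fround p q False (sqrt (real (dkey D)))))
    (fmat_mult p q (fmat_mult p q X (WQ H)) (transpose_mat (fmat_mult p q X (WK H))))"
  define S' where "S' = causal_mask S"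
  let ?n = "dim_row X"
  let ?xs = "take i (rows X)"
  let ?ss = "map (score D H (row X i)) ?xs @ replicate (?n - i) (Infty True)"
  have xs: "?xs = map (row X) [0..<i]"
    using i by (simp add: rows_def take_map)
  have dims: "dim_row S' = ?n" "dim_col S' = ?n"
    by (simp_all add: S_def S'_def causal_mask_def)
  have S: "S $$ (i, j) = score D H (row X i) (row X j)" if "j < ?n" for j
    unfolding S_def using i that assms(2) by (rule score_entry)
  then have S': "S' $$ (i, j) = (if i \<le> j then Infty True else score D H (row X i) (row X j))" if "j < ?n" for j
    using i that dims by (simp add: S'_def causal_mask_def)
  have "map (($) (row S' i)) [0..<dim_vec (row S' i)] = ?ss"
  proof (rule nth_equalityI)
    fix j
    assume "j < length (map (($) (row S' i)) [0..<dim_vec (row S' i)])"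
    then show "map (($) (row S' i)) [0..<dim_vec (row S' i)] ! j = ?ss ! j"
      using i dims S' by (simp add: xs nth_append)
  qed (use i dims in \<open>simp add: xs\<close>)
  then have sm: "softmax E p q (row S' i) $ j = weight ?ss (score D H (row X i) (row X j))"
    if "j < i" for j
    using softmax_weight[of j "row S' i"] i dims S' that by simp
  have "row (attention E p q D True H X X) i = row (fmat_mult_causal p q (softmax_rows E p q S') (fmat_mult p q X (WV H))) i"
    by (simp add: attention_def S_def S'_def Let_def)
  also have "\<dots> = head_row D H ?xs (?n - i) (row X i)"
  proof (rule eq_vecI)
    fix j
    assume "j < dim_vec (head_row D H ?xs (?n - i) (row X i))"
    then have j: "j < dim_col (WV H)"
      by (simp add: head_row_def)
    have "filter (\<lambda>k. k < i) [0..<?n] = [0..<i]"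
    proof -
      have "[0..<?n] = [0..<i] @ [i..<?n]"
        using i upt_add_eq_append[of 0 i "?n - i"] by simp
      then show ?thesis
        by (simp add: filter_empty_conv)
    qed
    moreover have "map (\<lambda>k. fmul p q (softmax_rows E p q S' $$ (i, k)) (fmat_mult p q X (WV H) $$ (k, j))) [0..<i] =
      map (\<lambda>x. fmul p q (weight ?ss (score D H (row X i) x)) (rmul x (WV H) $ j)) ?xs"
    proof -
      have "fmat_mult p q X (WV H) $$ (k, j) = rmul (row X k) (WV H) $ j" if "k < ?n" for k
        using row_fmat_mult[OF that, of "WV H", symmetric] that j by simp
      then show ?thesis
        using i dims sm by (auto simp: softmax_rows_def xs)
    qed
    ultimately show "row (fmat_mult_causal p q (softmax_rows E p q S') (fmat_mult p q X (WV H))) i $ j =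
        head_row D H ?xs (?n - i) (row X i) $ j"
      using i j dims by (simp add: fmat_mult_causal_def head_row_def)
  qed (simp add: head_row_def fmat_mult_causal_def)
  finally show ?thesis .
qed

lemma wf_mhaD:
  assumes "wf_mha p q D M" "1 \<le> dval D"
  shows "\<And>H. H \<in> set (heads M) \<Longrightarrow> dim_col (WK H) = dim_col (WQ H)"
    "\<And>H. H \<in> set (heads M) \<Longrightarrow> dim_col (WV H) = dval D"
    "dim_col (WO M) = dmodel D"
  using assms by (auto simp: wf_mha_def fmats_def)

lemma row_multi_head:
  assumes M: "wf_mha p q D M" "1 \<le> dval D" and i: "i < dim_row Y"
    and row: "\<And>H. H \<in> set (heads M) \<Longrightarrow> row (attention E p q D m H X Y) i = head_row D H xs c (row Y i)"
  shows "row (multi_head E p q D m M X Y) i = multi_row D M xs c (row Y i)"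
proof -
  let ?As = "map (\<lambda>H. attention E p q D m H X Y) (heads M)"
  have "row (concat_cols (dim_row Y) (dval D) ?As) i =
    vec (length (heads M) * dval D) (\<lambda>j. head_row D (heads M ! (j div dval D)) xs c (row Y i) $ (j mod dval D))"
  proof (rule eq_vecI)
    fix j
    assume "j < dim_vec (vec (length (heads M) * dval D)
      (\<lambda>j. head_row D (heads M ! (j div dval D)) xs c (row Y i) $ (j mod dval D)))"
    then have j: "j < length (heads M) * dval D"
      by simp
    then have h: "j div dval D < length (heads M)" "j mod dval D < dval D"
      using assms(2) by (auto simp: less_mult_imp_div_less)
    have H: "heads M ! (j div dval D) \<in> set (heads M)"
      using h by simp
    show "row (concat_cols (dim_row Y) (dval D) ?As) i $ j =
      vec (length (heads M) * dval D) (\<lambda>j. head_row D (heads M ! (j div dval D)) xs c (row Y i) $ (j mod dval D)) $ j"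
      using i j h row[OF H, symmetric] wf_mhaD(2)[OF M H] by (simp add: concat_cols_def)
  qed (simp add: concat_cols_def)
  then show ?thesis
    using i by (simp add: multi_head_def multi_row_def row_fmat_mult concat_cols_def)
qed

lemma dims_multi_head [simp]:
  "dim_row (multi_head E p q D m M X Y) = dim_row Y" "dim_col (multi_head E p q D m M X Y) = dim_col (WO M)"
  by (simp_all add: multi_head_def concat_cols_def)

lemma rows_encoder_layer:
  assumes "wf_mha p q D (enc_self L)" "wf_mlp p q D (enc_mlp L)" "1 \<le> dval D" "dim_col X = dmodel D"
  shows "rows (encoder_layer E p q D L X) = map (enc_row D L (rows X)) (rows X)"
    and "dim_col (encoder_layer E p q D L X) = dmodel D"
proof -
  have d: "dim_col (WO (enc_self L)) = dmodel D" "dim_col (W2 (enc_mlp L)) = dmodel D"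
    using assms by (auto simp: wf_mha_def wf_mlp_def fmats_def)
  have "row (encoder_layer E p q D L X) i = enc_row D L (rows X) (row X i)" if "i < dim_row X" for i
  proof -
    have "row (multi_head E p q D False (enc_self L) X X) i = multi_row D (enc_self L) (rows X) 0 (row X i)"
      using assms that by (intro row_multi_head row_attention) (auto dest: wf_mhaD)
    then show ?thesis
      using that d assms(4) by (simp add: encoder_layer_def enc_row_def Let_def row_fmat_add row_mlp_apply)
  qed
  then show "rows (encoder_layer E p q D L X) = map (enc_row D L (rows X)) (rows X)"
    by (simp add: rows_def encoder_layer_def Let_def)
  show "dim_col (encoder_layer E p q D L X) = dmodel D"
    using d by (simp add: encoder_layer_def Let_def)
qed

lemma decoder_layer_row:
  assumes "wf_mha p q D (dec_self L)" "wf_mha p q D (dec_cross L)" "wf_mlp p q D (dec_mlp L)"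
    "1 \<le> dval D" "dim_col Y = dmodel D"
  shows "i < dim_row Y \<Longrightarrow> row (decoder_layer E p q D L X Y) i =
      dec_row D L (rows X) (take i (rows Y)) (dim_row Y - i) (row Y i)"
    and "dim_row (decoder_layer E p q D L X Y) = dim_row Y"
    and "dim_col (decoder_layer E p q D L X Y) = dmodel D"
proof -
  have d: "dim_col (WO (dec_self L)) = dmodel D" "dim_col (WO (dec_cross L)) = dmodel D"
    "dim_col (W2 (dec_mlp L)) = dmodel D"
    using assms by (auto simp: wf_mha_def wf_mlp_def fmats_def)
  show "row (decoder_layer E p q D L X Y) i =
      dec_row D L (rows X) (take i (rows Y)) (dim_row Y - i) (row Y i)" if i: "i < dim_row Y"
  proof -
    have self: "row (multi_head E p q D True (dec_self L) Y Y) i =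
        multi_row D (dec_self L) (take i (rows Y)) (dim_row Y - i) (row Y i)"
      using assms i by (intro row_multi_head row_masked_attention) (auto dest: wf_mhaD)
    have cross: "row (multi_head E p q D False (dec_cross L) X Z) i = multi_row D (dec_cross L) (rows X) 0 (row Z i)"
      if "dim_row Z = dim_row Y" for Z
      using assms i that by (intro row_multi_head row_attention) (auto dest: wf_mhaD)
    show ?thesis
      using i d assms(5) by (simp add: decoder_layer_def dec_row_def Let_def row_fmat_add row_mlp_apply self cross)
  qed
  show "dim_row (decoder_layer E p q D L X Y) = dim_row Y" "dim_col (decoder_layer E p q D L X Y) = dmodel D"
    using d by (simp_all add: decoder_layer_def Let_def)
qed

end

section \<open>Rows depend only on capped multiplicities\<close>

lemma capcount_snoc: "capcount K xs = capcount K ys \<Longrightarrow> capcount K (xs @ [z]) = capcount K (ys @ [z])"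
proof -
  assume *: "capcount K xs = capcount K ys"
  have "min K (count (mset (zs @ [z])) y) = min K (min K (count (mset zs) y) + (if y = z then 1 else 0))"
    for zs :: "'a list" and y
    by (auto simp: min_def)
  then show ?thesis
    using * unfolding capcount_def fun_eq_iff by metis
qed

context format
begin

text \<open>The size of the space of accumulators: after that many repetitions of a summand the
  partial sum is stationary.\<close>

definition K :: nat where
  "K = card psums"

lemma K_pos: "1 \<le> K"
  unfolding K_def using finite_psums by (simp add: Suc_le_eq card_gt_0_iff) (auto simp: psums_def)

lemma fsum_map_cong:
  assumes "capcount K xs = capcount K xs'" "\<And>x. f x \<in> flts p q"
  shows "fsum p q (map f xs) = fsum p q (map f xs')"
  using assms(2) by (intro fsum_cong_capcount[of _ _ K] capcount_map[OF assms(1)]) (auto simp: K_def)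

end

context arithmetic
begin

text \<open>A masked score minus the maximum is \<open>Infty True\<close> or NaN, the latter if the
  maximum is itself \<open>Infty True\<close> or NaN. Its exponential is accordingly +0 or NaN, for
  which \<open>fsum_append_replicate\<close> applies. The maximum depends only on the set of
  scores.\<close>

lemma weight_cong:
  assumes "capcount K ss = capcount K ss'" "c = 0 \<longleftrightarrow> c' = 0"
  shows "weight (ss @ replicate c (Infty True)) s = weight (ss' @ replicate c' (Infty True)) s"
proof -
  have "set ss = set ss'"
    using assms(1) K_pos by (rule capcount_set_eq)
  then have sets: "set (ss @ replicate c (Infty True)) = set (ss' @ replicate c' (Infty True))"
    using assms(2) by (cases "c = 0"; cases "c' = 0") simp_all
  have "fsum p q (map (\<lambda>t. E p q (fsub p q t \<beta>)) (ss @ replicate c (Infty True))) =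
      fsum p q (map (\<lambda>t. E p q (fsub p q t \<beta>)) (ss' @ replicate c' (Infty True)))" for \<beta>
  proof (cases "c = 0")
    case True
    then show ?thesis
      using assms(2) fsum_map_cong[OF assms(1), of "\<lambda>t. E p q (fsub p q t \<beta>)"] by simp
  next
    case False
    let ?g = "\<lambda>t. E p q (fsub p q t \<beta>)"
    have "fsub p q (Infty True) \<beta> \<in> {Infty True, NaN}"
      by (cases \<beta>) (auto simp: fsub_def)
    then have g: "?g (Infty True) \<in> {fzero False, NaN}"
      by (auto simp: exp_neg_Infty exp_NaN)
    have tail: "fsum p q (map ?g (us @ replicate d (Infty True))) = fsum p q (map ?g (us @ [Infty True]))"
      if "d \<noteq> 0" for us d
    proof -
      have "set (map ?g us) \<subseteq> flts p q"
        by auto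
      from fsum_append_replicate[OF this g, of d] show ?thesis
        using that by simp
    qed
    have "fsum p q (map ?g (ss @ [Infty True])) = fsum p q (map ?g (ss' @ [Infty True]))"
      by (rule fsum_map_cong) (simp_all add: capcount_snoc[OF assms(1)])
    then show ?thesis
      using tail[of c ss] tail[of c' ss'] False assms(2) by metis
  qed
  then show ?thesis
    unfolding weight_def Let_def sets by (simp only:)
qed

lemma head_row_cong:
  assumes "capcount K xs = capcount K xs'" "c = 0 \<longleftrightarrow> c' = 0"
  shows "head_row D H xs c y = head_row D H xs' c' y"
proof -
  have "weight (map (score D H y) xs @ replicate c (Infty True)) =
      weight (map (score D H y) xs' @ replicate c' (Infty True))"
    by (intro ext weight_cong capcount_map assms)
  then show ?thesis
    unfolding head_row_def by (simp add: fsum_map_cong[OF assms(1)])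
qed

lemma multi_row_cong:
  assumes "capcount K xs = capcount K xs'" "c = 0 \<longleftrightarrow> c' = 0"
  shows "multi_row D M xs c y = multi_row D M xs' c' y"
  unfolding multi_row_def head_row_cong[OF assms] ..

lemma enc_row_cong:
  assumes "capcount K xs = capcount K xs'"
  shows "enc_row D L xs y = enc_row D L xs' y"
  unfolding enc_row_def multi_row_cong[OF assms refl] ..

lemma dec_row_cong:
  assumes "capcount K xs = capcount K xs'" "capcount K zs = capcount K zs'" "c = 0 \<longleftrightarrow> c' = 0"
  shows "dec_row D L xs zs c y = dec_row D L xs' zs' c' y"
  unfolding dec_row_def multi_row_cong[OF assms(1) refl] multi_row_cong[OF assms(2,3)] ..

lemma definable_encoder:
  assumes "definable \<Sigma> F" "1 \<le> dval D"
    and "\<And>L. L \<in> set Ls \<Longrightarrow> wf_mha p q D (enc_self L) \<and> wf_mlp p q D (enc_mlp L)"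
    and "\<And>G. two_sorted \<Sigma> G \<Longrightarrow> rows (X G) = map (F G) [0..<bos G] \<and> dim_col (X G) = dmodel D"
  shows "\<exists>F'. definable \<Sigma> F' \<and> (\<forall>G. two_sorted \<Sigma> G \<longrightarrow>
    rows (fold (encoder_layer E p q D) Ls (X G)) = map (F' G) [0..<bos G])"
  using assms(1,3,4)
proof (induction Ls arbitrary: F X)
  case (Cons L Ls)
  define F1 where "F1 = (\<lambda>G v. enc_row D L (map (F G) [0..<bos G]) (F G v))"
  have "definable \<Sigma> F1"
    unfolding F1_def
    by (rule definable_step[OF Cons.prems(1) Cons.prems(1) Cons.prems(1),
          where K = K and h = "\<lambda>y xs zs. enc_row D L xs y"]) (rule enc_row_cong)
  moreover have "rows (encoder_layer E p q D L (X G)) = map (F1 G) [0..<bos G] \<and>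
      dim_col (encoder_layer E p q D L (X G)) = dmodel D" if "two_sorted \<Sigma> G" for G
    using rows_encoder_layer[of D L "X G"] Cons.prems(2)[of L] Cons.prems(3)[OF that] assms(2)
    by (simp add: F1_def comp_def)
  ultimately show ?case
    using Cons.IH[of F1 "\<lambda>G. encoder_layer E p q D L (X G)"] Cons.prems(2) by simp
qed auto

lemma definable_decoder:
  assumes "definable \<Sigma> F" "definable \<Sigma> H" "1 \<le> dval D"
    and "\<And>L. L \<in> set Ls \<Longrightarrow> wf_mha p q D (dec_self L) \<and> wf_mha p q D (dec_cross L) \<and> wf_mlp p q D (dec_mlp L)"
    and "\<And>G. two_sorted \<Sigma> G \<Longrightarrow> rows (X G) = map (H G) [0..<bos G]"
    and "\<And>G. two_sorted \<Sigma> G \<Longrightarrow> rows (Y G) = map (F G) [bos G..<length G] \<and> dim_col (Y G) = dmodel D"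
  shows "\<exists>F'. definable \<Sigma> F' \<and> (\<forall>G. two_sorted \<Sigma> G \<longrightarrow>
    rows (fold (\<lambda>L. decoder_layer E p q D L (X G)) Ls (Y G)) = map (F' G) [bos G..<length G])"
  using assms(1,4,6)
proof (induction Ls arbitrary: F Y)
  case (Cons L Ls)
  \<comment> \<open>In the decoder the number of masked positions is \<open>length G - v\<close>,
    which takes unboundedly many values. It is always positive, as the mask covers the vertex
    itself, and by \<open>dec_row_cong\<close> it may be replaced by 1.\<close>
  define F1 where "F1 = (\<lambda>G v. dec_row D L (map (H G) [0..<bos G]) (map (F G) [bos G..<v]) 1 (F G v))"
  have "definable \<Sigma> F1"
    unfolding F1_def
    by (rule definable_step[OF Cons.prems(1) assms(2) Cons.prems(1),
          where K = K and h = "\<lambda>y xs zs. dec_row D L xs zs 1 y"]) (rule dec_row_cong; simp)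
  moreover have "rows (decoder_layer E p q D L (X G) (Y G)) = map (F1 G) [bos G..<length G] \<and>
      dim_col (decoder_layer E p q D L (X G) (Y G)) = dmodel D" if G: "two_sorted \<Sigma> G" for G
  proof -
    note wf = decoder_layer_row[where D = D and L = L and Y = "Y G" and X = "X G"]
    have Y: "rows (Y G) = map (F G) [bos G..<length G]" "dim_col (Y G) = dmodel D"
      using Cons.prems(3)[OF G] by auto
    then have n: "dim_row (Y G) = length G - bos G"
      by (metis length_rows length_map length_upt)
    have "rows (decoder_layer E p q D L (X G) (Y G)) = map (F1 G) [bos G..<length G]"
    proof (rule nth_equalityI)
      fix i
      assume "i < length (rows (decoder_layer E p q D L (X G) (Y G)))"
      then have i: "i < dim_row (Y G)"
        using wf(2) Cons.prems(2)[of L] Y assms(3) by simp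
      have "row (Y G) i = F G (bos G + i)"
        using i n Y(1) by (metis length_map length_rows length_upt nth_map nth_rows nth_upt less_diff_conv add.commute)
      moreover have "take i (rows (Y G)) = map (F G) [bos G..<bos G + i]"
        using i n unfolding Y(1) take_map by simp
      ultimately have "row (decoder_layer E p q D L (X G) (Y G)) i =
          dec_row D L (map (H G) [0..<bos G]) (map (F G) [bos G..<bos G + i]) (dim_row (Y G) - i) (F G (bos G + i))"
        using wf(1)[OF _ _ _ _ _ i] Cons.prems(2)[of L] Y assms(3) assms(5)[OF G] by simp
      also have "\<dots> = F1 G (bos G + i)"
        unfolding F1_def using i by (intro dec_row_cong) auto
      finally show "rows (decoder_layer E p q D L (X G) (Y G)) ! i = map (F1 G) [bos G..<length G] ! i"
        using i n wf(2) Cons.prems(2)[of L] Y assms(3) by simp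
    qed (use wf(2) Cons.prems(2)[of L] Y assms(3) n in simp)
    then show ?thesis
      using wf(3) Cons.prems(2)[of L] Y assms(3) by simp
  qed
  ultimately show ?case
    using Cons.IH[of F1 "\<lambda>G. decoder_layer E p q D L (X G) (Y G)"] Cons.prems(2) by simp
qed auto

lemma formulas_of_transformer:
  assumes "finite \<Sigma>" and T: "wf_transformer \<Sigma> T" "prec T = p" "expo T = q"
    and nan: "\<And>p q. length (nan p q) = 1 + q + p"
  shows "\<exists>\<phi>s. wf_formulas \<Sigma> \<phi>s \<and> equivalent \<Sigma> (bitwise_output E nan T) (formulas_output \<phi>s)"
proof -
  let ?D = "tdims T"
  let ?X0 = "\<lambda>G. mat_of_rows (dmodel ?D) (map (emb T) (take (bos G) G))"
  let ?Y0 = "\<lambda>G. mat_of_rows (dmodel ?D) (map (emb T) (drop (bos G) G))"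
  have D: "1 \<le> dval ?D" "1 \<le> dout ?D" "dim_col (Wout T) = dout ?D"
    using T by (auto simp: wf_transformer_def Let_def fmats_def)
  have emb: "emb T l \<in> carrier_vec (dmodel ?D)" if "l \<in> labels \<Sigma>" for l
    using T that by (auto simp: wf_transformer_def Let_def fvecs_def)
  have def0: "definable \<Sigma> (\<lambda>G v. emb T (G ! v))"
    using definable_comp[OF definable_label[OF assms(1)], of "emb T"] .
  have "rows (?X0 G) = map (\<lambda>v. emb T (G ! v)) [0..<bos G]" if "two_sorted \<Sigma> G" for G
  proof -
    have "rows (?X0 G) = map (emb T) (take (bos G) G)"
      using that emb by (intro rows_mat_of_rows) (auto simp: two_sorted_def dest: in_set_takeD)
    also have "\<dots> = map (\<lambda>v. emb T (G ! v)) [0..<bos G]"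
      using bos_props(1)[OF that] by (intro nth_equalityI) auto
    finally show ?thesis .
  qed
  then obtain H where H: "definable \<Sigma> H" "\<And>G. two_sorted \<Sigma> G \<Longrightarrow>
      rows (fold (encoder_layer E p q ?D) (enc T) (?X0 G)) = map (H G) [0..<bos G]"
    using definable_encoder[OF def0 D(1), of "enc T" ?X0] T
    by (auto simp: wf_transformer_def Let_def)
  have "rows (?Y0 G) = map (\<lambda>v. emb T (G ! v)) [bos G..<length G]" if "two_sorted \<Sigma> G" for G
  proof -
    have "rows (?Y0 G) = map (emb T) (drop (bos G) G)"
      using that emb by (intro rows_mat_of_rows) (auto simp: two_sorted_def dest: in_set_dropD)
    also have "\<dots> = map (\<lambda>v. emb T (G ! v)) [bos G..<length G]"
      using bos_props(1)[OF that] by (intro nth_equalityI) auto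
    finally show ?thesis .
  qed
  then obtain F where F: "definable \<Sigma> F" "\<And>G. two_sorted \<Sigma> G \<Longrightarrow>
      rows (fold (\<lambda>L. decoder_layer E p q ?D L (fold (encoder_layer E p q ?D) (enc T) (?X0 G))) (dec T) (?Y0 G))
        = map (F G) [bos G..<length G]"
    using definable_decoder[OF def0 H(1) D(1), of "dec T" "\<lambda>G. fold (encoder_layer E p q ?D) (enc T) (?X0 G)" ?Y0] T H(2)
    by (auto simp: wf_transformer_def Let_def)
  define out where "out = (\<lambda>x. concat (map (flt_bits nan p q) (list_of_vec (radd (rmul x (Wout T)) (bout T)))))"
  have row: "transformer_row E T G v = list_of_vec (radd (rmul (F G v) (Wout T)) (bout T))"
    if "two_sorted \<Sigma> G" "v \<in> suffix_vertices G" for G v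
  proof -
    let ?Y = "fold (\<lambda>L. decoder_layer E p q ?D L (fold (encoder_layer E p q ?D) (enc T) (?X0 G))) (dec T) (?Y0 G)"
    have v: "bos G \<le> v" "v < length G"
      using that by (auto simp: suffix_vertices_def)
    have "length (rows ?Y) = length G - bos G"
      unfolding F(2)[OF that(1)] by simp
    then have i: "v - bos G < dim_row ?Y"
      using v by simp
    have "row ?Y (v - bos G) = rows ?Y ! (v - bos G)"
      using i by simp
    also have "\<dots> = F G v"
      unfolding F(2)[OF that(1)] using v by simp
    finally show ?thesis
      unfolding transformer_row_def transformer_matrix_def Let_def T(2,3)
      using i by (simp add: row_fmat_add_bias row_fmat_mult)
  qed
  have "definable \<Sigma> (\<lambda>G v. out (F G v))"
    using F(1) by (rule definable_comp)
  \<comment> \<open>Every entry, NaN included, is written with the same number of bits, so the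
    output has a constant length.\<close>
  moreover have "length (out x) = dout ?D * (1 + q + p)" for x
  proof -
    have "length (flt_bits nan p q y) = 1 + q + p" for y
      by (cases y) (simp_all add: nan bin_def)
    then have "length (concat (map (flt_bits nan p q) l)) = length l * (1 + q + p)" for l
      by (induction l) auto
    then show ?thesis
      unfolding out_def by (simp only:) (simp add: radd_def rmul_def D)
  qed
  moreover have "1 \<le> dout ?D * (1 + q + p)"
    using D(2) by (cases "dout ?D") auto
  ultimately obtain \<phi>s where \<phi>s: "wf_formulas \<Sigma> \<phi>s" "equivalent \<Sigma> (\<lambda>G v. Some (out (F G v))) (formulas_output \<phi>s)"
    using formulas_of_definable[of \<Sigma> "\<lambda>G v. out (F G v)"] by blast
  have "equivalent \<Sigma> (bitwise_output E nan T) (formulas_output \<phi>s)"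
    using \<phi>s(2) row unfolding equivalent_def bitwise_output_def out_def T(2,3) by simp
  then show ?thesis
    using \<phi>s(1) by blast
qed

end

section \<open>Automata that evaluate formulas\<close>

primrec subformulas :: "'a gptl \<Rightarrow> 'a gptl list" where
  "subformulas Bot = [Bot]"
| "subformulas (Prop a) = [Prop a]"
| "subformulas (Neg \<phi>) = Neg \<phi> # subformulas \<phi>"
| "subformulas (Conj \<phi> \<psi>) = Conj \<phi> \<psi> # subformulas \<phi> @ subformulas \<psi>"
| "subformulas (GPre k \<phi>) = GPre k \<phi> # subformulas \<phi>"
| "subformulas (PSuf \<phi>) = PSuf \<phi> # subformulas \<phi>"

fun threshold :: "'a gptl \<Rightarrow> nat" where
  "threshold (GPre k \<phi>) = k"
| "threshold _ = 0"

text \<open>The last argument is the current bit of the formula itself. An atom keeps it, since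
  transitions have no access to the label.\<close>

primrec recompute ::
  "('a gptl \<Rightarrow> nat) \<Rightarrow> bool list \<Rightarrow> bool list multiset \<Rightarrow> bool list multiset \<Rightarrow> 'a gptl \<Rightarrow> bool \<Rightarrow> bool" where
  "recompute ix x M N Bot = (\<lambda>_. False)"
| "recompute ix x M N (Prop a) = (\<lambda>b. b)"
| "recompute ix x M N (Neg \<phi>) = (\<lambda>_. \<not> x ! ix \<phi>)"
| "recompute ix x M N (Conj \<phi> \<psi>) = (\<lambda>_. x ! ix \<phi> \<and> x ! ix \<psi>)"
| "recompute ix x M N (GPre k \<phi>) = (\<lambda>_. k \<le> size (filter_mset (\<lambda>y. y ! ix \<phi>) M))"
| "recompute ix x M N (PSuf \<phi>) = (\<lambda>_. \<exists>y \<in># N. y ! ix \<phi>)"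

text \<open>A formula may hold in several states, so its count is a sum of multiplicities. Capping
  every term at \<open>k\<close> leaves the sum capped at \<open>k\<close> unchanged.\<close>

lemma min_size_filter_capped: "min k (size (filter_mset P (capped k M))) = min k (size (filter_mset P M))"
proof -
  have size: "size (filter_mset P N) = (\<Sum>x \<in> set_mset M. if P x then count N x else 0)"
    if "set_mset N \<subseteq> set_mset M" for N
  proof -
    have "size (filter_mset P N) = (\<Sum>x \<in> set_mset M. count (filter_mset P N) x)"
      unfolding size_multiset_overloaded_eq
      using that by (intro sum.mono_neutral_left) (auto simp: count_eq_zero_iff)
    then show ?thesis
      by (simp add: if_distrib count_filter_mset cong: if_cong)
  qed
  have sub: "set_mset (capped k M) \<subseteq> set_mset M"
    by (auto simp: capped_def)
  have "min k (\<Sum>x \<in> set_mset M. if P x then count M x else 0) =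
      min k (\<Sum>x \<in> set_mset M. min k (if P x then count M x else 0))"
    by (rule min_sum_min) simp
  also have "(\<Sum>x \<in> set_mset M. min k (if P x then count M x else 0)) =
      (\<Sum>x \<in> set_mset M. if P x then count (capped k M) x else 0)"
    by (intro sum.cong) (auto simp: count_capped)
  finally show ?thesis
    unfolding size[OF sub] size[OF subset_refl] by simp
qed

lemma set_mset_capped: "1 \<le> k \<Longrightarrow> set_mset (capped k M) = set_mset M"
proof -
  assume "1 \<le> k"
  then have "count (capped k M) x = 0 \<longleftrightarrow> count M x = 0" for x
    by (auto simp: count_capped min_def)
  then have "x \<in># capped k M \<longleftrightarrow> x \<in># M" for x
    by (metis count_eq_zero_iff)
  then show ?thesis
    by blast
qed

text \<open>A state stores the truth values of all subformulas, and each round recomputes all of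
  them from the previous states. Initially only the bits of atoms are meaningful; the others become
  right in order of size.\<close>

lemma cpg_of_formulas:
  assumes "finite \<Sigma>" "wf_formulas \<Sigma> \<phi>s"
  shows "\<exists>A. wf_cpg \<Sigma> A \<and> equivalent \<Sigma> (formulas_output \<phi>s) (cpg_output A)"
proof -
  \<comment> \<open>The given formulas come first, so the output is a prefix of the state.
    Repetitions do no harm.\<close>
  define \<Psi> where "\<Psi> = \<phi>s @ concat (map subformulas \<phi>s)"
  define n where "n = length \<Psi>"
  define ix where "ix = (\<lambda>\<psi>. SOME i. i < n \<and> \<Psi> ! i = \<psi>)"
  \<comment> \<open>The cap reaches every threshold of a \<open>GPre\<close>; the successor makes it
    positive, so that capped multisets keep their elements, as \<open>PSuf\<close> needs.\<close>
  define k where "k = Suc (Max (threshold ` set \<Psi>))"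
  have ix: "ix \<psi> < n" "\<Psi> ! ix \<psi> = \<psi>" if "\<psi> \<in> set \<Psi>" for \<psi>
    using someI_ex[of "\<lambda>i. i < n \<and> \<Psi> ! i = \<psi>"] that unfolding ix_def n_def in_set_conv_nth by auto
  have self: "\<phi> \<in> set (subformulas \<phi>)" for \<phi> :: "'a gptl"
    by (cases \<phi>) auto
  have trans: "\<chi> \<in> set (subformulas \<phi>) \<Longrightarrow> \<psi> \<in> set (subformulas \<chi>) \<Longrightarrow> \<psi> \<in> set (subformulas \<phi>)"
    for \<phi> \<chi> \<psi> :: "'a gptl"
    by (induction \<phi>) auto
  have closed: "\<chi> \<in> set \<Psi>" if "\<psi> \<in> set \<Psi>" "\<chi> \<in> set (subformulas \<psi>)" for \<psi> \<chi>
    using that trans unfolding \<Psi>_def by auto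
  define A where "A = \<lparr>width = n, cap = k, states = {x. length x = n},
    initial = (\<lambda>l. map (\<lambda>\<psi>. \<exists>a. \<psi> = Prop a \<and> l = Some a) \<Psi>),
    delta = (\<lambda>x M N. map (\<lambda>i. recompute ix x M N (\<Psi> ! i) (x ! i)) [0..<n]),
    rounds = Suc (Max (size ` set \<Psi>)), outlen = length \<phi>s\<rparr>"
  have ne: "\<phi>s \<noteq> []"
    using assms(2) by (simp add: wf_formulas_def)
  have "finite {x :: bool list. length x = n}"
    using finite_lists_length_eq[of "UNIV :: bool set" n] by simp
  moreover have "replicate n False \<in> {x. length x = n}"
    by simp
  ultimately have "wf_cpg \<Sigma> A"
    using ne by (auto simp: wf_cpg_def A_def n_def \<Psi>_def Suc_le_eq intro: exI[of _ "replicate n False"])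
  moreover have "take (outlen A) (cpg_state A G (rounds A) v) = map (sat G v) \<phi>s"
    if G: "two_sorted \<Sigma> G" and v: "v < length G" for G v
  proof -
    have len: "length (cpg_state A G t u) = n" for t u
      by (cases t) (simp_all add: A_def n_def)
    have atom: "cpg_state A G t u ! i = (G ! u = Some a)" if "i < n" "\<Psi> ! i = Prop a" for t u i a
      using that by (induction t) (auto simp: A_def n_def)
    \<comment> \<open>The claim covers all vertices at once, since \<open>GPre\<close> and
      \<open>PSuf\<close> look at the bits of others.\<close>
    have correct: "cpg_state A G t u ! i = sat G u \<psi>"
      if "i < n" "\<Psi> ! i = \<psi>" "size \<psi> < t" "u < length G" for t u i \<psi>
      using that
    proof (induction t arbitrary: u i \<psi>)
      case (Suc t)
      let ?s = "cpg_state A G t"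
      let ?M = "image_mset ?s (mset_set (prefix_vertices G))"
      let ?N = "image_mset ?s (mset_set {w \<in> suffix_vertices G. w < u})"
      have \<psi>: "\<psi> \<in> set \<Psi>"
        using Suc.prems by (auto simp: n_def)
      have IH: "?s w ! ix \<chi> = sat G w \<chi>" if "\<chi> \<in> set (subformulas \<psi>)" "size \<chi> < size \<psi>" "w < length G" for \<chi> w
        using Suc.IH[OF ix[OF closed[OF \<psi> that(1)]]] that Suc.prems by simp
      have "cpg_state A G (Suc t) u ! i = recompute ix (?s u) (capped k ?M) (capped k ?N) \<psi> (?s u ! i)"
        using Suc.prems by (simp add: A_def)
      also have "\<dots> = sat G u \<psi>"
      proof (cases \<psi>)
        case (Prop a)
        then show ?thesis
          using atom[of i a t u] Suc.prems by simp
      next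
        case (GPre j \<chi>)
        have "j \<le> k"
          using \<psi> unfolding k_def GPre by (intro le_SucI Max_ge) (auto intro!: image_eqI[of _ _ "GPre j \<chi>"])
        then have "j \<le> size (filter_mset (\<lambda>y. y ! ix \<chi>) (capped k ?M)) \<longleftrightarrow>
            j \<le> size (filter_mset (\<lambda>y. y ! ix \<chi>) ?M)"
          using min_size_filter_capped[of k "\<lambda>y. y ! ix \<chi>" ?M] by linarith
        also have "size (filter_mset (\<lambda>y. y ! ix \<chi>) ?M) = card {w \<in> prefix_vertices G. ?s w ! ix \<chi>}"
          by (simp add: filter_mset_image_mset prefix_vertices_def)
        also have "{w \<in> prefix_vertices G. ?s w ! ix \<chi>} = {w \<in> prefix_vertices G. sat G w \<chi>}"
          using IH[of \<chi>] self[of \<chi>] bos_props(1)[OF G] by (auto simp: GPre prefix_vertices_def)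
        finally show ?thesis
          by (simp add: GPre)
      next
        case (PSuf \<chi>)
        have fin: "finite {w \<in> suffix_vertices G. w < u}"
          by simp
        have "recompute ix (?s u) (capped k ?M) (capped k ?N) \<psi> (?s u ! i) \<longleftrightarrow>
            (\<exists>w \<in> {w \<in> suffix_vertices G. w < u}. ?s w ! ix \<chi>)"
          using fin by (simp add: PSuf set_mset_capped k_def)
        then show ?thesis
          using IH[of \<chi>] self[of \<chi>] Suc.prems by (auto simp: PSuf suffix_vertices_def)
      qed (use IH self Suc.prems in auto)
      finally show ?case .
    qed simp
    have "cpg_state A G (rounds A) v ! i = sat G v (\<phi>s ! i)" if "i < length \<phi>s" for i
    proof -
      have i: "i < n" "\<Psi> ! i = \<phi>s ! i"
        using that by (auto simp: n_def \<Psi>_def nth_append)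
      then have "size (\<phi>s ! i) \<le> Max (size ` set \<Psi>)"
        by (intro Max_ge) (auto simp: n_def in_set_conv_nth intro!: image_eqI[of _ _ "\<phi>s ! i"])
      then show ?thesis
        using correct[OF i _ v, of "rounds A"] by (simp add: A_def)
    qed
    moreover have "length \<phi>s \<le> n"
      by (simp add: n_def \<Psi>_def)
    ultimately show ?thesis
      using len by (intro nth_equalityI) (auto simp: A_def)
  qed
  ultimately show ?thesis
    unfolding equivalent_def formulas_output_def cpg_output_def suffix_vertices_def by (intro exI[of _ A]) auto
qed

section \<open>Exact floating-point arithmetic\<close>

text \<open>A sparse column of a weight matrix, listed as pairs of an index and a coefficient;
  coefficients with the same index add up.\<close>

definition coef :: "(nat \<times> real) list \<Rightarrow> nat \<Rightarrow> real" where
  "coef ps k = (\<Sum>(j, c) \<leftarrow> ps. if k = j then c else 0)"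

lemma coef_Nil [simp]: "coef [] k = 0"
  by (simp add: coef_def)

lemma coef_Cons [simp]: "coef ((j, c) # ps) k = (if k = j then c else 0) + coef ps k"
  by (simp add: coef_def)

lemma sum_coef:
  "\<forall>(j, c) \<in> set ps. j < d \<Longrightarrow> (\<Sum>k<d. a k * coef ps k) = (\<Sum>(j, c) \<leftarrow> ps. c * a j)"
proof (induction ps)
  case (Cons x ps)
  obtain j c where x: "x = (j, c)"
    by (cases x)
  have "(\<Sum>k<d. a k * (if k = j then c else 0)) = (\<Sum>k<d. if k = j then a k * c else 0)"
    by (intro sum.cong) auto
  also have "\<dots> = a j * c"
    using Cons.prems x by simp
  finally show ?case
    using Cons x by (simp add: ring_distribs sum.distrib)
qed simp

text \<open>Only an inequality, because coefficients listed under the same index may cancel.\<close>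

lemma sum_abs_coef:
  "\<forall>(j, c) \<in> set ps. j < d \<Longrightarrow> (\<Sum>k<d. \<bar>a k * coef ps k\<bar>) \<le> (\<Sum>(j, c) \<leftarrow> ps. \<bar>c * a j\<bar>)"
proof (induction ps)
  case (Cons x ps)
  obtain j c where x: "x = (j, c)"
    by (cases x)
  have "(\<Sum>k<d. \<bar>a k * coef (x # ps) k\<bar>) \<le> (\<Sum>k<d. (if k = j then \<bar>a k * c\<bar> else 0) + \<bar>a k * coef ps k\<bar>)"
    unfolding x by (intro sum_mono) (auto simp: ring_distribs)
  also have "\<dots> = \<bar>c * a j\<bar> + (\<Sum>k<d. \<bar>a k * coef ps k\<bar>)"
    using Cons.prems x by (simp add: sum.distrib mult.commute)
  also have "\<dots> \<le> (\<Sum>(j, c) \<leftarrow> x # ps. \<bar>c * a j\<bar>)"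
    using Cons x by simp
  finally show ?case .
qed simp

lemma mult_coef_int:
  fixes u :: real
  assumes "\<forall>(j, c) \<in> set ps. \<exists>n::int. c * a j = of_int n * u"
  shows "\<exists>n::int. a k * coef ps k = of_int n * u"
  using assms
proof (induction ps)
  case Nil
  then show ?case
    by (intro exI[of _ 0]) simp
next
  case (Cons x ps)
  obtain j c where x: "x = (j, c)"
    by (cases x)
  obtain n m :: int where "c * a j = of_int n * u" "a k * coef ps k = of_int m * u"
    using Cons x by auto
  then show ?case
    unfolding x by (intro exI[of _ "(if k = j then n else 0) + m"]) (simp add: ring_distribs mult.commute)
qed

context format
begin

definition representable :: "real \<Rightarrow> bool" where
  "representable r \<longleftrightarrow> (\<exists>e s. fl_ok p q e s \<and> \<bar>r\<bar> = mag p q e s)"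

text \<open>A relation, since both zeros represent 0. It excludes infinities and NaN, so a proof of
  \<open>rep\<close> is also a proof that nothing overflowed.\<close>

definition rep :: "flt \<Rightarrow> real \<Rightarrow> bool" where
  "rep x r \<longleftrightarrow> x \<in> flts p q \<and> represents p q x r"

lemma rep_Fl: "rep (Fl b e s) r \<longleftrightarrow> fl_ok p q e s \<and> r = (if b then - mag p q e s else mag p q e s)"
  by (auto simp: rep_def represents_def fval_def)

lemma repE:
  assumes "rep x r"
  obtains b e s where "x = Fl b e s" "fl_ok p q e s" "r = (if b then - mag p q e s else mag p q e s)"
proof (cases x)
  case (Fl b e s)
  then show ?thesis
    using assms that[of b e s] by (simp add: rep_Fl)
qed (use assms in \<open>auto simp: rep_def represents_def\<close>)

lemma rep_unique: "rep x r \<Longrightarrow> rep x r' \<Longrightarrow> r = r'"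
  by (auto elim!: repE simp: rep_Fl)

lemma rep_representable: "rep x r \<Longrightarrow> representable r"
  by (erule repE) (auto simp: representable_def mag_nonneg split: if_splits)

lemma representable_0 [simp]: "representable 0"
  unfolding representable_def using ok_zero mag_zero_iff[of 0 0] by force

lemma representable_minus [simp]: "representable (- r) = representable r"
  by (simp add: representable_def)

lemma rep_fzero [simp]: "rep (fzero b) 0"
  using ok_zero mag_zero_iff[of 0 0] by (simp add: fzero_def rep_Fl)

lemma rep_fround:
  assumes "representable r" "0 \<le> r"
  shows "rep (fround p q b r) (if b then - r else r)"
proof -
  obtain e s where "fl_ok p q e s" "r = mag p q e s"
    using assms by (auto simp: representable_def)
  then show ?thesis
    by (simp add: fround_mag rep_Fl)
qed

text \<open>For results outside the format: the rounded value is nearest and does not cross any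
  representable number.\<close>

lemma rep_fround_approx:
  assumes "0 \<le> r" "r < overflow_bound p q"
  obtains r' where "rep (fround p q b r) (if b then - r' else r')" "0 \<le> r'"
    "\<And>t. representable t \<Longrightarrow> 0 \<le> t \<Longrightarrow> \<bar>r' - r\<bar> \<le> \<bar>t - r\<bar>"
    "\<And>t. representable t \<Longrightarrow> 0 \<le> t \<Longrightarrow> t \<le> r \<Longrightarrow> t \<le> r'"
    "\<And>t. representable t \<Longrightarrow> r \<le> t \<Longrightarrow> r' \<le> t"
    "\<exists>e s. fl_ok p q e s \<and> r' = mag p q e s"
proof -
  obtain e s where es: "fround p q b r = Fl b e s" "(e, s) \<in> nearest p q r"
    using fround_nearest[OF assms(2)] by blast
  have near: "\<bar>mag p q e s - r\<bar> \<le> \<bar>t - r\<bar>" if "representable t" "0 \<le> t" for t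
    using that es(2) by (auto simp: representable_def nearest_def)
  show thesis
  proof (rule that[of "mag p q e s"])
    show "rep (fround p q b r) (if b then - mag p q e s else mag p q e s)"
      using es nearest_ok by (simp add: rep_Fl)
    show "t \<le> mag p q e s" if "representable t" "0 \<le> t" "t \<le> r" for t
      using near[OF that(1,2)] that(3) by linarith
    show "mag p q e s \<le> t" if "representable t" "r \<le> t" for t
      using near[OF that(1)] that(2) assms(1) by linarith
    show "\<exists>e' s'. fl_ok p q e' s' \<and> mag p q e s = mag p q e' s'"
      using nearest_ok[OF es(2)] by blast
  qed (use near mag_nonneg in auto)
qed

lemma rep_fadd:
  assumes "rep x a" "rep y b" "representable (a + b)"
  shows "rep (fadd p q x y) (a + b)"
proof -
  obtain bx ex sx by' ey sy where xy: "x = Fl bx ex sx" "y = Fl by' ey sy"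
    and v: "a = fval p q bx ex sx" "b = fval p q by' ey sy"
    using assms(1,2) by (auto elim!: repE simp: fval_def)
  show ?thesis
  proof (cases "a + b = 0")
    case True
    then show ?thesis
      using v by (simp add: xy Let_def)
  next
    case False
    have "representable \<bar>a + b\<bar>"
      using assms(3) by (simp add: representable_def)
    then have "rep (fround p q (a + b < 0) \<bar>a + b\<bar>) (a + b)"
      using rep_fround[of "\<bar>a + b\<bar>" "a + b < 0"] by (cases "a + b < 0") (simp_all add: add.commute)
    then show ?thesis
      using False v by (simp add: xy Let_def)
  qed
qed

lemma fadd_eq_fround:
  assumes "rep x a" "rep y b" "a + b \<noteq> 0"
  shows "fadd p q x y = fround p q (a + b < 0) \<bar>a + b\<bar>"
proof -
  obtain bx ex sx by' ey sy where xy: "x = Fl bx ex sx" "y = Fl by' ey sy"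
    and v: "a = fval p q bx ex sx" "b = fval p q by' ey sy"
    using assms(1,2) by (auto elim!: repE simp: fval_def)
  then show ?thesis
    using assms(3) by (simp add: Let_def)
qed

lemma fmul_eq_fround:
  assumes "rep x a" "rep y b"
  obtains c where "fmul p q x y = fround p q c \<bar>a * b\<bar>" "a * b = (if c then - \<bar>a * b\<bar> else \<bar>a * b\<bar>)"
proof -
  obtain bx ex sx by' ey sy where xy: "x = Fl bx ex sx" "y = Fl by' ey sy"
    and v: "a = (if bx then - mag p q ex sx else mag p q ex sx)" "b = (if by' then - mag p q ey sy else mag p q ey sy)"
    using assms(1,2) by (auto elim!: repE)
  have "\<bar>a * b\<bar> = mag p q ex sx * mag p q ey sy"
    by (simp add: v abs_mult mag_nonneg)
  then show thesis
    by (intro that[of "bx \<noteq> by'"]) (auto simp: xy v)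
qed

lemma rep_fmul:
  assumes "rep x a" "rep y b" "representable (a * b)"
  shows "rep (fmul p q x y) (a * b)"
proof -
  obtain c where c: "fmul p q x y = fround p q c \<bar>a * b\<bar>" "a * b = (if c then - \<bar>a * b\<bar> else \<bar>a * b\<bar>)"
    using fmul_eq_fround[OF assms(1,2)] .
  have "representable \<bar>a * b\<bar>"
    using assms(3) by (simp add: representable_def)
  then show ?thesis
    using rep_fround[of "\<bar>a * b\<bar>" c] c by (simp del: abs_mult)
qed

lemma rep_fdiv_1:
  assumes "rep x a" "rep y 1"
  shows "rep (fdiv p q x y) a"
proof -
  obtain bx ex sx by' ey sy where xy: "x = Fl bx ex sx" "y = Fl by' ey sy"
    and ok: "fl_ok p q ex sx"
    and v: "a = (if bx then - mag p q ex sx else mag p q ex sx)" "1 = (if by' then - mag p q ey sy else mag p q ey sy)"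
    using assms(1,2) by (auto elim!: repE)
  have by': "\<not> by'" "mag p q ey sy = 1"
    using v(2) mag_nonneg[of ey sy] by (auto split: if_splits)
  then have "sy \<noteq> 0"
    using mag_zero_iff[of ey sy] by auto
  then show ?thesis
    using by' v(1) ok by (simp add: xy fround_mag rep_Fl)
qed

lemma rep_frelu: "rep x a \<Longrightarrow> rep (frelu x) (max 0 a)"
proof (erule repE)
  fix b e s
  assume *: "x = Fl b e s" "fl_ok p q e s" "a = (if b then - mag p q e s else mag p q e s)"
  show ?thesis
  proof (cases b)
    case True
    then have "max 0 a = 0"
      using * mag_nonneg[of e s] by simp
    then show ?thesis
      using True * by simp
  next
    case False
    then show ?thesis
      using * mag_nonneg[of e s] by (simp add: rep_Fl)
  qed
qed

lemma mag_representable: "fl_ok p q e s \<Longrightarrow> representable (mag p q e s)"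
  by (auto simp: representable_def mag_nonneg)

text \<open>With a positive exponent and no leading bit, \<open>s\<close> is not an admissible
  significand. It is normalised by doubling \<open>s\<close> and lowering the exponent.\<close>

lemma representable_nat:
  assumes "k < 2 ^ q"
  shows "s < 2 ^ p \<Longrightarrow> representable (real s * 2 ^ k * eta)"
  using assms
proof (induction k arbitrary: s)
  case 0
  then have "fl_ok p q 0 s"
    by (auto simp: fl_ok_def normalised_def subnormalised_def)
  then show ?case
    using mag_representable[of 0 s] by (simp add: mag_eq)
next
  case (Suc k)
  show ?case
  proof (cases "2 ^ (p - 1) \<le> s")
    case True
    then have "fl_ok p q (Suc k) s"
      using Suc.prems by (auto simp: fl_ok_def normalised_def)
    then show ?thesis
      unfolding mag_eq[symmetric] by (rule mag_representable)
  next
    case False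
    then have "2 * s < 2 * 2 ^ (p - 1)"
      by simp
    also have "(2::nat) * 2 ^ (p - 1) = 2 ^ p"
      using p_pos by (cases p) auto
    finally show ?thesis
      using Suc.IH[of "2 * s"] Suc.prems by (simp add: mult.assoc mult.left_commute)
  qed
qed

text \<open>A grid of spacing \<open>u\<close> on which all multiples up to \<open>M * u\<close> are
  floats. Arithmetic that stays on such a grid is exact, which replaces all error analysis where no
  rounding is intended.\<close>

definition unit :: "nat \<Rightarrow> real \<Rightarrow> bool" where
  "unit M u \<longleftrightarrow> 0 < u \<and> (\<forall>n::int. \<bar>n\<bar> \<le> int M \<longrightarrow> representable (of_int n * u))"

lemma unit_representable:
  fixes r :: real
  assumes "unit M u" "r = of_int n * u" "\<bar>r\<bar> \<le> real M * u"
  shows "representable r"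
proof -
  have "\<bar>real_of_int n\<bar> * u \<le> real M * u"
    using assms by (simp add: unit_def abs_mult)
  then have "\<bar>real_of_int n\<bar> \<le> real M"
    using assms(1) by (simp add: unit_def)
  then have "\<bar>n\<bar> \<le> int M"
    by linarith
  then show ?thesis
    using assms(1,2) by (simp add: unit_def)
qed

lemma unit_eta:
  assumes "k < 2 ^ q" "M < 2 ^ p"
  shows "unit M (2 ^ k * eta)"
proof -
  have "representable (of_int n * (2 ^ k * eta))" if "\<bar>n\<bar> \<le> int M" for n
  proof -
    have "representable (real (nat \<bar>n\<bar>) * 2 ^ k * eta)"
      using that assms by (intro representable_nat) linarith+
    then have "representable \<bar>of_int n * (2 ^ k * eta)\<bar>"
      using eta_pos by (simp add: abs_mult mult.assoc)
    then show ?thesis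
      by (simp add: representable_def)
  qed
  then show ?thesis
    using eta_pos by (simp add: unit_def)
qed

lemma unit_of_representable:
  assumes "representable r"
  obtains M u and n :: int where "unit M u" "r = of_int n * u" "\<bar>r\<bar> \<le> real M * u"
proof -
  obtain e s where es: "fl_ok p q e s" "\<bar>r\<bar> = mag p q e s"
    using assms by (auto simp: representable_def)
  then have b: "e < 2 ^ q" "s < 2 ^ p"
    using ok_bound by auto
  show thesis
  proof (rule that[OF unit_eta[OF b]])
    show "r = of_int (if r < 0 then - int s else int s) * (2 ^ e * eta)"
      using es(2) by (auto simp: mag_eq mult.assoc)
    show "\<bar>r\<bar> \<le> real s * (2 ^ e * eta)"
      using es(2) by (simp add: mag_eq)
  qed
qed

text \<open>The value 0 at infinities and NaN is a dummy; \<open>rep\<close> and \<open>finv\<close>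
  exclude these cases where the value is used.\<close>

primrec rv :: "flt \<Rightarrow> real" where
  "rv (Fl b e s) = (if b then - mag p q e s else mag p q e s)"
| "rv (Infty b) = 0"
| "rv NaN = 0"

lemma rv_rep: "rep x r \<Longrightarrow> rv x = r"
  by (erule repE) simp

text \<open>The sum of absolute values bounds every partial sum in whatever order the summands come,
  so sorting by rank cannot lead off the grid.\<close>

lemma foldl_fadd_exact:
  assumes "unit M u" "\<forall>y \<in> set ys. \<exists>n::int. rep y (of_int n * u)"
    and "rep a (of_int m * u)" "\<bar>of_int m * u\<bar> + (\<Sum>y \<leftarrow> ys. \<bar>rv y\<bar>) \<le> real M * u"
  shows "rep (foldl (fadd p q) a ys) (of_int m * u + (\<Sum>y \<leftarrow> ys. rv y))"
  using assms(2-)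
proof (induction ys arbitrary: a m)
  case (Cons y ys)
  obtain n :: int where n: "rep y (of_int n * u)"
    using Cons.prems by auto
  have nn: "0 \<le> (\<Sum>y \<leftarrow> ys. \<bar>rv y\<bar>)"
    by (rule sum_list_nonneg) auto
  have bound: "\<bar>of_int (m + n) * u\<bar> + (\<Sum>y \<leftarrow> ys. \<bar>rv y\<bar>) \<le> real M * u"
    using Cons.prems(3) rv_rep[OF n] abs_triangle_ineq[of "of_int m * u" "of_int n * u"]
    by (simp add: ring_distribs)
  then have "representable (of_int (m + n) * u)"
    using nn by (intro unit_representable[OF assms(1) refl]) linarith
  then have "rep (fadd p q a y) (of_int (m + n) * u)"
    using rep_fadd[OF Cons.prems(2) n] by (simp add: ring_distribs)
  then show ?case
    using Cons.IH[of "fadd p q a y" "m + n"] Cons.prems(1) bound rv_rep[OF n]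
    by (simp add: ring_distribs add.assoc)
qed simp

lemma sum_list_sort_key: "sum_list (map f (sort_key k xs)) = (sum_list (map f xs) :: real)"
  by (metis mset_map mset_sort sum_mset_sum_list)

lemma rep_fsum:
  assumes "unit M u" "\<forall>x \<in> set xs. \<exists>n::int. rep x (of_int n * u)"
    and "(\<Sum>x \<leftarrow> xs. \<bar>rv x\<bar>) \<le> real M * u"
  shows "rep (fsum p q xs) (\<Sum>x \<leftarrow> xs. rv x)"
proof (cases "sort_key (rank p q) xs")
  case Nil
  then have "xs = []"
    by (metis set_empty set_sort)
  then show ?thesis
    by (simp add: fsum_def)
next
  case (Cons y ys)
  have mem: "\<forall>x \<in> set (y # ys). \<exists>n::int. rep x (of_int n * u)"
    using assms(2) unfolding Cons[symmetric] by simp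
  then obtain m :: int where m: "rep y (of_int m * u)"
    by auto
  have "rep (foldl (fadd p q) y ys) (of_int m * u + (\<Sum>y \<leftarrow> ys. rv y))"
    using assms(3) sum_list_sort_key[of "\<lambda>x. \<bar>rv x\<bar>" "rank p q" xs] mem rv_rep[OF m] unfolding Cons
    by (intro foldl_fadd_exact[OF assms(1) _ m]) auto
  moreover have "(\<Sum>x \<leftarrow> xs. rv x) = of_int m * u + (\<Sum>y \<leftarrow> ys. rv y)"
    using sum_list_sort_key[of rv "rank p q" xs] rv_rep[OF m] unfolding Cons by simp
  ultimately show ?thesis
    by (simp add: fsum_def Cons)
qed

lemma rep_fsum_zero: "\<forall>x \<in> set xs. rep x 0 \<Longrightarrow> rep (fsum p q xs) 0"
proof -
  assume *: "\<forall>x \<in> set xs. rep x 0"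
  then have "map rv xs = map (\<lambda>_. 0) xs" "map (\<lambda>x. \<bar>rv x\<bar>) xs = map (\<lambda>_. 0) xs"
    using rv_rep by auto
  then have z: "(\<Sum>x \<leftarrow> xs. rv x) = 0" "(\<Sum>x \<leftarrow> xs. \<bar>rv x\<bar>) = 0"
    by (simp_all only: sum_list_0)
  have "\<exists>n::int. rep x (of_int n * (2 ^ 0 * eta))" if "x \<in> set xs" for x
    using * that by (intro exI[of _ 0]) simp
  then have "rep (fsum p q xs) (\<Sum>x \<leftarrow> xs. rv x)"
    using z(2) by (intro rep_fsum[OF unit_eta[of 0 0]]) auto
  then show ?thesis
    unfolding z .
qed

text \<open>Only the listed coefficients enter the bound, however large the dimension is; all other
  products are zeros and lie on every grid.\<close>

lemma rep_dot:
  fixes x w :: "nat \<Rightarrow> flt"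
  assumes "unit M u" "\<And>k. k < d \<Longrightarrow> rep (x k) (a k)" "\<And>k. k < d \<Longrightarrow> rep (w k) (coef ps k)"
    and ps: "\<forall>(j, c) \<in> set ps. j < d" "\<forall>(j, c) \<in> set ps. \<exists>n::int. c * a j = of_int n * u"
    and bound: "(\<Sum>(j, c) \<leftarrow> ps. \<bar>c * a j\<bar>) \<le> real M * u"
  shows "rep (fsum p q (map (\<lambda>k. fmul p q (x k) (w k)) [0..<d])) (\<Sum>(j, c) \<leftarrow> ps. c * a j)"
proof -
  have le: "(\<Sum>k<d. \<bar>a k * coef ps k\<bar>) \<le> real M * u"
    using sum_abs_coef[OF ps(1), of a] bound by linarith
  have int: "\<exists>n::int. a k * coef ps k = of_int n * u" for k
    using ps(2) by (rule mult_coef_int)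
  have prods: "rep (fmul p q (x k) (w k)) (a k * coef ps k)" if "k < d" for k
  proof (rule rep_fmul[OF assms(2)[OF that] assms(3)[OF that]])
    obtain n :: int where n: "a k * coef ps k = of_int n * u"
      using int by blast
    have "\<bar>a k * coef ps k\<bar> \<le> (\<Sum>k<d. \<bar>a k * coef ps k\<bar>)"
      using that by (intro member_le_sum) auto
    then show "representable (a k * coef ps k)"
      using le by (intro unit_representable[OF assms(1) n]) linarith
  qed
  have sums: "(\<Sum>x \<leftarrow> map (\<lambda>k. fmul p q (x k) (w k)) [0..<d]. g (rv x)) = (\<Sum>k<d. g (a k * coef ps k))" for g :: "real \<Rightarrow> real"
  proof -
    have "map (\<lambda>y. g (rv y)) (map (\<lambda>k. fmul p q (x k) (w k)) [0..<d]) = map (\<lambda>k. g (a k * coef ps k)) [0..<d]"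
      using prods by (auto intro!: arg_cong[of _ _ g] rv_rep)
    then have "(\<Sum>x \<leftarrow> map (\<lambda>k. fmul p q (x k) (w k)) [0..<d]. g (rv x)) = sum_list (map (\<lambda>k. g (a k * coef ps k)) [0..<d])"
      by (simp only:)
    also have "\<dots> = (\<Sum>k<d. g (a k * coef ps k))"
      by (simp add: interv_sum_list_conv_sum_set_nat atLeast0LessThan)
    finally show ?thesis .
  qed
  have "rep (fsum p q (map (\<lambda>k. fmul p q (x k) (w k)) [0..<d]))
      (\<Sum>x \<leftarrow> map (\<lambda>k. fmul p q (x k) (w k)) [0..<d]. rv x)"
  proof (rule rep_fsum[OF assms(1)])
    show "\<forall>y \<in> set (map (\<lambda>k. fmul p q (x k) (w k)) [0..<d]). \<exists>n::int. rep y (of_int n * u)"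
    proof
      fix y
      assume "y \<in> set (map (\<lambda>k. fmul p q (x k) (w k)) [0..<d])"
      then obtain k where "k < d" "y = fmul p q (x k) (w k)"
        by auto
      then show "\<exists>n::int. rep y (of_int n * u)"
        using prods[of k] int[of k] by metis
    qed
    show "(\<Sum>x \<leftarrow> map (\<lambda>k. fmul p q (x k) (w k)) [0..<d]. \<bar>rv x\<bar>) \<le> real M * u"
      unfolding sums[of abs] by (rule le)
  qed
  then show ?thesis
    unfolding sums[of "\<lambda>x. x"] sum_coef[OF ps(1)] .
qed

text \<open>From \<open>2 ^ (p + 1 + T)\<close> units on, floats are at least
  \<open>2 ^ (T + 2)\<close> units apart, four times the largest summand. An accumulator that has
  not passed this float is therefore rounded back to it at worst. Sums of small non-negative floats
  thus saturate instead of overflowing, however many there are.\<close>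

lemma fadd_saturated:
  assumes T: "T + 3 < 2 ^ q"
    and a: "rep a r" "0 \<le> r" "r \<le> 2 ^ (p + 1 + T) * eta"
    and b: "rep b c" "0 \<le> c" "c \<le> 2 ^ T * eta"
  shows "\<exists>r'. rep (fadd p q a b) r' \<and> r \<le> r' \<and> c \<le> r' \<and> r' \<le> 2 ^ (p + 1 + T) * eta \<and>
    (\<forall>t. representable t \<longrightarrow> 0 \<le> t \<longrightarrow> t \<le> r + c \<longrightarrow> t \<le> r')"
proof (cases "r + c = 0")
  case True
  then have "r = 0" "c = 0"
    using a b by auto
  then show ?thesis
    using rep_fadd[OF a(1) b(1)] eta_pos by (intro exI[of _ 0]) auto
next
  case False
  let ?U = "2 ^ (p + 1 + T) * eta"
  \<comment> \<open>The saturation point is the float with exponent \<open>T + 2\<close> and the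
    least normalised significand, and its double has exponent \<open>T + 3\<close>; hence the
    assumption on \<open>T\<close>.\<close>
  have pow: "(2::real) ^ (p + 1 + T) = 2 ^ (p - 1) * 2 ^ (T + 2)" "(2::real) ^ (p + 1 + T) * 2 = 2 ^ (p - 1) * 2 ^ (T + 3)"
    using p_pos by (cases p; simp add: power_add)+
  have "representable (real (2 ^ (p - 1)) * 2 ^ (T + 2) * eta)"
    using T p_pos by (intro representable_nat) auto
  then have U: "representable ?U"
    unfolding pow(1) by simp
  have "fl_ok p q (T + 3) (2 ^ (p - 1))"
    using T p_pos by (simp add: fl_ok_def normalised_def)
  then have "mag p q (T + 3) (2 ^ (p - 1)) < overflow_bound p q"
    by (rule mag_less_overflow)
  then have ovf: "2 * ?U < overflow_bound p q"
    using pow(2) by (simp add: mag_eq mult.commute mult.left_commute)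
  have TU: "2 ^ T * eta \<le> ?U"
    using eta_pos by (intro mult_right_mono power_increasing) auto
  have "fadd p q a b = fround p q False (r + c)"
    using fadd_eq_fround[OF a(1) b(1) False] a b by simp
  moreover have "r + c < overflow_bound p q"
    using a b TU ovf by linarith
  moreover have "0 \<le> r + c"
    using a b by simp
  ultimately obtain r' where r': "rep (fadd p q a b) r'" "0 \<le> r'"
    "\<And>t. representable t \<Longrightarrow> 0 \<le> t \<Longrightarrow> \<bar>r' - (r + c)\<bar> \<le> \<bar>t - (r + c)\<bar>"
    "\<And>t. representable t \<Longrightarrow> 0 \<le> t \<Longrightarrow> t \<le> r + c \<Longrightarrow> t \<le> r'"
    "\<exists>e s. fl_ok p q e s \<and> r' = mag p q e s"
    using rep_fround_approx[of "r + c" False] by (metis (full_types))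
  have "r \<le> r'" "c \<le> r'"
    using r'(4)[of r] r'(4)[of c] a b rep_representable by auto
  moreover have "r' \<le> ?U"
  proof (rule ccontr)
    assume "\<not> r' \<le> ?U"
    then have gt: "?U < r'"
      by simp
    obtain e s where es: "fl_ok p q e s" "r' = real s * 2 ^ e * eta"
      using r'(5) by (auto simp: mag_eq)
    have s: "s < 2 ^ p"
      using ok_bound[OF es(1)] by simp
    have "real (2 ^ (p + 1 + T)) < real (s * 2 ^ e)"
      using gt eta_pos unfolding es(2) by simp
    then have lt: "2 ^ (p + 1 + T) < s * 2 ^ e"
      by (rule iffD1[OF of_nat_less_iff])
    \<comment> \<open>A float beyond the saturation point has a large exponent, so both are
      multiples of \<open>2 ^ (T + 2)\<close> units and so is their distance.\<close>
    have "T + 2 \<le> e"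
    proof (rule ccontr)
      assume "\<not> T + 2 \<le> e"
      then have "s * 2 ^ e \<le> 2 ^ p * 2 ^ (T + 1)"
        using s by (intro mult_mono power_increasing) auto
      then show False
        using lt by (simp add: power_add mult.commute mult.left_commute)
    qed
    then have "(2::nat) ^ (T + 2) dvd s * 2 ^ e" "(2::nat) ^ (T + 2) dvd 2 ^ (p + 1 + T)"
      using p_pos by (intro dvd_mult le_imp_power_dvd; simp)+
    then have "(2::nat) ^ (T + 2) dvd s * 2 ^ e - 2 ^ (p + 1 + T)"
      by (rule dvd_diff_nat)
    then have "2 ^ (T + 2) \<le> s * 2 ^ e - 2 ^ (p + 1 + T)"
      using lt by (intro dvd_imp_le) auto
    then have "2 ^ (p + 1 + T) + 2 ^ (T + 2) \<le> s * 2 ^ e"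
      using lt by linarith
    then have "real (2 ^ (p + 1 + T) + 2 ^ (T + 2)) \<le> real (s * 2 ^ e)"
      by (rule of_nat_mono)
    then have "(2 ^ (p + 1 + T) + 2 ^ (T + 2)) * eta \<le> real (s * 2 ^ e) * eta"
      using eta_pos by (intro mult_right_mono) simp_all
    then have far: "?U + 4 * (2 ^ T * eta) \<le> r'"
      unfolding es(2) by (simp add: ring_distribs power_add)
    have "\<bar>r' - (r + c)\<bar> \<le> \<bar>?U - (r + c)\<bar>"
      using r'(3)[OF U] eta_pos by simp
    then show False
      using far a(3) b(3) gt eta_pos zero_less_mult_iff[of "2 ^ T" eta] by (simp add: abs_if split: if_splits)
  qed
  ultimately show ?thesis
    using r'(1,4) by blast
qed

lemma foldl_fadd_saturated:
  assumes T: "T + 3 < 2 ^ q"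
    and "\<forall>y \<in> set ys. \<exists>c. rep y c \<and> 0 \<le> c \<and> c \<le> 2 ^ T * eta"
    and "rep a r" "0 \<le> r" "r \<le> 2 ^ (p + 1 + T) * eta"
  shows "\<exists>r'. rep (foldl (fadd p q) a ys) r' \<and> r \<le> r' \<and> (\<forall>y \<in> set ys. rv y \<le> r') \<and> r' \<le> 2 ^ (p + 1 + T) * eta"
  using assms(2-)
proof (induction ys arbitrary: a r)
  case (Cons y ys)
  obtain c where c: "rep y c" "0 \<le> c" "c \<le> 2 ^ T * eta"
    using Cons.prems by auto
  obtain r1 where r1: "rep (fadd p q a y) r1" "r \<le> r1" "c \<le> r1" "r1 \<le> 2 ^ (p + 1 + T) * eta"
    using fadd_saturated[OF T Cons.prems(2-4) c] by blast
  then obtain r' where "rep (foldl (fadd p q) (fadd p q a y) ys) r'" "r1 \<le> r'" "\<forall>y \<in> set ys. rv y \<le> r'"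
    "r' \<le> 2 ^ (p + 1 + T) * eta"
    using Cons.IH[of "fadd p q a y" r1] Cons.prems by force
  then show ?case
    using r1 rv_rep[OF c(1)] by (intro exI[of _ r']) auto
qed auto

text \<open>The bound does not depend on the number of summands. This keeps softmax denominators and
  head outputs finite on inputs of any length.\<close>

lemma fsum_saturated:
  assumes T: "T + 3 < 2 ^ q"
    and "\<forall>y \<in> set xs. \<exists>c. rep y c \<and> 0 \<le> c \<and> c \<le> 2 ^ T * eta"
  shows "\<exists>r. rep (fsum p q xs) r \<and> 0 \<le> r \<and> (\<forall>y \<in> set xs. rv y \<le> r) \<and> r \<le> 2 ^ (p + 1 + T) * eta"
proof (cases "sort_key (rank p q) xs")
  case Nil
  then have "xs = []"
    by (metis set_empty set_sort)
  then show ?thesis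
    using eta_pos by (intro exI[of _ 0]) (simp add: fsum_def)
next
  case (Cons y ys)
  have set: "set xs = set (y # ys)"
    unfolding Cons[symmetric] by simp
  obtain c where c: "rep y c" "0 \<le> c" "c \<le> 2 ^ T * eta"
    using assms(2) set by auto
  moreover have "2 ^ T * eta \<le> 2 ^ (p + 1 + T) * eta"
    using eta_pos by (intro mult_right_mono power_increasing) auto
  ultimately obtain r' where "rep (foldl (fadd p q) y ys) r'" "c \<le> r'" "\<forall>y \<in> set ys. rv y \<le> r'"
    "r' \<le> 2 ^ (p + 1 + T) * eta"
    using foldl_fadd_saturated[OF T, of ys y c] assms(2) set by force
  then show ?thesis
    using c rv_rep[OF c(1)] unfolding set by (intro exI[of _ r']) (auto simp: fsum_def Cons)
qed

end

section \<open>Softmax over equal scores\<close>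

text \<open>The format of the compiled transformer. \<open>\<kappa>\<close> bounds the thresholds of
  \<open>GPre\<close>; weights have error at most \<open>1 / 2 ^ p\<close>, and the last assumption
  keeps this error below 1/64 after multiplication by two numbers of size up to
  \<open>\<kappa> + 2\<close>.\<close>

locale large_format = arithmetic +
  fixes \<kappa> :: nat
  assumes q_eq: "q = p" and p_ge: "8 \<le> p" and \<kappa>_bound: "64 * (\<kappa> + 2) ^ 2 \<le> (2::nat) ^ p"
begin

text \<open>The position of 1 in the format, \<open>p - 1\<close> plus the bias: 1 is
  \<open>2 ^ L\<close> units of \<open>eta\<close>.\<close>

definition L :: nat where
  "L = p + 2 ^ (p - 1) - 2"

text \<open>Up to \<open>7 B\<close> is representable, but \<open>8 B\<close> overflows.\<close>

definition B :: real where
  "B = 2 ^ (p - 3) * (2 ^ (2 ^ q - 1) * eta)"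

lemma pow_bounds: "2 * p + 3 \<le> 2 ^ (p - 1)" "(2::nat) ^ p = 2 * 2 ^ (p - 1)"
proof -
  have "2 * (8 + n) + 3 \<le> (2::nat) ^ (8 + n - 1)" for n
  proof (induction n)
    case (Suc n)
    have "8 + Suc n - 1 = Suc (8 + n - 1)"
      by simp
    then have "(2::nat) ^ (8 + Suc n - 1) = 2 * 2 ^ (8 + n - 1)"
      by (simp only: power_Suc)
    moreover have "2 * (8 + Suc n) + 3 \<le> 2 * (2 * (8 + n) + 3)"
      by simp
    ultimately show ?case
      using Suc by simp
  qed simp
  from this[of "p - 8"] show "2 * p + 3 \<le> 2 ^ (p - 1)"
    using p_ge by simp
  show "(2::nat) ^ p = 2 * 2 ^ (p - 1)"
    using p_pos by (cases p) auto
qed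

text \<open>Room on both sides of 1. The first bound is what \<open>fsum_saturated\<close> needs for
  summands up to \<open>2 ^ (p + 1)\<close>; the second makes fractions with denominator up to
  \<open>2 ^ (p + 1)\<close> representable.\<close>

lemma L_bounds: "L + p + 4 < 2 ^ q" "2 * p + 3 \<le> L"
  using pow_bounds p_ge unfolding L_def q_eq by linarith+

lemma eta_L: "2 ^ L * eta = 1"
proof -
  have "int L = int p + 2 ^ (p - 1) - 2"
    using p_ge by (simp add: L_def of_nat_diff)
  then have "int L + (1 - int p - bias q) = 0"
    by (simp add: bias_def q_eq)
  then have "(2::real) powi (int L) * 2 powi (1 - int p - bias q) = 1"
    by (metis power_int_0_right power_int_add zero_neq_numeral)
  then show ?thesis
    by (simp add: two_powi_nat eta_def)
qed

lemma two_pow_eta: "n \<le> L \<Longrightarrow> 2 ^ n * eta = 1 / 2 ^ (L - n)"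
  using eta_L power_add[of "2::real" n "L - n"] by (simp add: field_simps)

lemma two_pow_eta': "2 ^ (L + n) * eta = 2 ^ n"
  using eta_L by (simp add: power_add mult.commute mult.left_commute)

lemma unit_1: "unit (2 ^ p - 1) 1"
  using unit_eta[of L "2 ^ p - 1"] eta_L L_bounds by simp

lemma representable_int: "\<bar>n\<bar> < 2 ^ p \<Longrightarrow> representable (of_int n)"
  using unit_1 unfolding unit_def by (auto dest!: spec[of _ n] simp: of_nat_diff)

lemma representable_pow: "n < 2 ^ q \<Longrightarrow> representable (2 ^ n * eta)"
  using representable_nat[of n 1] p_pos one_less_power[of "2::nat" p] by simp

lemma representable_1: "representable 1"
  using representable_pow[of L] eta_L L_bounds by simp

lemma representable_two_pow: "n \<le> p + 1 \<Longrightarrow> representable (2 ^ n)"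
  using representable_pow[of "L + n"] L_bounds by (simp add: two_pow_eta')

lemma representable_frac:
  assumes "n < 2 ^ p" "i \<le> L"
  shows "representable (real n / 2 ^ i)"
proof -
  have "representable (real n * 2 ^ (L - i) * eta)"
    using L_bounds assms by (intro representable_nat) auto
  then show ?thesis
    using two_pow_eta[of "L - i"] assms(2) by (simp add: mult.assoc)
qed

lemma representable_real: "n < 2 ^ p \<Longrightarrow> representable (real n)"
  using representable_frac[of n 0] by simp

lemma B_pos: "0 < B"
  using eta_pos by (simp add: B_def)

lemma unit_B: "unit 7 B"
proof -
  have "representable (of_int n * B)" if n: "\<bar>n\<bar> \<le> 7" for n
  proof -
    have "8 * 2 ^ (p - 3) = (2::nat) ^ p"
      using p_ge power_add[of "2::nat" 3 "p - 3"] by simp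
    moreover have "\<bar>n * 2 ^ (p - 3)\<bar> \<le> 7 * 2 ^ (p - 3)"
      using n by (simp add: abs_mult)
    moreover have "unit (7 * 2 ^ (p - 3)) (2 ^ (2 ^ q - 1) * eta)"
    proof (rule unit_eta)
      have "(0::nat) < 2 ^ (p - 3)"
        by simp
      then show "7 * 2 ^ (p - 3) < (2::nat) ^ p"
        using \<open>8 * 2 ^ (p - 3) = 2 ^ p\<close> by linarith
    qed simp
    ultimately have "representable (of_int (n * 2 ^ (p - 3)) * (2 ^ (2 ^ q - 1) * eta))"
      unfolding unit_def by (metis of_nat_mult of_nat_numeral of_nat_power)
    then show ?thesis
      by (simp add: B_def mult.assoc)
  qed
  then show ?thesis
    using B_pos by (simp add: unit_def)
qed

lemma B_overflow: "overflow_bound p q \<le> 8 * B"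
proof -
  have "8 * B = 2 ^ p * 2 ^ (2 ^ q - 1) * eta"
    using p_ge power_add[of "2::real" 3 "p - 3"] by (simp add: B_def)
  moreover have "(2 ^ p - 1 / 2) * 2 ^ (2 ^ q - 1) * eta \<le> 2 ^ p * 2 ^ (2 ^ q - 1) * eta"
    using eta_pos by (intro mult_right_mono) simp_all
  ultimately show ?thesis
    by (simp add: overflow_bound_eq)
qed

lemma one_less_overflow: "1 < overflow_bound p q"
proof -
  obtain e s where "fl_ok p q e s" "1 = mag p q e s"
    using representable_1 by (auto simp: representable_def)
  then show ?thesis
    using mag_less_overflow by metis
qed

lemma fone_ok: "fl_ok p q (2 ^ (q - 1) - 1) (2 ^ (p - 1))"
proof -
  have "(2::nat) ^ (q - 1) \<le> 2 ^ q" "(0::nat) < 2 ^ (q - 1)" "(2::nat) ^ (p - 1) < 2 ^ p"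
    using p_pos by simp_all
  then show ?thesis
    unfolding fl_ok_def normalised_def by linarith
qed

lemma rep_fone: "rep (fone p q) 1"
proof -
  have "p - 1 + (2 ^ (q - 1) - 1) = L"
    using p_ge by (simp add: L_def q_eq)
  then have "mag p q (2 ^ (q - 1) - 1) (2 ^ (p - 1)) = 1"
    using eta_L by (simp add: mag_eq flip: power_add)
  then show ?thesis
    using fone_ok by (simp add: fone_def rep_Fl)
qed

text \<open>Beyond \<open>2 ^ p\<close> a sum of ones is no longer exact, but an integer below
  \<open>2 ^ p\<close> once reached is never lost: \<open>j + 1\<close> is a float not above the
  exact result, so rounding stays at or above it.\<close>

lemma foldl_fone_ge:
  assumes "\<forall>y \<in> set ys. y = fone p q \<or> y = fzero False" "N < 2 ^ p"
    and "rep a r" "0 \<le> r" "r \<le> 2 ^ (p + 1 + L) * eta" "real j \<le> r"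
    and "N \<le> j + count (mset ys) (fone p q)"
  shows "\<exists>r'. rep (foldl (fadd p q) a ys) r' \<and> real N \<le> r'"
  using assms(1,3-)
proof (induction ys arbitrary: a r j)
  case Nil
  then show ?case
    by (intro exI[of _ r]) auto
next
  case (Cons y ys)
  have T: "L + 3 < 2 ^ q"
    using L_bounds by simp
  show ?case
  proof (cases "y = fone p q")
    case True
    obtain r' where r': "rep (fadd p q a y) r'" "r \<le> r'" "r' \<le> 2 ^ (p + 1 + L) * eta"
      "\<forall>t. representable t \<longrightarrow> 0 \<le> t \<longrightarrow> t \<le> r + 1 \<longrightarrow> t \<le> r'"
      using fadd_saturated[OF T Cons.prems(2-4) rep_fone] eta_L True by auto
    show ?thesis
    proof (cases "j < N")
      case True
      then have "representable (real (j + 1))"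
        using assms(2) by (intro representable_real) simp
      then have "real (j + 1) \<le> r'"
        using r'(4) Cons.prems(5) by auto
      then show ?thesis
        using Cons.IH[of "fadd p q a y" r' "j + 1"] Cons.prems r' \<open>y = fone p q\<close> by auto
    next
      case False
      then show ?thesis
        using Cons.IH[of "fadd p q a y" r' j] Cons.prems r' by auto
    qed
  next
    case False
    then have y: "y = fzero False"
      using Cons.prems by auto
    obtain r' where r': "rep (fadd p q a y) r'" "r \<le> r'" "r' \<le> 2 ^ (p + 1 + L) * eta"
      using fadd_saturated[OF T Cons.prems(2-4), of y 0] eta_L y by auto
    then show ?thesis
      using Cons.IH[of "fadd p q a y" r' j] Cons.prems False by auto
  qed
qed

lemma fsum_fone_ge:
  assumes "\<forall>x \<in> set xs. x = fone p q \<or> x = fzero False" "N < 2 ^ p" "N \<le> count (mset xs) (fone p q)"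
    and "rep (fsum p q xs) r"
  shows "real N \<le> r"
proof (cases "sort_key (rank p q) xs")
  case Nil
  then have "xs = []"
    by (metis set_empty set_sort)
  then show ?thesis
    using assms(3,4) rep_unique[OF rep_fzero] by (fastforce simp: fsum_def)
next
  case (Cons y ys)
  have set: "set (y # ys) = set xs" and mset: "mset (y # ys) = mset xs"
    unfolding Cons[symmetric] by simp_all
  have ys: "\<forall>x \<in> set ys. x = fone p q \<or> x = fzero False"
    using assms(1) set by auto
  have U: "1 \<le> 2 ^ (p + 1 + L) * eta"
    using two_pow_eta'[of "p + 1"] one_le_power[of "2::real" "p + 1"] by (simp only: add.commute[of _ L])
  have N: "N \<le> count (mset (y # ys)) (fone p q)"
    using assms(3) mset by simp
  have "y = fone p q \<or> y = fzero False"
    using assms(1) set by auto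
  then have "\<exists>r'. rep (foldl (fadd p q) y ys) r' \<and> real N \<le> r'"
  proof
    assume "y = fone p q"
    then show ?thesis
      using foldl_fone_ge[OF ys assms(2), of y 1 1] rep_fone U N by simp
  next
    assume y: "y = fzero False"
    moreover have "y \<noteq> fone p q"
      unfolding y fzero_def fone_def by simp
    ultimately show ?thesis
      using foldl_fone_ge[OF ys assms(2), of y 0 0] order_trans[OF zero_le_one U] N by simp
  qed
  then show ?thesis
    using assms(4) rep_unique by (auto simp: fsum_def Cons)
qed

text \<open>The predicate \<open>tp\<close> marks the maximal scores, all of the same value, and
  every other score falls below them by an overflowing difference. All exponentials are then exactly
  1 or 0, the denominator is a sum of \<open>m\<close> ones, and \<open>W\<close> is the rounded
  reciprocal. A predicate is used because +0 and -0 are different floats with the same value and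
  must both count as maximal.\<close>

lemma weight_tops:
  fixes tp :: "flt \<Rightarrow> bool"
  assumes tp: "\<forall>s \<in> set ss. tp s \<longrightarrow> rep s a"
    and low: "\<forall>s \<in> set ss. \<forall>t \<in> set ss. \<not> tp s \<longrightarrow> tp t \<longrightarrow> rank p q s < rank p q t \<and> fsub p q s t = Infty True"
    and m: "m = length (filter tp ss)" "1 \<le> m"
  obtains W where "\<And>s. s \<in> set ss \<Longrightarrow> rep (weight ss s) (if tp s then W else 0)"
    "1 / 2 ^ (p + 1) \<le> W" "W \<le> 1" "m = 1 \<Longrightarrow> W = 1"
    "m < 2 ^ p \<Longrightarrow> \<bar>W - 1 / real m\<bar> \<le> 1 / 2 ^ p"
    "\<And>N. 1 \<le> N \<Longrightarrow> N \<le> m \<Longrightarrow> N < 2 ^ p \<Longrightarrow> W \<le> 1 / real N + 1 / 2 ^ p"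
proof -
  obtain s0 where s0: "s0 \<in> set ss" "tp s0"
  proof -
    have "filter tp ss \<noteq> []"
      using m by auto
    then have "hd (filter tp ss) \<in> set (filter tp ss)"
      by (rule hd_in_set)
    then have "hd (filter tp ss) \<in> set ss" "tp (hd (filter tp ss))"
      by simp_all
    then show thesis
      by (rule that)
  qed
  define \<beta> where "\<beta> = (ARG_MAX (rank p q) y. y \<in> set ss)"
  obtain y0 where y0: "y0 \<in> set ss" "\<And>y. y \<in> set ss \<Longrightarrow> rank p q y \<le> rank p q y0"
    using Max_in[of "rank p q ` set ss"] Max_ge[of "rank p q ` set ss"] s0 by fastforce
  have "\<beta> \<in> set ss \<and> (\<forall>y \<in> set ss. rank p q y \<le> rank p q \<beta>)"
    unfolding \<beta>_def by (rule arg_maxI[of "\<lambda>y. y \<in> set ss" y0]) (use y0 in \<open>auto simp: not_less\<close>)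
  then have \<beta>: "\<beta> \<in> set ss" "\<And>y. y \<in> set ss \<Longrightarrow> rank p q y \<le> rank p q \<beta>"
    by auto
  then have "tp \<beta>"
    using low s0 by fastforce
  then have rep\<beta>: "rep \<beta> a"
    using tp \<beta> by blast
  have sub: "fsub p q s \<beta> = (if tp s then fsub p q s \<beta> else Infty True)" if "s \<in> set ss" for s
    using low that \<beta>(1) \<open>tp \<beta>\<close> by auto
  \<comment> \<open>The maximum \<open>\<beta>\<close> may be another float of the same value, so
    the sign of the zero difference is not determined.\<close>
  have zero: "\<exists>b. fsub p q s \<beta> = fzero b" if "s \<in> set ss" "tp s" for s
  proof -
    have "rep s a"
      using tp that by blast
    then obtain b1 e1 s1 where s: "s = Fl b1 e1 s1" "a = (if b1 then - mag p q e1 s1 else mag p q e1 s1)"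
      by (rule repE)
    obtain b2 e2 s2 where b: "\<beta> = Fl b2 e2 s2" "a = (if b2 then - mag p q e2 s2 else mag p q e2 s2)"
      using rep\<beta> by (rule repE)
    have "fval p q b1 e1 s1 = a"
      unfolding s(2) by (simp add: fval_def)
    moreover have "fval p q (\<not> b2) e2 s2 = - a"
      unfolding b(2) by (simp add: fval_def)
    ultimately show ?thesis
      by (intro exI[of _ "b1 \<and> \<not> b2"]) (simp add: fsub_def s(1) b(1) Let_def)
  qed
  define g where "g = (\<lambda>s. if tp s then fone p q else fzero False)"
  have ex: "E p q (fsub p q s \<beta>) = g s" if "s \<in> set ss" for s
    using sub[OF that] zero[OF that] by (auto simp: g_def exp_fzero exp_neg_Infty)
  define den where "den = fsum p q (map g ss)"
  have notall: "\<not> (\<forall>t \<in> set ss. t = Infty True)"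
    using s0 tp by (auto simp: rep_def represents_def)
  have exs: "map (\<lambda>t. E p q (fsub p q t \<beta>)) ss = map g ss"
    using ex by simp
  have weight: "weight ss s = fdiv p q (g s) den" if "s \<in> set ss" for s
    unfolding weight_def \<beta>_def[symmetric] Let_def den_def if_not_P[OF notall] exs ex[OF that] ..
  have g01: "\<forall>x \<in> set (map g ss). x = fone p q \<or> x = fzero False"
    by (auto simp: g_def)
  have "\<exists>c. rep y c \<and> 0 \<le> c \<and> c \<le> 2 ^ L * eta" if "y \<in> set (map g ss)" for y
    using g01 that rep_fone eta_L rep_fzero[of False] by (metis order_refl zero_le_one)
  then obtain D where D: "rep den D" "0 \<le> D" "\<forall>y \<in> set (map g ss). rv y \<le> D" "D \<le> 2 ^ (p + 1 + L) * eta"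
    using fsum_saturated[of L "map g ss"] L_bounds unfolding den_def by auto
  have D1: "1 \<le> D"
    using D(3) s0 rv_rep[OF rep_fone] by (force simp: g_def)
  have D2: "D \<le> 2 ^ (p + 1)"
    using D(4) two_pow_eta'[of "p + 1"] by (simp only: add.commute[of _ L])
  have ne: "fone p q \<noteq> fzero False"
    by (simp add: fone_def fzero_def)
  have cnt: "count (mset (map g ss)) (fone p q) = m"
    unfolding m(1) by (induction ss) (auto simp: g_def ne ne[symmetric])
  have Dge: "real N \<le> D" if "N \<le> m" "N < 2 ^ p" for N
    using fsum_fone_ge[OF g01 that(2)] cnt D(1) that(1) unfolding den_def by simp
  \<comment> \<open>Counting is exact below \<open>2 ^ p\<close>. For larger \<open>m\<close> only
    the lower bounds \<open>Dge\<close> are available, which is the reason for two separate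
    estimates of \<open>W\<close>.\<close>
  have Dm: "D = real m" if "m < 2 ^ p"
  proof -
    have rvg: "rv (g s) = (if tp s then 1 else 0)" for s
      using rv_rep[OF rep_fone] rv_rep[OF rep_fzero[of False]] by (simp add: g_def)
    have sum: "(\<Sum>x \<leftarrow> map g ss. rv x) = real m" "(\<Sum>x \<leftarrow> map g ss. \<bar>rv x\<bar>) = real m"
      unfolding m(1) by (induction ss) (simp_all add: rvg)
    have "rep den (\<Sum>x \<leftarrow> map g ss. rv x)"
      unfolding den_def
    proof (rule rep_fsum[OF unit_1])
      show "\<forall>x \<in> set (map g ss). \<exists>n::int. rep x (of_int n * 1)"
      proof
        fix x
        assume "x \<in> set (map g ss)"
        then show "\<exists>n::int. rep x (of_int n * 1)"
          using g01 rep_fone rep_fzero[of False] by (metis mult_1_right of_int_0 of_int_1)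
      qed
      show "(\<Sum>x \<leftarrow> map g ss. \<bar>rv x\<bar>) \<le> real (2 ^ p - 1) * 1"
      proof -
        have "m \<le> 2 ^ p - 1"
          using that by simp
        then show ?thesis
          unfolding sum by (simp only: mult_1_right of_nat_le_iff)
      qed
    qed
    then show ?thesis
      using D(1) rep_unique sum(1) by metis
  qed
  obtain e' s' where den: "den = Fl False e' s'" "mag p q e' s' = D"
  proof (rule repE[OF D(1)])
    fix b e s
    assume *: "den = Fl b e s" "D = (if b then - mag p q e s else mag p q e s)"
    have "\<not> b"
      using *(2) D1 mag_nonneg[of e s] by auto
    then show thesis
      using * that by simp
  qed
  have s': "s' \<noteq> 0"
    using den(2) D1 mag_zero_iff[of e' s'] by auto
  have m1: "mag p q (2 ^ (q - 1) - 1) (2 ^ (p - 1)) = 1"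
    using rep_fone by (simp add: fone_def rep_Fl)
  have w1: "fdiv p q (fone p q) den = fround p q False (1 / D)"
    using s' m1 den(2) by (simp add: fone_def den(1))
  have w0: "rep (fdiv p q (fzero False) den) 0"
    using s' rep_fround[of 0 False] mag_zero_iff[of 0 0] by (simp add: fzero_def den(1))
  have inv: "0 \<le> 1 / D" "1 / D \<le> 1" "1 / 2 ^ (p + 1) \<le> 1 / D"
    using D1 D2 by (auto simp: field_simps)
  then have "1 / D < overflow_bound p q"
    using one_less_overflow by linarith
  then obtain W where W: "rep (fdiv p q (fone p q) den) W" "0 \<le> W"
    "\<And>t. representable t \<Longrightarrow> 0 \<le> t \<Longrightarrow> \<bar>W - 1 / D\<bar> \<le> \<bar>t - 1 / D\<bar>"
    "\<And>t. representable t \<Longrightarrow> 0 \<le> t \<Longrightarrow> t \<le> 1 / D \<Longrightarrow> t \<le> W"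
    "\<And>t. representable t \<Longrightarrow> 1 / D \<le> t \<Longrightarrow> W \<le> t"
    using rep_fround_approx[OF inv(1), of False] unfolding w1 by (metis (full_types))
  have near: "\<bar>W - 1 / D\<bar> \<le> 1 / 2 ^ p"
  proof -
    \<comment> \<open>Rounding \<open>1 / D\<close> down to \<open>p\<close> binary places gives a
      float that competes with \<open>W\<close>.\<close>
    define n where "n = nat \<lfloor>2 ^ p / D\<rfloor>"
    have n: "real n \<le> 2 ^ p / D" "2 ^ p / D < real n + 1"
      unfolding n_def using D1 by (simp_all add: of_nat_nat)
    have "2 ^ p / D \<le> 2 ^ p"
      using D1 by (simp add: field_simps)
    then have "real n \<le> real (2 ^ p)"
      using n(1) unfolding of_nat_power of_nat_numeral by linarith
    then have "n \<le> 2 ^ p"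
      by (rule iffD1[OF of_nat_le_iff])
    then have "representable (real n / 2 ^ p)"
      using representable_frac[of n p] L_bounds representable_1 by (cases "n = 2 ^ p") auto
    moreover have "\<bar>real n / 2 ^ p - 1 / D\<bar> \<le> 1 / 2 ^ p"
    proof -
      have "real n / 2 ^ p \<le> 1 / D" "1 / D \<le> (real n + 1) / 2 ^ p"
        using n D1 by (simp_all add: field_simps)
      then show ?thesis
        by (simp add: add_divide_distrib)
    qed
    ultimately show ?thesis
      using W(3)[of "real n / 2 ^ p"] by simp
  qed
  show thesis
  proof (rule that[of W])
    show "rep (weight ss s) (if tp s then W else 0)" if "s \<in> set ss" for s
      using weight[OF that] W(1) w0 by (simp add: g_def)
    show "1 / 2 ^ (p + 1) \<le> W"
      using W(4)[of "1 / 2 ^ (p + 1)"] representable_frac[of 1 "p + 1"] L_bounds inv(3) p_pos one_less_power[of "2::nat" p]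
      by simp
    show "W \<le> 1"
      using W(5)[of 1] representable_1 inv by simp
    show "W = 1" if "m = 1"
      using Dm W(3)[of 1] representable_1 that p_pos one_less_power[of "2::nat" p] by simp
    show "\<bar>W - 1 / real m\<bar> \<le> 1 / 2 ^ p" if "m < 2 ^ p"
      using near Dm[OF that] by simp
    show "W \<le> 1 / real N + 1 / 2 ^ p" if "1 \<le> N" "N \<le> m" "N < 2 ^ p" for N
    proof -
      have "1 / D \<le> 1 / real N"
        using Dge[OF that(2,3)] that(1) by (simp add: frac_le)
      then show ?thesis
        using near by linarith
    qed
  qed
qed

end

text \<open>\<open>n\<close> is \<open>W * x\<close> rounded to an integer, with \<open>W\<close>
  close to \<open>1 / m\<close>. If \<open>m < k\<close> then \<open>x / m\<close> exceeds 1/2 by at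
  least \<open>1 / (2 * m)\<close>, so \<open>n\<close> is positive. If
  \<open>m \<ge> 2 * x + 2\<close> then it is below 1/2 by a margin, so \<open>n = 0\<close>.
  Between \<open>k\<close> and \<open>2 * x + 1\<close> the value of \<open>n\<close> is left open,
  and only the size of \<open>m * n\<close> is bounded.\<close>

lemma threshold_arith:
  fixes W \<delta> :: real and n m k x \<kappa> P :: nat
  assumes x: "x = (k + 1) div 2" and k: "1 \<le> k" "k \<le> \<kappa>" and m: "1 \<le> m"
    and P: "64 * (\<kappa> + 2) ^ 2 \<le> P" and \<delta>: "\<delta> = 1 / real P"
    and n: "\<bar>real n - W * real x\<bar> \<le> 1 / 2"
    and W: "m < P \<Longrightarrow> \<bar>W - 1 / real m\<bar> \<le> \<delta>"
    and WN: "\<And>N. 1 \<le> N \<Longrightarrow> N \<le> m \<Longrightarrow> N < P \<Longrightarrow> W \<le> 1 / real N + \<delta>"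
  shows "m < k \<Longrightarrow> 1 \<le> n \<and> m * n < k" and "2 * x + 2 \<le> m \<Longrightarrow> n = 0" and "m \<le> 2 * x + 1 \<Longrightarrow> m * n \<le> \<kappa> + 2"
proof -
  have x2: "k \<le> 2 * x" "2 * x \<le> k + 1" "1 \<le> x"
    using k by (auto simp: x)
  have sq: "(\<kappa> + 2) * (\<kappa> + 2) * 64 \<le> P"
    using P by (simp add: power2_eq_square mult.commute)
  have P2: "64 * \<kappa> + 128 \<le> P"
  proof -
    have "(\<kappa> + 2) * 64 \<le> (\<kappa> + 2) * (\<kappa> + 2) * 64"
      by (intro mult_le_mono1) simp
    then show ?thesis
      using sq by simp
  qed
  \<comment> \<open>Here the factor \<open>64 * (\<kappa> + 2) ^ 2\<close> is used: both
    \<open>a\<close> and \<open>x\<close> are at most \<open>\<kappa> + 2\<close>.\<close>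
  have small: "real a * (\<delta> * real x) \<le> 1 / 64" if "a \<le> \<kappa> + 2" for a
  proof -
    have "real (a * x * 64) \<le> real P"
      using sq that x2 k by (intro of_nat_mono le_trans[OF _ sq] mult_le_mono) auto
    then show ?thesis
      using P2 by (simp add: \<delta> field_simps)
  qed
  have close: "\<bar>real m * (W * real x) - real x\<bar> \<le> 1 / 64" if "m \<le> \<kappa> + 2"
  proof -
    have "m < P"
      using that P2 by linarith
    then have "\<bar>W - 1 / real m\<bar> \<le> \<delta>"
      by (rule W)
    then have "real m * real x * \<bar>W - 1 / real m\<bar> \<le> real m * real x * \<delta>"
      by (intro mult_left_mono) auto
    moreover have "real m * real x * \<bar>W - 1 / real m\<bar> = \<bar>real m * (W * real x) - real x\<bar>"
    proof -
      have "real m * (W * real x) - real x = real m * real x * (W - 1 / real m)"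
        using m by (simp add: field_simps)
      then show ?thesis
        by (simp add: abs_mult)
    qed
    ultimately show ?thesis
      using small[OF that] by (simp add: mult.commute mult.left_commute)
  qed
  have prod: "\<bar>real (m * n) - real m * (W * real x)\<bar> \<le> real m / 2"
  proof -
    have "real m * \<bar>real n - W * real x\<bar> \<le> real m * (1 / 2)"
      using n by (intro mult_left_mono) auto
    moreover have "real m * \<bar>real n - W * real x\<bar> = \<bar>real (m * n) - real m * (W * real x)\<bar>"
    proof -
      have "real (m * n) - real m * (W * real x) = real m * (real n - W * real x)"
        by (simp add: right_diff_distrib)
      then show ?thesis
        by (simp add: abs_mult)
    qed
    ultimately show ?thesis
      by simp
  qed
  show "1 \<le> n \<and> m * n < k" if mk: "m < k"
  proof -
    have c: "\<bar>real m * (W * real x) - real x\<bar> \<le> 1 / 64"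
      using mk k by (intro close) auto
    have "n \<noteq> 0"
    proof
      assume "n = 0"
      then have "real (m * n) = 0"
        by simp
      then have "real x - 1 / 64 \<le> real m / 2"
        using c prod by linarith
      moreover have "real m + 1 \<le> 2 * real x"
        using mk x2 by linarith
      ultimately show False
        by linarith
    qed
    moreover have "m * n < k"
    proof (rule ccontr)
      assume "\<not> m * n < k"
      then have ge: "real k \<le> real (m * n)"
        by (intro of_nat_mono) simp
      \<comment> \<open>For \<open>n = 1\<close> the product would be \<open>m\<close>, which is
        below \<open>k\<close>.\<close>
      have "n \<noteq> 1"
        using \<open>\<not> m * n < k\<close> mk by auto
      then have "m * 2 \<le> m * n"
        using \<open>n \<noteq> 0\<close> by (intro mult_le_mono2) auto
      then have ge2: "real m * 2 \<le> real (m * n)"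
        by (metis of_nat_mono of_nat_mult of_nat_numeral)
      have up: "real (m * n) \<le> real x + 1 / 64 + real m / 2"
        using c prod by linarith
      \<comment> \<open>With \<open>n \<ge> 2\<close> the estimate
        \<open>m * n \<le> x + m / 2 + 1 / 64\<close> leaves only \<open>3 * m \<le> 2 * x\<close>.
        Then \<open>m * n\<close> is at most \<open>4 * x / 3 + 1 / 64\<close>, which is below
        \<open>k\<close> once \<open>k \<ge> 3\<close>.\<close>
      show False
      proof (cases "2 * x + 1 \<le> 3 * m")
        case True
        then have "2 * real x + 1 \<le> 3 * real m"
          by linarith
        then show False
          using up ge2 by linarith
      next
        case False
        then have "3 * m \<le> 2 * x"
          by simp
        then have *: "3 * real m \<le> 2 * real x" "2 * real x \<le> real k + 1"
          using x2 by linarith+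
        \<comment> \<open>For \<open>k = 2\<close> one has \<open>x = 1\<close> and
          \<open>m = 1\<close>, contradicting \<open>3 * m \<le> 2 * x\<close>.\<close>
        have "3 \<le> k"
          using \<open>3 * m \<le> 2 * x\<close> m mk x2(1,2) by presburger
        then have "3 \<le> real k"
          by simp
        then show False
          using * up ge by linarith
      qed
    qed
    ultimately show ?thesis
      by simp
  qed
  \<comment> \<open>\<open>WN\<close> is taken at \<open>2 * x + 2\<close> instead of
    \<open>m\<close>: for very large \<open>m\<close> the denominator is not exact.\<close>
  show "n = 0" if mx: "2 * x + 2 \<le> m"
  proof -
    have N: "2 * x + 2 \<le> \<kappa> + 3" "2 * x + 2 < P"
      using x2 k P2 by linarith+
    then have "W \<le> 1 / real (2 * x + 2) + \<delta>"
      using WN[of "2 * x + 2"] mx by simp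
    then have "real (2 * x + 2) * real x * W \<le> real (2 * x + 2) * real x * (1 / real (2 * x + 2) + \<delta>)"
      by (intro mult_left_mono) auto
    also have "\<dots> = real x + real (2 * x + 2) * (\<delta> * real x)"
      by (simp add: field_simps)
    also have "real (2 * x + 2) * (\<delta> * real x) \<le> 1 / 32"
      using small[of "x + 1"] x2 k by (simp add: algebra_simps)
    finally have *: "real (2 * x + 2) * (W * real x) \<le> real x + 1 / 32"
      by (simp add: algebra_simps)
    have "real n \<le> W * real x + 1 / 2"
      using n by linarith
    then have "real (2 * x + 2) * real n \<le> real (2 * x + 2) * (W * real x + 1 / 2)"
      by (intro mult_left_mono) auto
    also have "\<dots> \<le> real x + 1 / 32 + (real x + 1)"
      using * by (simp add: algebra_simps)
    also have "\<dots> < real (2 * x + 2) * 1"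
      by simp
    finally have "real n < 1"
      by (rule mult_left_less_imp_less) simp
    then show ?thesis
      by simp
  qed
  show "m * n \<le> \<kappa> + 2" if "m \<le> 2 * x + 1"
  proof -
    have "m \<le> \<kappa> + 2"
      using that x2 k by linarith
    then have "real (m * n) \<le> real x + 1 / 64 + real m / 2"
      using close prod by linarith
    moreover have "2 * real x \<le> real \<kappa> + 1" "real m \<le> 2 * real x + 1"
      using that x2 k by linarith+
    ultimately have "real (m * n) \<le> real (\<kappa> + 2)"
      by simp
    then show ?thesis
      by (rule iffD1[OF of_nat_le_iff])
  qed
qed

lemma sum_list_indicator:
  fixes c :: real
  assumes "\<forall>x \<in> set xs. g x = (if Q x then c else 0)"
  shows "sum_list (map g xs) = real (length (filter Q xs)) * c"
  using assms by (induction xs) (auto simp: algebra_simps)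

section \<open>Sparse weight matrices and constant queries\<close>

context large_format
begin

definition flo :: "real \<Rightarrow> flt" where
  "flo r = fround p q (r < 0) \<bar>r\<bar>"

lemma rep_flo: "representable r \<Longrightarrow> rep (flo r) r"
  using rep_fround[of "\<bar>r\<bar>" "r < 0"] by (cases "r < 0") (simp_all add: flo_def)

definition smat :: "nat \<Rightarrow> nat \<Rightarrow> (nat \<Rightarrow> (nat \<times> real) list) \<Rightarrow> flt mat" where
  "smat m n ps = mat m n (\<lambda>(k, j). flo (coef (ps j) k))"

lemma smat_fmats [simp]: "smat m n ps \<in> fmats p q m n"
  by (auto simp: smat_def fmats_def flo_def)

lemma dim_smat [simp]: "dim_row (smat m n ps) = m" "dim_col (smat m n ps) = n"
  by (simp_all add: smat_def)

definition finv :: "nat \<Rightarrow> flt vec \<Rightarrow> bool" where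
  "finv d x \<longleftrightarrow> dim_vec x = d \<and> (\<forall>k < d. rep (x $ k) (rv (x $ k)))"

lemma dim_rmul_smat [simp]: "dim_vec (rmul x (smat m n ps)) = n"
  by (simp add: rmul_def)

lemma rep_rmul:
  assumes "finv d x" "i < n" "unit M u" "\<And>k. representable (coef (ps i) k)"
    and "\<forall>(j, c) \<in> set (ps i). j < d" "\<forall>(j, c) \<in> set (ps i). \<exists>n::int. c * rv (x $ j) = of_int n * u"
    and "(\<Sum>(j, c) \<leftarrow> ps i. \<bar>c * rv (x $ j)\<bar>) \<le> real M * u"
  shows "rep (rmul x (smat d n ps) $ i) (\<Sum>(j, c) \<leftarrow> ps i. c * rv (x $ j))"
proof -
  have d: "dim_vec x = d"
    using assms(1) by (simp add: finv_def)
  have "rmul x (smat d n ps) $ i = fsum p q (map (\<lambda>k. fmul p q (x $ k) (smat d n ps $$ (k, i))) [0..<d])"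
    using assms(2) by (simp add: rmul_def d)
  moreover have "rep (fsum p q (map (\<lambda>k. fmul p q (x $ k) (smat d n ps $$ (k, i))) [0..<d]))
      (\<Sum>(j, c) \<leftarrow> ps i. c * rv (x $ j))"
    using assms by (intro rep_dot[where a = "\<lambda>k. rv (x $ k)"]) (auto simp: finv_def smat_def intro: rep_flo)
  ultimately show ?thesis
    by simp
qed

text \<open>With a single coefficient the product itself supplies the grid, so it suffices that the
  product is representable. This allows values of any size, such as multiples of \<open>eta\<close>
  or large sums.\<close>

lemma rep_rmul_single:
  assumes "finv d x" "i < n" "ps i = [(j, c)]" "j < d" "representable c" "representable (c * rv (x $ j))"
  shows "rep (rmul x (smat d n ps) $ i) (c * rv (x $ j))"
proof -
  obtain M u and z :: int where u: "unit M u" "c * rv (x $ j) = of_int z * u" "\<bar>c * rv (x $ j)\<bar> \<le> real M * u"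
    using unit_of_representable[OF assms(6)] .
  show ?thesis
    using rep_rmul[OF assms(1,2) u(1), of ps] assms(3-5) u(2,3) by auto
qed

lemma rep_rmul_Nil:
  assumes "finv d x" "i < n" "ps i = []"
  shows "rep (rmul x (smat d n ps) $ i) 0"
  using rep_rmul[OF assms(1,2) unit_1, of ps] assms(3) by simp

text \<open>The query reads the constant coordinate and is 4 at every vertex. The factor 4 splits
  the overflow into two steps: a key of \<open>-2 * B\<close> is still a float, while the score
  \<open>-8 * B\<close> is rounded to negative infinity.\<close>

definition score_query :: "nat \<Rightarrow> flt mat" where
  "score_query d = smat d 1 (\<lambda>_. [(0, 4)])"

lemma rank_neg_Infty_less: "rep t r \<Longrightarrow> rank p q (Infty True) < rank p q t"
proof (erule repE)
  fix b e s
  assume *: "t = Fl b e s" "fl_ok p q e s"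
  have "(0::int) < 2 ^ (p + q)"
    by simp
  then show ?thesis
    using code_less[OF *(2)] code_nonneg[of e s] unfolding *(1) rank_simps by (cases b; simp)
qed

lemma fsub_neg_Infty: "rep t r \<Longrightarrow> fsub p q (Infty True) t = Infty True"
  by (erule repE) (simp add: fsub_def)

lemma rep_imp_ne_Infty: "rep s r \<Longrightarrow> s \<noteq> Infty b"
  by (auto elim: repE)

lemma fsum_single: "fsum p q [x] = x"
  by (simp add: fsum_def)

lemma rep_query:
  assumes "finv d y" "rv (y $ 0) = 1" "0 < d"
  shows "rep (rmul y (score_query d) $ 0) 4"
  using rep_rmul_single[OF assms(1), of 0 1 "\<lambda>_. [(0, 4)]" 0 4] assms representable_real[of 4] p_ge
    power_increasing[of 8 p "2::nat"] by (simp add: score_query_def)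

lemma score_eq:
  assumes "dkey D = 1" "WQ H = score_query d" "WK H = smat d 1 ks"
  shows "score D H y x = fdiv p q (fmul p q (rmul y (WQ H) $ 0) (rmul x (WK H) $ 0)) (fround p q False 1)"
  unfolding score_def using assms by (simp add: score_query_def fsum_single)

lemma rep_score:
  assumes "dkey D = 1" "WQ H = score_query d" "WK H = smat d 1 ks"
    and "finv d y" "rv (y $ 0) = 1" "0 < d" "rep (rmul x (WK H) $ 0) r" "representable (4 * r)"
  shows "rep (score D H y x) (4 * r)"
  unfolding score_eq[OF assms(1-3)]
  using rep_fmul[OF rep_query[OF assms(4-6)] assms(7,8)] rep_fround[OF representable_1, of False]
  by (intro rep_fdiv_1) (simp_all add: assms(2))

lemma score_neg_Infty:
  assumes "dkey D = 1" "WQ H = score_query d" "WK H = smat d 1 ks"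
    and "finv d y" "rv (y $ 0) = 1" "0 < d" "rep (rmul x (WK H) $ 0) (- 2 * B)"
  shows "score D H y x = Infty True"
proof -
  obtain c where c: "fmul p q (rmul y (WQ H) $ 0) (rmul x (WK H) $ 0) = fround p q c \<bar>4 * (- 2 * B)\<bar>"
    "4 * (- 2 * B) = (if c then - \<bar>4 * (- 2 * B)\<bar> else \<bar>4 * (- 2 * B)\<bar>)"
    using fmul_eq_fround[OF rep_query[OF assms(4-6)] assms(7)] unfolding assms(2) .
  have abs: "\<bar>4 * (- 2 * B)\<bar> = 8 * B"
    using B_pos by simp
  have "c"
    using c(2) B_pos unfolding abs by (cases c) auto
  then have "fmul p q (rmul y (WQ H) $ 0) (rmul x (WK H) $ 0) = Infty True"
    using c(1) B_overflow unfolding abs by (simp add: fround_def)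
  moreover obtain e s where "fround p q False 1 = Fl False e s"
    using fround_nearest[OF one_less_overflow] by blast
  ultimately show ?thesis
    unfolding score_eq[OF assms(1-3)] by simp
qed

lemma coef_representable:
  assumes "unit M u" "\<forall>(j, c) \<in> set ps. \<exists>n::int. c = of_int n * u" "(\<Sum>(j, c) \<leftarrow> ps. \<bar>c\<bar>) \<le> real M * u"
  shows "representable (coef ps k)"
proof -
  have "\<exists>n::int. 1 * coef ps k = of_int n * u"
    using assms(2) by (intro mult_coef_int[where a = "\<lambda>_. 1"]) auto
  then obtain n :: int where n: "coef ps k = of_int n * u"
    by auto
  have "\<bar>coef ps k\<bar> \<le> (\<Sum>(j, c) \<leftarrow> ps. \<bar>c\<bar>)"
    by (induction ps) (auto simp: coef_def)
  then show ?thesis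
    using assms(3) by (intro unit_representable[OF assms(1) n]) simp
qed

end

section \<open>Attention heads that count\<close>

context large_format
begin

text \<open>The key is 0 where coordinate \<open>j\<close> is 1 and \<open>-2 * B\<close> where it
  is 0, so exactly the former vertices get a finite score. The value \<open>2 ^ (p + 1)\<close>
  compensates the least possible weight \<open>1 / 2 ^ (p + 1)\<close>: each marked vertex
  contributes at least 1.\<close>

definition count_head :: "nat \<Rightarrow> nat \<Rightarrow> nat \<Rightarrow> head" where
  "count_head d j x = \<lparr>WQ = score_query d, WK = smat d 1 (\<lambda>_. [(0, - 2 * B), (j, 2 * B)]),
     WV = smat d 2 (\<lambda>i. if i = 0 then [(j, real x * eta)] else [(j, 2 ^ (p + 1))])\<rparr>"

text \<open>Scores in three tiers: \<open>4 * B\<close> where \<open>j\<close> holds,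
  \<open>-4 * B\<close> where \<open>j'\<close> holds, and negative infinity elsewhere. The upper
  two tiers differ by \<open>8 * B\<close>, which overflows, so one vertex with \<open>j\<close>
  removes all weight from those with \<open>j'\<close>. Only \<open>j'\<close> is read as
  value.\<close>

definition past_head :: "nat \<Rightarrow> nat \<Rightarrow> nat \<Rightarrow> head" where
  "past_head d j j' = \<lparr>WQ = score_query d, WK = smat d 1 (\<lambda>_. [(0, - 2 * B), (j, 3 * B), (j', B)]),
     WV = smat d 2 (\<lambda>i. if i = 0 then [(j', 1)] else [])\<rparr>"

lemma weight_all_neg_Infty: "\<forall>t \<in> set ss. t = Infty True \<Longrightarrow> weight ss s = fzero False"
  by (simp add: weight_def)

lemma head_row_entry:
  "i < dim_col (WV H) \<Longrightarrow> head_row D H xs c y $ i = fsum p q (map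
     (\<lambda>x. fmul p q (weight (map (score D H y) xs @ replicate c (Infty True)) (score D H y x))
       (rmul x (WV H) $ i)) xs)"
  by (simp add: head_row_def)

lemma rep_fmul_zero_left: "rep x 0 \<Longrightarrow> rep y b \<Longrightarrow> rep (fmul p q x y) 0"
  using rep_fmul[of x 0 y b] by simp

lemma rep_fmul_zero_right: "rep x a \<Longrightarrow> rep y 0 \<Longrightarrow> rep (fmul p q x y) 0"
  using rep_fmul[of x a y 0] by simp

lemma fmul_eq_fround_pos:
  assumes "rep x a" "rep y b" "0 < a * b"
  shows "fmul p q x y = fround p q False (a * b)"
proof -
  obtain c where "fmul p q x y = fround p q c \<bar>a * b\<bar>" "a * b = (if c then - \<bar>a * b\<bar> else \<bar>a * b\<bar>)"
    using fmul_eq_fround[OF assms(1,2)] .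
  then show ?thesis
    using assms(3) by (cases c) auto
qed

text \<open>At the bottom of the format every multiple of \<open>eta\<close> below
  \<open>2 ^ p\<close> units is a float, so the rounding error is absolute. Nothing is claimed about
  ties.\<close>

lemma rep_fround_eta:
  assumes "0 \<le> r" "r < 2 ^ p - 1"
  obtains n where "rep (fround p q False (r * eta)) (real n * eta)" "\<bar>real n - r\<bar> \<le> 1 / 2"
proof -
  \<comment> \<open>The nearest integer, as a competitor of the rounded value.\<close>
  define k where "k = nat \<lfloor>r + 1 / 2\<rfloor>"
  have k: "real k \<le> r + 1 / 2" "r < real k + 1 / 2"
    unfolding k_def using assms by (simp_all add: of_nat_nat) linarith+
  have "real k < real (2 ^ p)"
    using k(1) assms(2) unfolding of_nat_power of_nat_numeral by linarith
  then have "k < 2 ^ p"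
    by (rule iffD1[OF of_nat_less_iff])
  then have rk: "representable (real k * eta)"
    using representable_nat[of 0 k] by simp
  have "representable (real (2 ^ p - 1) * eta)"
    using representable_nat[of 0 "2 ^ p - 1"] by simp
  then obtain e s where "fl_ok p q e s" "\<bar>real (2 ^ p - 1) * eta\<bar> = mag p q e s"
    unfolding representable_def by blast
  then have "real (2 ^ p - 1) * eta < overflow_bound p q"
    using mag_less_overflow abs_ge_self[of "real (2 ^ p - 1) * eta"] by fastforce
  moreover have "r * eta \<le> real (2 ^ p - 1) * eta"
    using assms eta_pos by (intro mult_right_mono) (simp_all add: of_nat_diff)
  ultimately have "r * eta < overflow_bound p q"
    by linarith
  moreover have "0 \<le> r * eta"
    using assms eta_pos by simp
  ultimately obtain r' where r': "rep (fround p q False (r * eta)) r'"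
    "\<And>t. representable t \<Longrightarrow> 0 \<le> t \<Longrightarrow> \<bar>r' - r * eta\<bar> \<le> \<bar>t - r * eta\<bar>"
    "\<exists>e s. fl_ok p q e s \<and> r' = mag p q e s"
    using rep_fround_approx[of "r * eta" False] by (metis (full_types))
  then obtain e s where es: "r' = mag p q e s"
    by blast
  show thesis
  proof (rule that[of "s * 2 ^ e"])
    show "rep (fround p q False (r * eta)) (real (s * 2 ^ e) * eta)"
      using r'(1) by (simp add: es mag_eq)
    have "\<bar>real (s * 2 ^ e) * eta - r * eta\<bar> \<le> \<bar>real k * eta - r * eta\<bar>"
      using r'(2)[OF rk] eta_pos by (simp add: es mag_eq)
    then have "\<bar>real (s * 2 ^ e) - r\<bar> * eta \<le> \<bar>real k - r\<bar> * eta"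
      using eta_pos by (simp add: abs_mult flip: left_diff_distrib)
    then have "\<bar>real (s * 2 ^ e) - r\<bar> \<le> \<bar>real k - r\<bar>"
      using eta_pos by simp
    then show "\<bar>real (s * 2 ^ e) - r\<bar> \<le> 1 / 2"
      using k by linarith
  qed
qed

lemma rep_rmul_bool:
  assumes "finv d x" "i < n" "unit M u"
    and ps: "\<forall>(j, c) \<in> set (ps i). j < d \<and> (rv (x $ j) = 0 \<or> rv (x $ j) = 1) \<and> (\<exists>n::int. c = of_int n * u)"
    and bound: "(\<Sum>(j, c) \<leftarrow> ps i. \<bar>c\<bar>) \<le> real M * u"
  shows "rep (rmul x (smat d n ps) $ i) (\<Sum>(j, c) \<leftarrow> ps i. c * rv (x $ j))"
proof (rule rep_rmul[OF assms(1-3)])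
  show "representable (coef (ps i) k)" for k
    using ps bound by (intro coef_representable[OF assms(3)]) auto
  show "\<forall>(j, c) \<in> set (ps i). \<exists>n::int. c * rv (x $ j) = of_int n * u"
  proof safe
    fix j c
    assume "(j, c) \<in> set (ps i)"
    then obtain n :: int where "c = of_int n * u" "rv (x $ j) = 0 \<or> rv (x $ j) = 1"
      using ps by blast
    then show "\<exists>n::int. c * rv (x $ j) = of_int n * u"
      by (cases "rv (x $ j) = 0") (auto intro: exI[of _ 0] exI[of _ n])
  qed
  have "(\<Sum>(j, c) \<leftarrow> ps i. \<bar>c * rv (x $ j)\<bar>) \<le> (\<Sum>(j, c) \<leftarrow> ps i. \<bar>c\<bar>)"
    using ps by (intro sum_list_mono) (auto simp: abs_mult)
  then show "(\<Sum>(j, c) \<leftarrow> ps i. \<bar>c * rv (x $ j)\<bar>) \<le> real M * u"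
    using bound by simp
qed (use ps in auto)

lemma \<kappa>_less: "64 * \<kappa> + 128 \<le> 2 ^ p"
proof -
  have "64 * (\<kappa> + 2) * 1 \<le> 64 * (\<kappa> + 2) * (\<kappa> + 2)"
    by (intro mult_le_mono2) simp
  also have "\<dots> \<le> 2 ^ p"
    using \<kappa>_bound unfolding power2_eq_square by (simp only: mult.assoc)
  finally show ?thesis
    by simp
qed

text \<open>Each of the \<open>m\<close> marked vertices contributes the same \<open>n\<close>
  units, so the first output is \<open>m * n\<close> units without further rounding. The second
  output is inexact and may saturate; only its being at least 1 is used to detect
  \<open>m > 0\<close>. For \<open>m = 0\<close> all scores are negative infinity and softmax
  returns zeros by convention.\<close>

lemma count_head_row:
  assumes D: "dkey D = 1" and y: "finv d y" "rv (y $ 0) = 1" and j: "0 < j" "j < d"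
    and xs: "\<forall>x \<in> set xs. finv d x \<and> rv (x $ 0) = 1 \<and> (rv (x $ j) = 0 \<or> rv (x $ j) = 1)"
    and m: "m = length (filter (\<lambda>x. rv (x $ j) = 1) xs)"
    and k: "1 \<le> k" "k \<le> \<kappa>"
  obtains z S where "rep (head_row D (count_head d j ((k + 1) div 2)) xs c y $ 0) (real z * eta)"
    "rep (head_row D (count_head d j ((k + 1) div 2)) xs c y $ 1) S" "z \<le> \<kappa> + 2"
    "m = 0 \<Longrightarrow> z = 0 \<and> S = 0" "1 \<le> m \<Longrightarrow> 1 \<le> S"
    "1 \<le> m \<Longrightarrow> m < k \<Longrightarrow> 1 \<le> z \<and> z < k" "k \<le> m \<Longrightarrow> z = 0 \<or> k \<le> z"
proof -
  define x0 where "x0 = (k + 1) div 2"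
  define H where "H = count_head d j x0"
  define ss where "ss = map (score D H y) xs @ replicate c (Infty True)"
  let ?\<phi> = "\<lambda>x. rv (x $ j) = 1"
  have d: "0 < d"
    using j by simp
  have HQ: "WQ H = score_query d" and HK: "WK H = smat d 1 (\<lambda>_. [(0, - 2 * B), (j, 2 * B)])"
    and HV: "WV H = smat d 2 (\<lambda>i. if i = 0 then [(j, real x0 * eta)] else [(j, 2 ^ (p + 1))])"
    by (simp_all add: H_def count_head_def)
  have \<kappa>p: "\<kappa> + 2 < 2 ^ p"
    using \<kappa>_less by simp
  then have x0: "x0 < 2 ^ p - 1" "1 \<le> x0"
    using k unfolding x0_def by auto
  have key: "rep (rmul x (WK H) $ 0) (- 2 * B + 2 * B * rv (x $ j))" if "x \<in> set xs" for x
  proof -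
    have n: "\<exists>n::int. - 2 * B = of_int n * B" "\<exists>n::int. 2 * B = of_int n * B"
      by (intro exI[of _ "- 2"], simp) (intro exI[of _ 2], simp)
    have "rep (rmul x (smat d 1 (\<lambda>_. [(0, - 2 * B), (j, 2 * B)])) $ 0)
        (\<Sum>(j, c) \<leftarrow> [(0, - 2 * B), (j, 2 * B)]. c * rv (x $ j))"
      using xs that d j n B_pos by (intro rep_rmul_bool[OF _ _ unit_B]) auto
    then show ?thesis
      using xs that unfolding HK by simp
  qed
  have sc1: "rep (score D H y x) 0" if "x \<in> set xs" "?\<phi> x" for x
    using rep_score[OF D HQ HK y d key[OF that(1)]] that(2) by simp
  have sc0: "score D H y x = Infty True" if "x \<in> set xs" "\<not> ?\<phi> x" for x
    using score_neg_Infty[OF D HQ HK y d] key[OF that(1)] xs that by fastforce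
  have val0: "rep (rmul x (WV H) $ 0) (real x0 * eta * rv (x $ j))" if "x \<in> set xs" for x
  proof -
    have "representable (real x0 * eta)"
      using representable_nat[of 0 x0] x0 by simp
    then show ?thesis
      unfolding HV using xs that j by (intro rep_rmul_single) auto
  qed
  have val1: "rep (rmul x (WV H) $ 1) (2 ^ (p + 1) * rv (x $ j))" if "x \<in> set xs" for x
    unfolding HV using xs that j representable_two_pow[of "p + 1"] by (intro rep_rmul_single) auto
  have row: "head_row D H xs c y $ i = fsum p q (map (\<lambda>x. fmul p q (weight ss (score D H y x)) (rmul x (WV H) $ i)) xs)"
    if "i < 2" for i
    using head_row_entry[of i H D xs c y] that by (simp add: HV ss_def)
  show thesis
  proof (cases "m = 0")
    case True
    then have "\<not> ?\<phi> x" if "x \<in> set xs" for x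
      using that unfolding m by (auto simp: filter_empty_conv)
    then have "\<forall>t \<in> set ss. t = Infty True"
      using sc0 by (auto simp: ss_def)
    then have w: "weight ss s = fzero False" for s
      by (rule weight_all_neg_Infty)
    have "rep (head_row D H xs c y $ i) 0" if "i < 2" for i
    proof -
      have "\<forall>v \<in> set (map (\<lambda>x. fmul p q (weight ss (score D H y x)) (rmul x (WV H) $ i)) xs). rep v 0"
      proof
        fix v
        assume "v \<in> set (map (\<lambda>x. fmul p q (weight ss (score D H y x)) (rmul x (WV H) $ i)) xs)"
        then obtain x where x: "x \<in> set xs" "v = fmul p q (weight ss (score D H y x)) (rmul x (WV H) $ i)"
          by auto
        have "\<exists>r. rep (rmul x (WV H) $ i) r"
          using that val0[OF x(1)] val1[OF x(1)] by (cases "i = 0") (auto simp: less_2_cases_iff)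
        then show "rep v 0"
          unfolding x(2) w using rep_fmul_zero_left[OF rep_fzero] by blast
      qed
      then show ?thesis
        unfolding row[OF that] by (rule rep_fsum_zero)
    qed
    from this[of 0] this[of 1] show thesis
      using True k by (intro that[of 0 0]) (simp_all add: H_def x0_def)
  next
    case False
    then have m1: "1 \<le> m"
      by simp
    let ?tp = "\<lambda>s. s \<noteq> Infty True"
    have tp: "?tp (score D H y x) \<longleftrightarrow> ?\<phi> x" if "x \<in> set xs" for x
      using sc0[OF that] sc1[OF that] rep_imp_ne_Infty by blast
    have top_rep: "\<forall>s \<in> set ss. ?tp s \<longrightarrow> rep s 0"
      using tp sc1 by (auto simp: ss_def)
    have "length (filter ?tp (map (score D H y) xs)) = m"
      unfolding m filter_map length_map comp_def using tp by (intro arg_cong[of _ _ length] filter_cong) auto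
    then have len: "m = length (filter ?tp ss)"
      by (simp add: ss_def)
    obtain W where W: "\<And>s. s \<in> set ss \<Longrightarrow> rep (weight ss s) (if ?tp s then W else 0)"
      "1 / 2 ^ (p + 1) \<le> W" "W \<le> 1"
      "m < 2 ^ p \<Longrightarrow> \<bar>W - 1 / real m\<bar> \<le> 1 / 2 ^ p"
      "\<And>N. 1 \<le> N \<Longrightarrow> N \<le> m \<Longrightarrow> N < 2 ^ p \<Longrightarrow> W \<le> 1 / real N + 1 / 2 ^ p"
    proof (rule weight_tops[OF top_rep _ len m1])
      show "\<forall>s \<in> set ss. \<forall>t \<in> set ss. \<not> ?tp s \<longrightarrow> ?tp t \<longrightarrow> rank p q s < rank p q t \<and> fsub p q s t = Infty True"
        using top_rep rank_neg_Infty_less fsub_neg_Infty by blast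
    qed blast
    have W0: "0 < W"
      using W(2) by (smt (verit) divide_pos_pos zero_less_power)
    have w: "rep (weight ss (score D H y x)) (if ?\<phi> x then W else 0)" if "x \<in> set xs" for x
      using W(1)[of "score D H y x"] tp[OF that] that by (simp add: ss_def)
    have "W * real x0 \<le> 1 * real x0"
      using W(3) by (intro mult_right_mono) auto
    moreover have "real (x0 + 1) < real (2 ^ p)"
      using x0(1) by (intro iffD2[OF of_nat_less_iff]) simp
    ultimately have "W * real x0 < 2 ^ p - 1"
      by simp
    then obtain n where n: "rep (fround p q False (W * real x0 * eta)) (real n * eta)" "\<bar>real n - W * real x0\<bar> \<le> 1 / 2"
      using rep_fround_eta[of "W * real x0"] W0 by auto
    have "64 * (\<kappa> + 2) ^ 2 \<le> 2 ^ p"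
      by (rule \<kappa>_bound)
    note arith = threshold_arith[OF x0_def k m1 this _ n(2), of "1 / 2 ^ p"]
    have ar1: "m < k \<Longrightarrow> 1 \<le> n \<and> m * n < k" and ar2: "2 * x0 + 2 \<le> m \<Longrightarrow> n = 0"
      and ar3: "m \<le> 2 * x0 + 1 \<Longrightarrow> m * n \<le> \<kappa> + 2"
      using arith W(4,5) by simp_all
    \<comment> \<open>An unbounded \<open>m\<close> does not lead off the grid, since
      \<open>n = 0\<close> as soon as \<open>m\<close> exceeds \<open>2 * x0 + 1\<close>.\<close>
    have mn2: "m * n \<le> \<kappa> + 2"
      using ar2 ar3 by (cases "m \<le> 2 * x0 + 1") auto
    then have mn: "m * n < 2 ^ p"
      using \<kappa>p by linarith
    have t0: "rep (fmul p q (weight ss (score D H y x)) (rmul x (WV H) $ 0)) (if ?\<phi> x then real n * eta else 0)"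
      if "x \<in> set xs" for x
    proof (cases "?\<phi> x")
      case True
      have "0 < W * (real x0 * eta)"
        using W0 x0 eta_pos by simp
      then have "fmul p q (weight ss (score D H y x)) (rmul x (WV H) $ 0) = fround p q False (W * real x0 * eta)"
        using fmul_eq_fround_pos[of _ W _ "real x0 * eta"] w[OF that] val0[OF that] True by (simp add: mult.assoc)
      then show ?thesis
        using n(1) True by simp
    next
      case False
      then show ?thesis
        using w[OF that] val0[OF that] by (auto intro: rep_fmul_zero_left)
    qed
    have rep0: "rep (head_row D H xs c y $ 0) (real (m * n) * eta)"
    proof -
      let ?l = "map (\<lambda>x. fmul p q (weight ss (score D H y x)) (rmul x (WV H) $ 0)) xs"
      have s: "(\<Sum>v \<leftarrow> ?l. rv v) = real m * (real n * eta)" "(\<Sum>v \<leftarrow> ?l. \<bar>rv v\<bar>) = real m * (real n * eta)"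
        unfolding m map_map comp_def using rv_rep[OF t0] eta_pos by (intro sum_list_indicator; simp)+
      have "rep (fsum p q ?l) (\<Sum>v \<leftarrow> ?l. rv v)"
      proof (rule rep_fsum[OF unit_eta[of 0 "2 ^ p - 1"]])
        show "\<forall>v \<in> set ?l. \<exists>n::int. rep v (of_int n * (2 ^ 0 * eta))"
        proof
          fix v
          assume "v \<in> set ?l"
          then obtain x where "x \<in> set xs" "rep v (if ?\<phi> x then real n * eta else 0)"
            using t0 by auto
          then show "\<exists>n::int. rep v (of_int n * (2 ^ 0 * eta))"
            by (intro exI[of _ "if ?\<phi> x then int n else 0"]) (simp split: if_splits)
        qed
        have "real (m * n) \<le> real (2 ^ p - 1)"
          using mn by (intro of_nat_mono) simp
        then have "real (m * n) * eta \<le> real (2 ^ p - 1) * eta"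
          using eta_pos by (intro mult_right_mono) simp_all
        then show "(\<Sum>v \<leftarrow> ?l. \<bar>rv v\<bar>) \<le> real (2 ^ p - 1) * (2 ^ 0 * eta)"
          unfolding s by (simp add: mult.assoc)
      qed simp_all
      then show ?thesis
        unfolding s row[of 0, simplified] by (simp add: mult.assoc)
    qed
    have "2 ^ (p + 1) < overflow_bound p q"
    proof -
      obtain e s where "fl_ok p q e s" "\<bar>2 ^ (p + 1)\<bar> = mag p q e s"
        using representable_two_pow[of "p + 1"] unfolding representable_def by blast
      then show ?thesis
        using mag_less_overflow by fastforce
    qed
    moreover have W2: "W * 2 ^ (p + 1) \<le> 2 ^ (p + 1)" "1 \<le> W * 2 ^ (p + 1)"
      using W(2,3) by (simp_all add: field_simps)
    ultimately have "W * 2 ^ (p + 1) < overflow_bound p q" "0 \<le> W * 2 ^ (p + 1)"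
      by linarith+
    \<comment> \<open>The exact product lies between the floats 1 and \<open>2 ^ (p + 1)\<close>,
      and rounding crosses neither.\<close>
    then obtain R where R: "rep (fround p q False (W * 2 ^ (p + 1))) R" "1 \<le> R" "R \<le> 2 ^ (p + 1)"
      using rep_fround_approx[of "W * 2 ^ (p + 1)" False] representable_1 representable_two_pow[of "p + 1"] W2
      by (smt (verit) le_add2 order_refl)
    have t1: "rep (fmul p q (weight ss (score D H y x)) (rmul x (WV H) $ 1)) (if ?\<phi> x then R else 0)"
      if "x \<in> set xs" for x
    proof (cases "?\<phi> x")
      case True
      then have "fmul p q (weight ss (score D H y x)) (rmul x (WV H) $ 1) = fround p q False (W * 2 ^ (p + 1))"
        using fmul_eq_fround_pos[of _ W _ "2 ^ (p + 1)"] w[OF that] val1[OF that] W0 by simp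
      then show ?thesis
        using R(1) True by simp
    next
      case False
      then show ?thesis
        using w[OF that] val1[OF that] by (auto intro: rep_fmul_zero_left)
    qed
    let ?l = "map (\<lambda>x. fmul p q (weight ss (score D H y x)) (rmul x (WV H) $ 1)) xs"
    have T: "L + (p + 1) + 3 < 2 ^ q"
      using L_bounds by simp
    have "\<forall>v \<in> set ?l. \<exists>c. rep v c \<and> 0 \<le> c \<and> c \<le> 2 ^ (L + (p + 1)) * eta"
      unfolding two_pow_eta'
    proof
      fix v
      assume "v \<in> set ?l"
      then obtain x where "x \<in> set xs" "rep v (if ?\<phi> x then R else 0)"
        using t1 by auto
      then show "\<exists>c. rep v c \<and> 0 \<le> c \<and> c \<le> 2 ^ (p + 1)"
        using R by (intro exI[of _ "if ?\<phi> x then R else 0"]) simp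
    qed
    then obtain S where S: "rep (fsum p q ?l) S" "\<forall>v \<in> set ?l. rv v \<le> S"
      using fsum_saturated[OF T, of ?l] by blast
    obtain x where x: "x \<in> set xs" "?\<phi> x"
      using False unfolding m by (auto simp: filter_empty_conv)
    have "1 \<le> S"
      using S(2) x t1[OF x(1)] R(2) by (force dest: rv_rep)
    moreover have "k \<le> m \<Longrightarrow> m * n = 0 \<or> k \<le> m * n"
      by (cases n) auto
    ultimately show thesis
      using rep0 S(1) row[of 1] mn2 ar1 False k
      by (intro that[of "m * n" S]) (auto simp: H_def x0_def)
  qed
qed

text \<open>If \<open>j\<close> occurs, the vertices carrying weight have value 0 at
  \<open>j'\<close> and the output is 0, however many there are. If it never occurs, the unique
  vertex with \<open>j'\<close> is alone in the top tier and its weight is exactly 1. The output is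
  therefore an exact bit, without any counting.\<close>

lemma past_head_row:
  assumes D: "dkey D = 1" and y: "finv d y" "rv (y $ 0) = 1" and j: "0 < j" "j < d" "0 < j'" "j' < d" "j \<noteq> j'"
    and xs: "\<forall>x \<in> set xs. finv d x \<and> rv (x $ 0) = 1 \<and> (rv (x $ j) = 0 \<or> rv (x $ j) = 1) \<and>
      (rv (x $ j') = 0 \<or> rv (x $ j') = 1) \<and> (rv (x $ j) = 0 \<or> rv (x $ j') = 0)"
    and uniq: "length (filter (\<lambda>x. rv (x $ j') = 1) xs) \<le> 1"
  shows "rep (head_row D (past_head d j j') xs c y $ 0)
      (of_bool ((\<forall>x \<in> set xs. rv (x $ j) = 0) \<and> (\<exists>x \<in> set xs. rv (x $ j') = 1)))"
    and "rep (head_row D (past_head d j j') xs c y $ 1) 0"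
proof -
  define H where "H = past_head d j j'"
  define ss where "ss = map (score D H y) xs @ replicate c (Infty True)"
  let ?\<phi> = "\<lambda>x. rv (x $ j) = 1" and ?\<psi> = "\<lambda>x. rv (x $ j') = 1"
  have d: "0 < d"
    using j by simp
  have HQ: "WQ H = score_query d" and HK: "WK H = smat d 1 (\<lambda>_. [(0, - 2 * B), (j, 3 * B), (j', B)])"
    and HV: "WV H = smat d 2 (\<lambda>i. if i = 0 then [(j', 1)] else [])"
    by (simp_all add: H_def past_head_def)
  have key: "rep (rmul x (WK H) $ 0) (- 2 * B + 3 * B * rv (x $ j) + B * rv (x $ j'))" if "x \<in> set xs" for x
  proof -
    have n: "\<exists>n::int. - 2 * B = of_int n * B" "\<exists>n::int. 3 * B = of_int n * B" "\<exists>n::int. B = of_int n * B"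
      by (intro exI[of _ "- 2"], simp) (intro exI[of _ 3], simp, intro exI[of _ 1], simp)
    have "rep (rmul x (smat d 1 (\<lambda>_. [(0, - 2 * B), (j, 3 * B), (j', B)])) $ 0)
        (\<Sum>(j, c) \<leftarrow> [(0, - 2 * B), (j, 3 * B), (j', B)]. c * rv (x $ j))"
      using xs that d j n B_pos by (intro rep_rmul_bool[OF _ _ unit_B]) auto
    then show ?thesis
      using xs that unfolding HK by (simp add: algebra_simps)
  qed
  have repB: "representable (4 * B)"
    using unit_B unfolding unit_def by (auto dest!: spec[of _ 4])
  have sc1: "rep (score D H y x) (4 * B)" if "x \<in> set xs" "?\<phi> x" for x
  proof -
    have "rv (x $ j') = 0"
      using xs that by force
    then show ?thesis
      using rep_score[OF D HQ HK y d key[OF that(1)]] that(2) repB by simp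
  qed
  have sc2: "rep (score D H y x) (- 4 * B)" if "x \<in> set xs" "?\<psi> x" for x
  proof -
    have "rv (x $ j) = 0"
      using xs that by force
    then show ?thesis
      using rep_score[OF D HQ HK y d key[OF that(1)]] that(2) repB by simp
  qed
  have sc0: "score D H y x = Infty True" if "x \<in> set xs" "\<not> ?\<phi> x" "\<not> ?\<psi> x" for x
    using score_neg_Infty[OF D HQ HK y d] key[OF that(1)] xs that by fastforce
  have val0: "rep (rmul x (WV H) $ 0) (rv (x $ j'))" if "x \<in> set xs" for x
    unfolding HV using rep_rmul_single[of d x 0 2 "\<lambda>i. if i = 0 then [(j', 1)] else []" j' 1] xs that j representable_1
    by fastforce
  have val1: "rep (rmul x (WV H) $ 1) 0" if "x \<in> set xs" for x
    unfolding HV using xs that by (intro rep_rmul_Nil) auto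
  have row: "head_row D H xs c y $ i = fsum p q (map (\<lambda>x. fmul p q (weight ss (score D H y x)) (rmul x (WV H) $ i)) xs)"
    if "i < 2" for i
    using head_row_entry[of i H D xs c y] that by (simp add: HV ss_def)
  \<comment> \<open>Which tier is maximal depends on whether \<open>j\<close> occurs at all.\<close>
  let ?tp = "\<lambda>s. if \<exists>x \<in> set xs. ?\<phi> x then rep s (4 * B) else s \<noteq> Infty True"
  let ?a = "if \<exists>x \<in> set xs. ?\<phi> x then 4 * B else - 4 * B"
  have mem: "s = Infty True \<or> rep s (4 * B) \<or> rep s (- 4 * B)" if "s \<in> set ss" for s
    using that sc0 sc1 sc2 unfolding ss_def by (auto split: if_splits)
  have top_rep: "\<forall>s \<in> set ss. ?tp s \<longrightarrow> rep s ?a"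
  proof (cases "\<exists>x \<in> set xs. ?\<phi> x")
    case False
    then have "s \<noteq> Infty True \<Longrightarrow> rep s (- 4 * B)" if "s \<in> set ss" for s
      using that sc0 sc2 unfolding ss_def by (auto split: if_splits)
    then show ?thesis
      using False by simp
  qed simp
  have low: "\<forall>s \<in> set ss. \<forall>t \<in> set ss. \<not> ?tp s \<longrightarrow> ?tp t \<longrightarrow> rank p q s < rank p q t \<and> fsub p q s t = Infty True"
  proof (intro ballI impI)
    fix s t
    assume st: "s \<in> set ss" "t \<in> set ss" "\<not> ?tp s" "?tp t"
    have t: "rep t ?a"
      using top_rep st by blast
    show "rank p q s < rank p q t \<and> fsub p q s t = Infty True"
    proof (cases "s = Infty True")
      case True
      then show ?thesis
        using rank_neg_Infty_less[OF t] fsub_neg_Infty[OF t] by simp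
    next
      case False
      then have ex: "\<exists>x \<in> set xs. ?\<phi> x"
        using st(3) by (auto split: if_splits)
      then have t4: "rep t (4 * B)" and s4: "rep s (- 4 * B)"
        using t st False mem[OF st(1)] by auto
      obtain b e u where t': "t = Fl b e u" "4 * B = (if b then - mag p q e u else mag p q e u)" "fl_ok p q e u"
        using t4 by (rule repE)
      obtain b' e' u' where s': "s = Fl b' e' u'" "- 4 * B = (if b' then - mag p q e' u' else mag p q e' u')"
        using s4 by (rule repE)
      have b: "\<not> b" "b'"
        using t'(2) s'(2) B_pos mag_nonneg[of e u] mag_nonneg[of e' u'] by (auto split: if_splits)
      have "rank p q s < rank p q t"
        using b code_nonneg[of e u] code_nonneg[of e' u'] unfolding t'(1) s'(1) rank_Fl by simp
      \<comment> \<open>The two finite tiers are \<open>8 * B\<close> apart, which is beyond the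
        overflow bound.\<close>
      moreover have "fsub p q s t = Infty True"
      proof -
        have "rep (fneg t) (- (4 * B))"
          using t' b by (simp add: rep_Fl)
        then have "fsub p q s t = fround p q (- 4 * B + - (4 * B) < 0) \<bar>- 4 * B + - (4 * B)\<bar>"
          unfolding fsub_def using s4 B_pos by (intro fadd_eq_fround) auto
        moreover have "\<bar>- 4 * B + - (4 * B)\<bar> = 8 * B" "- 4 * B + - (4 * B) < 0"
          using B_pos by auto
        ultimately show ?thesis
          using B_overflow by (simp add: fround_def)
      qed
      ultimately show ?thesis
        by blast
    qed
  qed
  have prods: "rep (fmul p q (weight ss (score D H y x)) (rmul x (WV H) $ 0))
      (of_bool ((\<forall>x \<in> set xs. rv (x $ j) = 0) \<and> ?\<psi> x)) \<and>
      (\<exists>r. rep (weight ss (score D H y x)) r)" if x: "x \<in> set xs" for x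
  proof (cases "length (filter ?tp ss) = 0")
    \<comment> \<open>No finite score at all: neither \<open>j\<close> nor \<open>j'\<close> occurs,
      and the convention for an entirely masked softmax gives weight 0.\<close>
    case True
    have no\<phi>: "\<not> (\<exists>x \<in> set xs. ?\<phi> x)"
    proof
      assume ex: "\<exists>x \<in> set xs. ?\<phi> x"
      then obtain x where "x \<in> set xs" "?\<phi> x"
        by blast
      then have "score D H y x \<in> set ss" "rep (score D H y x) (4 * B)"
        using sc1 by (auto simp: ss_def)
      then show False
        using True ex by (auto simp: filter_empty_conv)
    qed
    then have all: "\<forall>t \<in> set ss. t = Infty True"
      using True by (auto simp: filter_empty_conv)
    then have "score D H y x = Infty True"
      using x by (simp add: ss_def)
    then have "\<not> ?\<psi> x"
      using sc2[OF x] rep_imp_ne_Infty by metis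
    then show ?thesis
      using weight_all_neg_Infty[OF all] rep_fmul_zero_left[OF rep_fzero val0[OF x]]
      by (auto intro: exI[of _ 0])
  next
    case False
    define m where "m = length (filter ?tp ss)"
    have m1: "1 \<le> m"
      unfolding m_def using False by linarith
    obtain W where W: "\<And>s. s \<in> set ss \<Longrightarrow> rep (weight ss s) (if ?tp s then W else 0)" "m = 1 \<Longrightarrow> W = 1"
      using weight_tops[OF top_rep low m_def m1] by blast
    have ss: "score D H y x \<in> set ss"
      using x by (simp add: ss_def)
    show ?thesis
    proof (cases "?\<psi> x")
      case False
      then have "rv (x $ j') = 0"
        using xs x by blast
      then show ?thesis
        using rep_fmul_zero_right[OF W(1)[OF ss]] val0[OF x] W(1)[OF ss] False by auto
    next
      case \<psi>: True
      have s4: "rep (score D H y x) (- 4 * B)"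
        using sc2[OF x \<psi>] .
      show ?thesis
      proof (cases "\<exists>x \<in> set xs. ?\<phi> x")
        case True
        then have "\<not> ?tp (score D H y x)"
          using s4 rep_unique[of "score D H y x" "4 * B" "- 4 * B"] B_pos by auto
        then have "rep (weight ss (score D H y x)) 0"
          using W(1)[OF ss] by simp
        moreover have "\<not> (\<forall>x \<in> set xs. rv (x $ j) = 0)"
          using True by force
        ultimately show ?thesis
          using rep_fmul_zero_left[OF _ val0[OF x]] by auto
      next
        case False
        then have tp: "?tp s \<longleftrightarrow> s \<noteq> Infty True" for s
          by simp
        have "filter ?tp ss = filter (\<lambda>s. s \<noteq> Infty True) (map (score D H y) xs)"
          using False by (simp add: ss_def)
        also have "\<dots> = map (score D H y) (filter (\<lambda>x. score D H y x \<noteq> Infty True) xs)"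
          by (simp add: filter_map comp_def)
        also have "filter (\<lambda>x. score D H y x \<noteq> Infty True) xs = filter ?\<psi> xs"
          using sc0 sc2 False rep_imp_ne_Infty by (intro filter_cong) (auto, metis)
        finally have "m \<le> 1"
          using uniq unfolding m_def by simp
        then have "W = 1"
          using W(2) m1 by simp
        then have "rep (weight ss (score D H y x)) 1"
          using W(1)[OF ss] False rep_imp_ne_Infty[OF s4] by simp
        moreover have "rep (rmul x (WV H) $ 0) 1"
          using val0[OF x] \<psi> by simp
        ultimately have "rep (fmul p q (weight ss (score D H y x)) (rmul x (WV H) $ 0)) 1"
          using rep_fmul[of _ 1 _ 1] representable_1 by simp
        moreover have "\<forall>x \<in> set xs. rv (x $ j) = 0"
          using False xs by blast
        ultimately show ?thesis
          using \<psi> W(1)[OF ss] by auto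
      qed
    qed
  qed
  have "rep (head_row D H xs c y $ 1) 0"
  proof -
    have "rep (fmul p q (weight ss (score D H y x)) (rmul x (WV H) $ 1)) 0" if "x \<in> set xs" for x
      using prods[OF that] rep_fmul_zero_right[OF _ val1[OF that]] by blast
    then have "rep (fsum p q (map (\<lambda>x. fmul p q (weight ss (score D H y x)) (rmul x (WV H) $ 1)) xs)) 0"
      by (intro rep_fsum_zero) auto
    then show ?thesis
      using row[of 1] by simp
  qed
  then show "rep (head_row D (past_head d j j') xs c y $ 1) 0"
    by (simp add: H_def)
  let ?l = "map (\<lambda>x. fmul p q (weight ss (score D H y x)) (rmul x (WV H) $ 0)) xs"
  let ?c = "of_bool (\<forall>x \<in> set xs. rv (x $ j) = 0) :: real"
  let ?n = "length (filter ?\<psi> xs)"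
  have rvl: "rv (fmul p q (weight ss (score D H y x)) (rmul x (WV H) $ 0)) = (if ?\<psi> x then ?c else 0)" if "x \<in> set xs" for x
    using prods[OF that] rv_rep by fastforce
  have s: "(\<Sum>v \<leftarrow> ?l. rv v) = real ?n * ?c" "(\<Sum>v \<leftarrow> ?l. \<bar>rv v\<bar>) = real ?n * ?c"
    unfolding map_map comp_def using rvl by (intro sum_list_indicator; simp)+
  have n_eq: "?n = of_bool (\<exists>x \<in> set xs. ?\<psi> x)"
  proof (cases "\<exists>x \<in> set xs. ?\<psi> x")
    case True
    then have "?n \<noteq> 0"
      by (auto simp: filter_empty_conv)
    then have "?n = 1"
      using uniq by linarith
    then show ?thesis
      using True by simp
  next
    case False
    then have "filter ?\<psi> xs = []"
      by (auto simp: filter_empty_conv)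
    then show ?thesis
      using False by simp
  qed
  have "rep (fsum p q ?l) (\<Sum>v \<leftarrow> ?l. rv v)"
  proof (rule rep_fsum[OF unit_1])
    show "\<forall>v \<in> set ?l. \<exists>n::int. rep v (of_int n * 1)"
    proof
      fix v
      assume "v \<in> set ?l"
      then obtain x where "rep v (of_bool ((\<forall>x \<in> set xs. rv (x $ j) = 0) \<and> ?\<psi> x))"
        using prods by auto
      then show "\<exists>n::int. rep v (of_int n * 1)"
        by (intro exI[of _ "of_bool ((\<forall>x \<in> set xs. rv (x $ j) = 0) \<and> ?\<psi> x)"]) simp
    qed
    have "real 1 \<le> real (2 ^ p - 1)"
      using one_less_power[of "2::nat" p] p_pos by (intro of_nat_mono) simp
    moreover have "real ?n * ?c \<le> 1"
      unfolding n_eq by simp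
    ultimately show "(\<Sum>v \<leftarrow> ?l. \<bar>rv v\<bar>) \<le> real (2 ^ p - 1) * 1"
      unfolding s of_nat_1 by linarith
  qed
  then show "rep (head_row D (past_head d j j') xs c y $ 0)
      (of_bool ((\<forall>x \<in> set xs. rv (x $ j) = 0) \<and> (\<exists>x \<in> set xs. rv (x $ j') = 1)))"
    unfolding s n_eq using row[of 0] by (simp add: H_def of_bool_conj mult.commute)
qed

end

section \<open>Compiling formulas into layers\<close>

text \<open>\<open>BosNot \<phi>\<close> marks the BOS vertex if it violates \<open>\<phi>\<close>. This is the vertex that the head for \<open>PSuf \<phi>\<close>
  falls back to when \<open>\<phi>\<close> never held.\<close>

datatype 'a node = Fm "'a gptl" | BosNot "'a gptl"

primrec node_sat :: "'a graph \<Rightarrow> nat \<Rightarrow> 'a node \<Rightarrow> bool" where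
  "node_sat G v (Fm \<phi>) = sat G v \<phi>"
| "node_sat G v (BosNot \<phi>) = (v = bos G \<and> \<not> sat G v \<phi>)"

fun deps :: "'a node \<Rightarrow> 'a node list" where
  "deps (Fm Bot) = []"
| "deps (Fm (Prop a)) = []"
| "deps (Fm (Neg \<phi>)) = [Fm \<phi>]"
| "deps (Fm (Conj \<phi> \<psi>)) = [Fm \<phi>, Fm \<psi>]"
| "deps (Fm (GPre k \<phi>)) = [Fm \<phi>]"
| "deps (Fm (PSuf \<phi>)) = [Fm \<phi>, BosNot \<phi>]"
| "deps (BosNot \<phi>) = [Fm \<phi>]"

primrec nodes :: "'a gptl \<Rightarrow> 'a node list" where
  "nodes Bot = [Fm Bot]"
| "nodes (Prop a) = [Fm (Prop a)]"
| "nodes (Neg \<phi>) = nodes \<phi> @ [Fm (Neg \<phi>)]"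
| "nodes (Conj \<phi> \<psi>) = (nodes \<phi> @ nodes \<psi>) @ [Fm (Conj \<phi> \<psi>)]"
| "nodes (GPre k \<phi>) = nodes \<phi> @ [Fm (GPre k \<phi>)]"
| "nodes (PSuf \<phi>) = (nodes \<phi> @ [BosNot \<phi>]) @ [Fm (PSuf \<phi>)]"

text \<open>A topological order: layer \<open>i\<close> evaluates node \<open>i\<close>, so the
  nodes it reads must belong to earlier layers.\<close>

definition ordered :: "'a node list \<Rightarrow> bool" where
  "ordered ns \<longleftrightarrow> (\<forall>i < length ns. set (deps (ns ! i)) \<subseteq> set (take i ns))"

lemma ordered_Nil [simp]: "ordered []"
  by (simp add: ordered_def)

lemma ordered_append: "ordered xs \<Longrightarrow> ordered ys \<Longrightarrow> ordered (xs @ ys)"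
  unfolding ordered_def
proof (intro allI impI)
  fix i
  assume *: "\<forall>i < length xs. set (deps (xs ! i)) \<subseteq> set (take i xs)"
    "\<forall>i < length ys. set (deps (ys ! i)) \<subseteq> set (take i ys)" "i < length (xs @ ys)"
  show "set (deps ((xs @ ys) ! i)) \<subseteq> set (take i (xs @ ys))"
  proof (cases "i < length xs")
    case True
    then show ?thesis
      using *(1) by (simp add: nth_append)
  next
    case False
    then have "set (deps (ys ! (i - length xs))) \<subseteq> set (take (i - length xs) ys)"
      using *(2,3) by simp
    then show ?thesis
      using False by (auto simp: nth_append)
  qed
qed

lemma ordered_snoc: "ordered xs \<Longrightarrow> set (deps n) \<subseteq> set xs \<Longrightarrow> ordered (xs @ [n])"
  unfolding ordered_def by (auto simp: nth_append less_Suc_eq)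

lemma nodes_ordered: "ordered (nodes \<phi>) \<and> Fm \<phi> \<in> set (nodes \<phi>)"
proof (induction \<phi>)
  case Bot
  then show ?case
    using ordered_snoc[of "[]" "Fm Bot"] by simp
next
  case (Prop a)
  then show ?case
    using ordered_snoc[of "[]" "Fm (Prop a)"] by simp
next
  case (Neg \<phi>)
  then show ?case
    using ordered_snoc[of "nodes \<phi>" "Fm (Neg \<phi>)"] by simp
next
  case (Conj \<phi> \<psi>)
  then show ?case
    using ordered_snoc[OF ordered_append[of "nodes \<phi>" "nodes \<psi>"], of "Fm (Conj \<phi> \<psi>)"] by simp
next
  case (GPre k \<phi>)
  then show ?case
    using ordered_snoc[of "nodes \<phi>" "Fm (GPre k \<phi>)"] by simp
next
  case (PSuf \<phi>)
  then show ?case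
    using ordered_snoc[OF ordered_snoc[of "nodes \<phi>" "BosNot \<phi>"], of "Fm (PSuf \<phi>)"] by simp
qed

locale compilation = large_format +
  fixes ns :: "'a node list"
  assumes ordered: "ordered ns"
    and \<kappa>_pos: "1 \<le> \<kappa>"
    and \<kappa>_GPre: "\<And>k \<phi>. Fm (GPre k \<phi>) \<in> set ns \<Longrightarrow> k \<le> \<kappa>"
begin

abbreviation N :: nat where
  "N \<equiv> length ns"

text \<open>Coordinate 0 is constantly 1, coordinate 1 flags BOS, and each node has one coordinate for its truth
  value and two scratch coordinates for the attention outputs.\<close>

definition d :: nat where
  "d = 3 * N + 2"

definition feat :: "nat \<Rightarrow> nat" where
  "feat i = 3 * i + 2"

definition scr :: "nat \<Rightarrow> nat" where
  "scr i = 3 * i + 3"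

definition scr' :: "nat \<Rightarrow> nat" where
  "scr' i = 3 * i + 4"

lemmas coord_defs = d_def feat_def scr_def scr'_def

lemma coords_less: "0 < d" "1 < d" "i < N \<Longrightarrow> feat i < d" "i < N \<Longrightarrow> scr i < d" "i < N \<Longrightarrow> scr' i < d"
  by (auto simp: coord_defs)

lemma coords_distinct:
  "feat i \<noteq> 0" "feat i \<noteq> 1" "scr i \<noteq> 0" "scr i \<noteq> 1" "scr' i \<noteq> 0" "scr' i \<noteq> 1"
  "feat i = feat j \<longleftrightarrow> i = j" "scr i = scr j \<longleftrightarrow> i = j" "scr' i = scr' j \<longleftrightarrow> i = j"
  "feat i \<noteq> scr j" "feat i \<noteq> scr' j" "scr i \<noteq> scr' j"
  "scr j \<noteq> feat i" "scr' j \<noteq> feat i" "scr' j \<noteq> scr i"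
  by (auto simp: coord_defs) presburger+

lemma coords_distinct_Suc: "feat i \<noteq> Suc 0" "scr i \<noteq> Suc 0" "scr' i \<noteq> Suc 0"
  by (auto simp: coord_defs)

text \<open>A node may be listed repeatedly; the least index is the safe choice, as
  \<open>ordered\<close> guarantees some occurrence before the layer that reads it.\<close>

definition ix :: "'a node \<Rightarrow> nat" where
  "ix n = (LEAST i. ns ! i = n)"

lemma ix_less:
  assumes "n \<in> set (take i ns)" "i \<le> N"
  shows "ix n < i" "ns ! ix n = n"
proof -
  obtain j where j: "j < i" "ns ! j = n"
    using assms by (auto simp: in_set_conv_nth)
  have "ix n \<le> j"
    unfolding ix_def using j(2) by (rule Least_le)
  then show "ix n < i"
    using j(1) by simp
  show "ns ! ix n = n"
    unfolding ix_def using j(2) by (rule LeastI)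
qed

lemma ix_dep:
  assumes "i < N" "n \<in> set (deps (ns ! i))"
  shows "ix n < i" "ns ! ix n = n"
  using ix_less[of n i] ordered assms unfolding ordered_def by auto

section \<open>Sublayers for single nodes\<close>

definition single :: "head \<Rightarrow> (nat \<Rightarrow> (nat \<times> real) list) \<Rightarrow> mha" where
  "single H ps = \<lparr>heads = [H], WO = smat 2 d ps\<rparr>"

text \<open>A head is mandatory, so inactive attention is a head with zero output weights. Its
  outputs must still be finite, because 0 times an infinity is NaN; counting the BOS flag is such a
  head.\<close>

definition null_mha :: mha where
  "null_mha = single (count_head d 1 1) (\<lambda>_. [])"

text \<open>The count arrives in units of \<open>eta\<close>, but \<open>1 / eta = 2 ^ L\<close>
  exceeds the largest float. The scaling is split: this factor leads to units of
  \<open>1 / 2 ^ (p - 1)\<close>, and the hidden units in \<open>gates\<close> multiply by the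
  remaining \<open>2 ^ (p - 1)\<close>.\<close>

definition count_mha :: "nat \<Rightarrow> nat \<Rightarrow> nat \<Rightarrow> mha" where
  "count_mha i j k = single (count_head d (feat j) ((k + 1) div 2))
     (\<lambda>t. if t = scr i then [(0, 2 ^ (2 ^ (p - 1) - 1))] else if t = scr' i then [(1, 1)] else [])"

definition past_mha :: "nat \<Rightarrow> nat \<Rightarrow> nat \<Rightarrow> mha" where
  "past_mha i j j' = single (past_head d (feat j) (feat j')) (\<lambda>t. if t = scr i then [(0, 1)] else [])"

text \<open>A hidden unit is given by its incoming weights, its bias and its outgoing weight.\<close>

definition unit_mlp :: "nat \<Rightarrow> (nat \<Rightarrow> (nat \<times> real) list \<times> real \<times> real) \<Rightarrow> mlp" where
  "unit_mlp t g = \<lparr>W1 = smat d 4 (\<lambda>h. fst (g h)), b1 = vec 4 (\<lambda>h. flo (fst (snd (g h)))),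
     W2 = smat 4 d (\<lambda>u. if u = t then map (\<lambda>h. (h, snd (snd (g h)))) [0..<4] else []),
     b2 = vec d (\<lambda>_. fzero False)\<rparr>"

definition only :: "(nat \<times> real) list \<Rightarrow> real \<Rightarrow> nat \<Rightarrow> (nat \<times> real) list \<times> real \<times> real" where
  "only ps b h = (if h = 0 then (ps, b, 1) else ([], 0, 0))"

text \<open>Truth functions as integer combinations of ReLUs. Let \<open>z\<close> be the scaled
  count and \<open>m\<close> the true one. The four units of \<open>GPre\<close> compute [m = 0],
  [z = 0] and, as a difference of two ramps, [z \<ge> k]; their combination -[m = 0] + [z = 0] +
  [z \<ge> k] is [m \<ge> k] by \<open>counted\<close>. For \<open>PSuf\<close> the scratch bit says
  that the argument never held before; it is 0 at BOS, where the flag is subtracted instead. The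
  parameter \<open>dc\<close> distinguishes decoder from encoder, in whose vertices
  \<open>PSuf\<close> is false.\<close>

fun gates :: "bool \<Rightarrow> nat \<Rightarrow> 'a node \<Rightarrow> nat \<Rightarrow> (nat \<times> real) list \<times> real \<times> real" where
  "gates dc i (Fm (Neg \<phi>)) = only [(feat (ix (Fm \<phi>)), - 1)] 1"
| "gates dc i (Fm (Conj \<phi> \<psi>)) = only [(feat (ix (Fm \<phi>)), 1), (feat (ix (Fm \<psi>)), 1)] (- 1)"
| "gates dc i (Fm (GPre k \<phi>)) = (if k = 0 then only [] 1 else (\<lambda>h.
     if h = 0 then ([(scr' i, - 1)], 1, - 1)
     else if h = 1 then ([(scr i, - (2 ^ (p - 1)))], 1, 1)
     else if h = 2 then ([(scr i, 2 ^ (p - 1))], 1 - real k, 1)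
     else ([(scr i, 2 ^ (p - 1))], - real k, - 1)))"
| "gates dc i (Fm (PSuf \<phi>)) = (if dc then only [(scr i, - 1), (1, - 1)] 1 else only [] 0)"
| "gates dc i (BosNot \<phi>) = only [(1, 1), (feat (ix (Fm \<phi>)), - 1)] 0"
| "gates dc i _ = only [] 0"

fun count_attention :: "nat \<Rightarrow> 'a node \<Rightarrow> mha" where
  "count_attention i (Fm (GPre k \<phi>)) = (if k = 0 then null_mha else count_mha i (ix (Fm \<phi>)) k)"
| "count_attention i _ = null_mha"

fun past_attention :: "nat \<Rightarrow> 'a node \<Rightarrow> mha" where
  "past_attention i (Fm (PSuf \<phi>)) = past_mha i (ix (Fm \<phi>)) (ix (BosNot \<phi>))"
| "past_attention i _ = null_mha"

definition enc_layer_of :: "nat \<Rightarrow> enc_layer" where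
  "enc_layer_of i = \<lparr>enc_self = count_attention i (ns ! i), enc_mlp = unit_mlp (feat i) (gates False i (ns ! i))\<rparr>"

definition dec_layer_of :: "nat \<Rightarrow> dec_layer" where
  "dec_layer_of i = \<lparr>dec_self = past_attention i (ns ! i), dec_cross = count_attention i (ns ! i),
     dec_mlp = unit_mlp (feat i) (gates True i (ns ! i))\<rparr>"

definition atomic :: "'a node \<Rightarrow> bool" where
  "atomic n \<longleftrightarrow> (\<exists>a. n = Fm (Prop a))"

text \<open>Features of nodes not yet evaluated are 0, except for atoms, which the embedding sets;
  their scratch coordinates are 0 as well. Thus each layer writes into empty coordinates and the
  residual connection acts as an assignment.\<close>

definition Inv :: "nat \<Rightarrow> 'a graph \<Rightarrow> nat \<Rightarrow> flt vec \<Rightarrow> bool" where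
  "Inv i G v x \<longleftrightarrow> finv d x \<and> rv (x $ 0) = 1 \<and> rv (x $ 1) = of_bool (v = bos G) \<and>
     (\<forall>t < N. rv (x $ feat t) = of_bool (node_sat G v (ns ! t) \<and> (t < i \<or> atomic (ns ! t)))) \<and>
     (\<forall>t < N. i \<le> t \<longrightarrow> rv (x $ scr t) = 0 \<and> rv (x $ scr' t) = 0)"

lemma InvD:
  assumes "Inv i G v x"
  shows "finv d x" "rv (x $ 0) = 1" "rv (x $ 1) = of_bool (v = bos G)"
    "\<And>t. t < N \<Longrightarrow> rv (x $ feat t) = of_bool (node_sat G v (ns ! t) \<and> (t < i \<or> atomic (ns ! t)))"
    "\<And>t. t < N \<Longrightarrow> i \<le> t \<Longrightarrow> rv (x $ scr t) = 0" "\<And>t. t < N \<Longrightarrow> i \<le> t \<Longrightarrow> rv (x $ scr' t) = 0"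
  using assms by (auto simp: Inv_def)

lemma finvD: "finv n x \<Longrightarrow> t < n \<Longrightarrow> rep (x $ t) (rv (x $ t))"
  by (simp add: finv_def)

text \<open>At each coordinate one of the two summands is 0, so the addition is exact without a
  common grid, even for the large inexact output that signals a nonzero count.\<close>

lemma residual:
  assumes "finv d y" "dim_vec u = d" "\<And>t. t < d \<Longrightarrow> rep (u $ t) (b t)"
    and "\<And>t. t < d \<Longrightarrow> b t = 0 \<or> rv (y $ t) = 0"
  shows "finv d (radd u y)" "\<And>t. t < d \<Longrightarrow> rv (radd u y $ t) = b t + rv (y $ t)"
proof -
  have r: "rep (radd u y $ t) (b t + rv (y $ t))" if "t < d" for t
  proof -
    have "representable (b t + rv (y $ t))"
      using assms(4)[OF that] rep_representable[OF assms(3)[OF that]] rep_representable[OF finvD[OF assms(1) that]]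
      by auto
    then show ?thesis
      using rep_fadd[OF assms(3)[OF that] finvD[OF assms(1) that]] that assms(2) by (simp add: radd_def)
  qed
  then show "\<And>t. t < d \<Longrightarrow> rv (radd u y $ t) = b t + rv (y $ t)"
    by (rule rv_rep)
  then show "finv d (radd u y)"
    using r assms(2) by (simp add: finv_def) (simp add: radd_def)
qed

lemma multi_row_single:
  assumes "dval D = 2"
  shows "multi_row D (single H ps) xs c y = rmul (vec 2 (($) (head_row D H xs c y))) (smat 2 d ps)"
proof -
  have "vec (length (heads (single H ps)) * dval D)
      (\<lambda>j. head_row D (heads (single H ps) ! (j div dval D)) xs c y $ (j mod dval D)) = vec 2 (($) (head_row D H xs c y))"
    by (intro eq_vecI) (auto simp: assms single_def)
  then show ?thesis
    by (simp add: multi_row_def single_def)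
qed

lemma finv_2: "rep (o' $ 0) a \<Longrightarrow> rep (o' $ 1) b \<Longrightarrow> finv 2 (vec 2 (($) o'))"
  by (auto simp: finv_def less_2_cases_iff dest: rv_rep)

lemma null_attention:
  assumes D: "dkey D = 1" "dval D = 2" and y: "finv d y" "rv (y $ 0) = 1"
    and xs: "\<forall>x \<in> set xs. finv d x \<and> rv (x $ 0) = 1 \<and> (rv (x $ 1) = 0 \<or> rv (x $ 1) = 1)"
  shows "finv d (radd (multi_row D null_mha xs c y) y)"
    and "\<And>t. t < d \<Longrightarrow> rv (radd (multi_row D null_mha xs c y) y $ t) = rv (y $ t)"
proof -
  have one: "(1 + 1) div 2 = (1::nat)"
    by simp
  obtain z S where "rep (head_row D (count_head d 1 1) xs c y $ 0) (real z * eta)"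
    "rep (head_row D (count_head d 1 1) xs c y $ 1) S"
  proof (rule count_head_row[where D = D and d = d and j = 1 and k = 1 and y = y and xs = xs and c = c,
        OF D(1) y _ coords_less(2) xs refl])
    show "0 < (1::nat)" "1 \<le> (1::nat)" "1 \<le> \<kappa>"
      using \<kappa>_pos by simp_all
    fix z S
    assume "rep (head_row D (count_head d 1 ((1 + 1) div 2)) xs c y $ 0) (real z * eta)"
      "rep (head_row D (count_head d 1 ((1 + 1) div 2)) xs c y $ 1) S"
    then show thesis
      unfolding one by (rule that)
  qed
  note fin = finv_2[OF this]
  have "rep (multi_row D null_mha xs c y $ t) 0" if "t < d" for t
    unfolding null_mha_def multi_row_single[OF D(2)] using fin that by (intro rep_rmul_Nil) auto
  moreover have "dim_vec (multi_row D null_mha xs c y) = d"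
    unfolding null_mha_def multi_row_single[OF D(2)] by simp
  ultimately show "finv d (radd (multi_row D null_mha xs c y) y)"
    and "\<And>t. t < d \<Longrightarrow> rv (radd (multi_row D null_mha xs c y) y $ t) = rv (y $ t)"
    using residual[OF y(1), of "multi_row D null_mha xs c y" "\<lambda>_. 0"] by auto
qed

lemma count_attention_step:
  assumes D: "dkey D = 1" "dval D = 2" and y: "finv d y" "rv (y $ 0) = 1" "rv (y $ scr i) = 0" "rv (y $ scr' i) = 0"
    and i: "i < N" "j < N" and k: "1 \<le> k" "k \<le> \<kappa>"
    and xs: "\<forall>x \<in> set xs. finv d x \<and> rv (x $ 0) = 1 \<and> (rv (x $ feat j) = 0 \<or> rv (x $ feat j) = 1)"
    and m: "m = length (filter (\<lambda>x. rv (x $ feat j) = 1) xs)"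
  obtains z S where "finv d (radd (multi_row D (count_mha i j k) xs c y) y)"
    "\<And>t. t < d \<Longrightarrow> t \<noteq> scr i \<Longrightarrow> t \<noteq> scr' i \<Longrightarrow> rv (radd (multi_row D (count_mha i j k) xs c y) y $ t) = rv (y $ t)"
    "rv (radd (multi_row D (count_mha i j k) xs c y) y $ scr i) = real z / 2 ^ (p - 1)"
    "rv (radd (multi_row D (count_mha i j k) xs c y) y $ scr' i) = S" "z \<le> \<kappa> + 2"
    "m = 0 \<Longrightarrow> z = 0 \<and> S = 0" "1 \<le> m \<Longrightarrow> 1 \<le> S"
    "1 \<le> m \<Longrightarrow> m < k \<Longrightarrow> 1 \<le> z \<and> z < k" "k \<le> m \<Longrightarrow> z = 0 \<or> k \<le> z"
proof -
  let ?H = "count_head d (feat j) ((k + 1) div 2)"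
  obtain z S where zS: "rep (head_row D ?H xs c y $ 0) (real z * eta)" "rep (head_row D ?H xs c y $ 1) S" "z \<le> \<kappa> + 2"
    "m = 0 \<Longrightarrow> z = 0 \<and> S = 0" "1 \<le> m \<Longrightarrow> 1 \<le> S"
    "1 \<le> m \<Longrightarrow> m < k \<Longrightarrow> 1 \<le> z \<and> z < k" "k \<le> m \<Longrightarrow> z = 0 \<or> k \<le> z"
    using count_head_row[OF D(1) y(1,2) _ coords_less(3)[OF i(2)] xs m k, of c] coords_distinct(1) by blast
  let ?o = "vec 2 (($) (head_row D ?H xs c y))"
  let ?u = "multi_row D (count_mha i j k) xs c y"
  let ?A = "2 ^ (p - 1) - 1 :: nat"
  have fin: "finv 2 ?o"
    using zS(1,2) by (rule finv_2)
  have ov: "rv (?o $ 0) = real z * eta" "rv (?o $ 1) = S"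
    using rv_rep[OF zS(1)] rv_rep[OF zS(2)] by simp_all
  have A: "?A \<le> L" "L - ?A = p - 1" "?A < 2 ^ q"
    using p_ge pow_bounds by (auto simp: L_def q_eq)
  have z: "2 ^ ?A * (real z * eta) = real z / 2 ^ (p - 1)"
    using two_pow_eta[OF A(1)] unfolding A(2) by (simp add: mult.left_commute)
  have repA: "representable (2 ^ ?A)"
  proof -
    \<comment> \<open>With significand 1 the exponent \<open>L + ?A\<close> would be out of range,
      so \<open>p - 1\<close> binary places are moved into the significand.\<close>
    have "representable (real (2 ^ (p - 1)) * 2 ^ (L + ?A - (p - 1)) * eta)"
      using L_bounds pow_bounds p_ge by (intro representable_nat) (auto simp: L_def q_eq)
    moreover have "real (2 ^ (p - 1)) * 2 ^ (L + ?A - (p - 1)) * eta = 2 ^ ?A"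
    proof -
      have "p - 1 + (L + ?A - (p - 1)) = L + ?A"
        using L_bounds by simp
      then have "(2::real) ^ (p - 1) * 2 ^ (L + ?A - (p - 1)) = 2 ^ (L + ?A)"
        by (metis power_add)
      then show ?thesis
        using two_pow_eta'[of ?A] by simp
    qed
    ultimately show ?thesis
      by simp
  qed
  have u: "?u = rmul ?o (smat 2 d (\<lambda>t. if t = scr i then [(0, 2 ^ ?A)] else if t = scr' i then [(1, 1)] else []))"
    unfolding count_mha_def multi_row_single[OF D(2)] ..
  have r: "rep (?u $ t) (if t = scr i then real z / 2 ^ (p - 1) else if t = scr' i then S else 0)" if "t < d" for t
  proof -
    consider "t = scr i" | "t = scr' i" | "t \<noteq> scr i" "t \<noteq> scr' i"
      by blast
    then show ?thesis
    proof cases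
      case 1
      have "representable (2 ^ ?A * rv (?o $ 0))"
        unfolding ov z using zS(3) \<kappa>_less L_bounds by (intro representable_frac) auto
      then have "rep (?u $ t) (2 ^ ?A * rv (?o $ 0))"
        unfolding u using 1 fin that repA by (intro rep_rmul_single) auto
      then show ?thesis
        unfolding ov z using 1 by simp
    next
      case 2
      then have "rep (?u $ t) (1 * rv (?o $ 1))"
        unfolding u using fin that representable_1 rep_representable[OF finvD[OF fin, of 1]]
        by (intro rep_rmul_single) (auto simp: coords_distinct)
      then show ?thesis
        unfolding ov using 2 by (simp add: coords_distinct)
    next
      case 3
      then show ?thesis
        unfolding u using fin that by (simp, intro rep_rmul_Nil) auto
    qed
  qed
  have "dim_vec ?u = d"
    unfolding u by simp
  note res = residual[OF y(1) this r]
  have zero: "(if t = scr i then real z / 2 ^ (p - 1) else if t = scr' i then S else 0) = 0 \<or> rv (y $ t) = 0" for t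
    using y(3,4) by auto
  show thesis
    using res(1)[OF _ zero] res(2)[OF _ zero] zS y(3,4) i coords_less(4,5)[OF i(1)]
    by (intro that[of z S]) (auto simp: coords_distinct)
qed

lemma past_attention_step:
  assumes D: "dkey D = 1" "dval D = 2" and y: "finv d y" "rv (y $ 0) = 1" "rv (y $ scr i) = 0"
    and i: "i < N" "j < N" "j' < N" "j \<noteq> j'"
    and xs: "\<forall>x \<in> set xs. finv d x \<and> rv (x $ 0) = 1 \<and> (rv (x $ feat j) = 0 \<or> rv (x $ feat j) = 1) \<and>
      (rv (x $ feat j') = 0 \<or> rv (x $ feat j') = 1) \<and> (rv (x $ feat j) = 0 \<or> rv (x $ feat j') = 0)"
    and uniq: "length (filter (\<lambda>x. rv (x $ feat j') = 1) xs) \<le> 1"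
  shows "finv d (radd (multi_row D (past_mha i j j') xs c y) y)"
    and "\<And>t. t < d \<Longrightarrow> rv (radd (multi_row D (past_mha i j j') xs c y) y $ t) = (if t = scr i then
      of_bool ((\<forall>x \<in> set xs. rv (x $ feat j) = 0) \<and> (\<exists>x \<in> set xs. rv (x $ feat j') = 1)) else rv (y $ t))"
proof -
  let ?H = "past_head d (feat j) (feat j')"
  let ?b = "of_bool ((\<forall>x \<in> set xs. rv (x $ feat j) = 0) \<and> (\<exists>x \<in> set xs. rv (x $ feat j') = 1)) :: real"
  let ?o = "vec 2 (($) (head_row D ?H xs c y))"
  let ?u = "multi_row D (past_mha i j j') xs c y"
  have j: "0 < feat j" "feat j < d" "0 < feat j'" "feat j' < d" "feat j \<noteq> feat j'"
    using i coords_less coords_distinct by auto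
  note h = past_head_row[OF D(1) y(1,2) j xs uniq, of c]
  have fin: "finv 2 ?o"
    using h by (rule finv_2)
  have ov: "rv (?o $ 0) = ?b"
    using rv_rep[OF h(1)] by simp
  have u: "?u = rmul ?o (smat 2 d (\<lambda>t. if t = scr i then [(0, 1)] else []))"
    unfolding past_mha_def multi_row_single[OF D(2)] ..
  have r: "rep (?u $ t) (if t = scr i then ?b else 0)" if "t < d" for t
  proof (cases "t = scr i")
    case True
    then have "rep (?u $ t) (1 * rv (?o $ 0))"
      unfolding u using fin that representable_1 rep_representable[OF finvD[OF fin, of 0]]
      by (intro rep_rmul_single) auto
    then show ?thesis
      unfolding ov using True by simp
  next
    case False
    then show ?thesis
      unfolding u using fin that by (simp, intro rep_rmul_Nil) auto
  qed
  have "dim_vec ?u = d"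
    unfolding u by simp
  note res = residual[OF y(1) this r]
  have zero: "(if t = scr i then ?b else 0) = 0 \<or> rv (y $ t) = 0" for t
    using y(3) by auto
  show "finv d (radd ?u y)"
    using res(1)[OF _ zero] by simp
  show "rv (radd ?u y $ t) = (if t = scr i then ?b else rv (y $ t))" if "t < d" for t
    using res(2)[OF _ zero that] y(3) by (cases "t = scr i") simp_all
qed

text \<open>Only the clipped values \<open>max 0 (v h)\<close> must be integers. A hidden unit may
  be inexact as long as the error disappears in the ReLU, which happens for the unit that tests for
  a zero count.\<close>

lemma unit_mlp_step:
  assumes y: "finv d y" and t: "t < d" "r = 0 \<or> rv (y $ t) = 0"
    and v: "\<And>h. h < 4 \<Longrightarrow> rep (fadd p q (rmul y (smat d 4 (\<lambda>h. fst (g h))) $ h) (flo (fst (snd (g h))))) (v h)"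
    and int: "\<And>h. h < 4 \<Longrightarrow> \<exists>n::int. max 0 (v h) = of_int n"
    and c: "\<And>h. h < 4 \<Longrightarrow> snd (snd (g h)) \<in> {- 1, 0, 1}"
    and bound: "(\<Sum>h<4. \<bar>max 0 (v h)\<bar>) < 2 ^ p"
    and sum: "(\<Sum>h<4. snd (snd (g h)) * max 0 (v h)) = r"
  shows "finv d (radd (mlp_row (unit_mlp t g) y) y)"
    and "\<And>u. u < d \<Longrightarrow> rv (radd (mlp_row (unit_mlp t g) y) y $ u) = (if u = t then r else 0) + rv (y $ u)"
proof -
  define x where "x = map_vec frelu (radd (rmul y (smat d 4 (\<lambda>h. fst (g h)))) (vec 4 (\<lambda>h. flo (fst (snd (g h))))))"
  define w where "w = (\<lambda>u. if u = t then map (\<lambda>h. (h, snd (snd (g h)))) [0..<4] else [])"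
  have x4: "rep (x $ h) (max 0 (v h))" if "h < 4" for h
    using rep_frelu[OF v[OF that]] that by (simp add: x_def radd_def)
  have fin: "finv 4 x"
    using x4 rv_rep[OF x4] by (simp add: finv_def) (simp add: x_def radd_def)
  have mlp: "mlp_row (unit_mlp t g) y = radd (rmul x (smat 4 d w)) (vec d (\<lambda>_. fzero False))"
    by (simp add: mlp_row_def unit_mlp_def x_def w_def)
  have upt4: "[0..<4] = [0, 1, 2, 3 :: nat]"
    by (simp add: upt_rec)
  have four: "{..<4} = {0, 1, 2, 3 :: nat}"
    by auto
  have r: "rep (rmul x (smat 4 d w) $ u) (if u = t then r else 0)" if "u < d" for u
  proof (cases "u = t")
    case False
    then show ?thesis
      using rep_rmul_Nil[OF fin that, of w] by (simp add: w_def)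
  next
    case True
    have coef: "coef (w u) k = (if k < 4 then snd (snd (g k)) else 0)" for k
    proof (cases "k < 4")
      case True
      then have "k = 0 \<or> k = 1 \<or> k = 2 \<or> k = 3"
        by arith
      then show ?thesis
        using \<open>u = t\<close> by (auto simp: w_def upt4)
    next
      case False
      then show ?thesis
        using \<open>u = t\<close> by (simp add: w_def upt4)
    qed
    have "rep (rmul x (smat 4 d w) $ u) (\<Sum>(j, c) \<leftarrow> w u. c * rv (x $ j))"
    proof (rule rep_rmul[OF fin that unit_1])
      show "representable (coef (w u) k)" for k
        unfolding coef using c[of k] representable_1 by auto
      show "\<forall>(j, c) \<in> set (w u). j < 4"
        using True by (auto simp: w_def)
      show "\<forall>(j, c) \<in> set (w u). \<exists>n::int. c * rv (x $ j) = of_int n * 1"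
      proof safe
        fix j b
        assume "(j, b) \<in> set (w u)"
        then have j: "j < 4" "b = snd (snd (g j))"
          using True by (auto simp: w_def)
        obtain n :: int where n: "rv (x $ j) = of_int n"
          using int[OF j(1)] rv_rep[OF x4[OF j(1)]] by auto
        have "b = - 1 \<or> b = 0 \<or> b = 1"
          using c[OF j(1)] j(2) by auto
        then show "\<exists>n::int. b * rv (x $ j) = of_int n * 1"
          using n by (elim disjE) (auto intro: exI[of _ "- n"] exI[of _ 0] exI[of _ n])
      qed
      have "(\<Sum>(j, c) \<leftarrow> w u. \<bar>c * rv (x $ j)\<bar>) = (\<Sum>h<4. \<bar>snd (snd (g h)) * max 0 (v h)\<bar>)"
        using True rv_rep[OF x4] by (simp add: w_def upt4 four)
      also have "\<dots> \<le> (\<Sum>h<4. \<bar>max 0 (v h)\<bar>)"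
        using c by (intro sum_mono) (force simp: abs_mult)
      finally have le: "(\<Sum>(j, c) \<leftarrow> w u. \<bar>c * rv (x $ j)\<bar>) \<le> (\<Sum>h<4. \<bar>max 0 (v h)\<bar>)" .
      \<comment> \<open>Integrality sharpens the strict bound \<open>2 ^ p\<close> to
        \<open>2 ^ p - 1\<close>, the size of the grid in \<open>unit_1\<close>.\<close>
      have "\<exists>n::int. (\<Sum>h<4. \<bar>max 0 (v h)\<bar>) = of_int n"
      proof -
        obtain n0 n1 n2 n3 :: int where "max 0 (v 0) = of_int n0" "max 0 (v 1) = of_int n1"
          "max 0 (v 2) = of_int n2" "max 0 (v 3) = of_int n3"
          using int[of 0] int[of 1] int[of 2] int[of 3] by auto
        then show ?thesis
          unfolding four by (intro exI[of _ "\<bar>n0\<bar> + \<bar>n1\<bar> + \<bar>n2\<bar> + \<bar>n3\<bar>"]) simp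
      qed
      then obtain n :: int where n: "(\<Sum>h<4. \<bar>max 0 (v h)\<bar>) = of_int n"
        by blast
      then have "of_int n < (of_int (2 ^ p) :: real)"
        using bound by simp
      then have "n \<le> 2 ^ p - 1"
        by (simp only: of_int_less_iff)
      then have "of_int n \<le> (of_int (2 ^ p - 1) :: real)"
        by (rule iffD2[OF of_int_le_iff])
      then show "(\<Sum>(j, c) \<leftarrow> w u. \<bar>c * rv (x $ j)\<bar>) \<le> real (2 ^ p - 1) * 1"
        using le n by (simp add: of_nat_diff)
    qed
    moreover have "(\<Sum>(j, c) \<leftarrow> w u. c * rv (x $ j)) = r"
      unfolding sum[symmetric] using True rv_rep[OF x4] by (simp add: w_def upt4 four)
    ultimately show ?thesis
      using True by simp
  qed
  have "rep (mlp_row (unit_mlp t g) y $ u) (if u = t then r else 0)" if "u < d" for u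
    unfolding mlp using rep_fadd[OF r[OF that] rep_fzero[of False]] rep_representable[OF r[OF that]] that
    by (simp add: radd_def)
  moreover have "dim_vec (mlp_row (unit_mlp t g) y) = d"
    unfolding mlp by (simp add: radd_def)
  ultimately show "finv d (radd (mlp_row (unit_mlp t g) y) y)"
    "\<And>u. u < d \<Longrightarrow> rv (radd (mlp_row (unit_mlp t g) y) y $ u) = (if u = t then r else 0) + rv (y $ u)"
    using residual[OF y, of "mlp_row (unit_mlp t g) y" "\<lambda>u. if u = t then r else 0"] t(2) by auto
qed

end

section \<open>Correctness of the gates\<close>

context compilation
begin

lemma coords_nonzero:
  "0 \<noteq> feat i" "0 \<noteq> scr i" "0 \<noteq> scr' i" "Suc 0 \<noteq> feat i" "Suc 0 \<noteq> scr i" "Suc 0 \<noteq> scr' i"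
  by (auto simp: coord_defs)

lemma representable_pm1: "b \<in> {- 1, 0, 1} \<Longrightarrow> representable b"
  using representable_1 by auto

text \<open>All pre-activations of Boolean gates lie in {-1, 0, 1}, where the ReLU is the indicator
  of 1.\<close>

lemma only_step:
  assumes y: "finv d y" and t: "t < d" and b: "b \<in> {- 1, 0, 1}"
    and ps: "\<forall>(j, c) \<in> set ps. j < d \<and> (rv (y $ j) = 0 \<or> rv (y $ j) = 1) \<and> c \<in> {- 1, 1}" "length ps \<le> 2"
    and v: "(\<Sum>(j, c) \<leftarrow> ps. c * rv (y $ j)) + b = v" "v \<in> {- 1, 0, 1}" "v \<noteq> 1 \<or> rv (y $ t) = 0"
  shows "finv d (radd (mlp_row (unit_mlp t (only ps b)) y) y)"
    and "\<And>u. u < d \<Longrightarrow> rv (radd (mlp_row (unit_mlp t (only ps b)) y) y $ u) =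
      (if u = t then of_bool (v = 1) else 0) + rv (y $ u)"
proof -
  let ?W = "smat d 4 (\<lambda>h. fst (only ps b h))"
  have "real (length ps) \<le> real (2 ^ p - 1)"
    using \<kappa>_less ps(2) by (intro of_nat_mono) simp
  note big = this
  have lin: "rep (rmul y ?W $ h) (if h = 0 then (\<Sum>(j, c) \<leftarrow> ps. c * rv (y $ j)) else 0)" if "h < 4" for h
  proof (cases "h = 0")
    case True
    have "rep (rmul y ?W $ h) (\<Sum>(j, c) \<leftarrow> fst (only ps b h). c * rv (y $ j))"
    proof (rule rep_rmul_bool[OF y that unit_1])
      show "\<forall>(j, c) \<in> set (fst (only ps b h)). j < d \<and> (rv (y $ j) = 0 \<or> rv (y $ j) = 1) \<and> (\<exists>n::int. c = of_int n * 1)"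
      proof safe
        fix j c
        assume "(j, c) \<in> set (fst (only ps b h))"
        then have "j < d \<and> (rv (y $ j) = 0 \<or> rv (y $ j) = 1) \<and> c \<in> {- 1, 1}"
          using ps(1) True by (auto simp: only_def)
        then show "j < d" "\<exists>n::int. c = of_int n * 1" "rv (y $ j) \<noteq> 1 \<Longrightarrow> rv (y $ j) = 0"
          by (auto intro: exI[of _ "- 1"] exI[of _ 1])
      qed
      have "(\<Sum>(j, c) \<leftarrow> ps. \<bar>c\<bar>) = (\<Sum>_ \<leftarrow> ps. 1)"
        using ps(1) by (intro arg_cong[of _ _ sum_list] map_cong) auto
      also have "\<dots> = real (length ps)"
        by (simp add: sum_list_triv)
      finally have "(\<Sum>(j, c) \<leftarrow> ps. \<bar>c\<bar>) \<le> real (2 ^ p - 1)"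
        using big by linarith
      moreover have "fst (only ps b h) = ps"
        using True by (simp add: only_def)
      ultimately show "(\<Sum>(j, c) \<leftarrow> fst (only ps b h). \<bar>c\<bar>) \<le> real (2 ^ p - 1) * 1"
        by (simp only: mult_1_right)
    qed
    then show ?thesis
      using True by (simp add: only_def)
  next
    case False
    then show ?thesis
      using rep_rmul_Nil[OF y that, of "\<lambda>h. fst (only ps b h)"] by (simp add: only_def)
  qed
  have vh: "rep (fadd p q (rmul y ?W $ h) (flo (fst (snd (only ps b h))))) (if h = 0 then v else 0)" if "h < 4" for h
  proof (cases "h = 0")
    case True
    then show ?thesis
      using rep_fadd[OF lin[OF that] rep_flo[OF representable_pm1[OF b]]] representable_pm1[OF v(2)] v(1)
      by (simp add: only_def)
  next
    case False
    then show ?thesis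
      using rep_fadd[OF lin[OF that] rep_flo[OF representable_0]] by (simp add: only_def)
  qed
  have four: "{..<4} = {0, 1, 2, 3 :: nat}"
    by auto
  have r: "(\<Sum>h<4. snd (snd (only ps b h)) * max 0 (if h = 0 then v else 0)) = of_bool (v = 1)"
    using v(2) unfolding four by (auto simp: only_def)
  have *: "\<exists>n::int. max 0 (if h = 0 then v else 0) = of_int n" for h :: nat
    using v(2) by (auto intro: exI[of _ 0] exI[of _ 1])
  have "(\<Sum>h<4. \<bar>max 0 (if h = (0::nat) then v else 0)\<bar>) \<le> 1"
    using v(2) unfolding four by auto
  moreover have "(1::real) < 2 ^ p"
    using p_pos by (simp add: one_less_power)
  ultimately have bound: "(\<Sum>h<4. \<bar>max 0 (if h = (0::nat) then v else 0)\<bar>) < 2 ^ p"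
    by linarith
  have t': "of_bool (v = 1) = (0::real) \<or> rv (y $ t) = 0"
    using v(3) by auto
  note step = unit_mlp_step[OF y t t' vh * _ bound r]
  have c: "snd (snd (only ps b h)) \<in> {- 1, 0, 1}" for h
    by (simp add: only_def)
  show "finv d (radd (mlp_row (unit_mlp t (only ps b)) y) y)"
    "\<And>u. u < d \<Longrightarrow> rv (radd (mlp_row (unit_mlp t (only ps b)) y) y $ u) =
      (if u = t then of_bool (v = 1) else 0) + rv (y $ u)"
    using step c by blast+
qed

text \<open>The contract between counting head and gate: \<open>m\<close> is the true count,
  \<open>z\<close> the rounded one, and \<open>S\<close> tells whether \<open>m\<close> is positive.
  Above the threshold \<open>z\<close> may be 0 or large, but never between 1 and
  \<open>k - 1\<close>.\<close>

definition counted :: "nat \<Rightarrow> nat \<Rightarrow> nat \<Rightarrow> real \<Rightarrow> bool" where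
  "counted k m z S \<longleftrightarrow> z \<le> \<kappa> + 2 \<and> (m = 0 \<longrightarrow> z = 0 \<and> S = 0) \<and> (1 \<le> m \<longrightarrow> 1 \<le> S) \<and>
     (1 \<le> m \<longrightarrow> m < k \<longrightarrow> 1 \<le> z \<and> z < k) \<and> (k \<le> m \<longrightarrow> z = 0 \<or> k \<le> z)"

lemma count_gates_step:
  assumes y: "finv d y" and i: "i < N" and k: "1 \<le> k" "k \<le> \<kappa>"
    and z: "rv (y $ scr i) = real z / 2 ^ (p - 1)" "rv (y $ scr' i) = S" "counted k m z S"
    and t: "rv (y $ feat i) = 0"
  shows "finv d (radd (mlp_row (unit_mlp (feat i) (gates dc i (Fm (GPre k \<phi>)))) y) y)"
    and "\<And>u. u < d \<Longrightarrow> rv (radd (mlp_row (unit_mlp (feat i) (gates dc i (Fm (GPre k \<phi>)))) y) y $ u) =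
      (if u = feat i then of_bool (k \<le> m) else 0) + rv (y $ u)"
proof -
  define g where "g = gates dc i (Fm (GPre k \<phi>))"
  let ?W = "smat d 4 (\<lambda>h. fst (g h))"
  have g: "g 0 = ([(scr' i, - 1)], 1, - 1)" "g 1 = ([(scr i, - (2 ^ (p - 1)))], 1, 1)"
    "g 2 = ([(scr i, 2 ^ (p - 1))], 1 - real k, 1)" "g 3 = ([(scr i, 2 ^ (p - 1))], - real k, - 1)"
    using k by (simp_all add: g_def)
  have l4: "h = 0 \<or> h = 1 \<or> h = 2 \<or> h = 3" if "h < 4" for h :: nat
    using that by arith
  have d: "scr i < d" "scr' i < d"
    using coords_less i by auto
  have zk: "z \<le> \<kappa> + 2"
    using z(3) by (simp add: counted_def)
  have rz: "representable (of_int n)" if "\<bar>n\<bar> \<le> int (2 * \<kappa> + 3)" for n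
  proof (rule representable_int)
    have "int (64 * \<kappa> + 128) \<le> int (2 ^ p)"
      using \<kappa>_less by (rule iffD2[OF of_nat_le_iff])
    then show "\<bar>n\<bar> < 2 ^ p"
      using that by simp
  qed
  have Sr: "representable S"
    using rep_representable[OF finvD[OF y d(2)]] z(2) by simp
  have l0: "rep (rmul y ?W $ 0) (- S)"
    using rep_rmul_single[OF y, of 0 4 "\<lambda>h. fst (g h)" "scr' i" "- 1"] g(1) d(2) z(2) Sr representable_1 by simp
  have p2: "representable (2 ^ (p - 1))"
    by (rule representable_two_pow) simp
  have rzz: "representable (real z)"
    using rz[of "int z"] zk by simp
  have l1: "rep (rmul y ?W $ 1) (- real z)"
    using rep_rmul_single[OF y, of 1 4 "\<lambda>h. fst (g h)" "scr i" "- (2 ^ (p - 1))"] g(2) d(1) z(1) p2 rzz by simp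
  have l2: "rep (rmul y ?W $ 2) (real z)"
    using rep_rmul_single[OF y, of 2 4 "\<lambda>h. fst (g h)" "scr i" "2 ^ (p - 1)"] g(3) d(1) z(1) p2 rzz by simp
  have l3: "rep (rmul y ?W $ 3) (real z)"
    using rep_rmul_single[OF y, of 3 4 "\<lambda>h. fst (g h)" "scr i" "2 ^ (p - 1)"] g(4) d(1) z(1) p2 rzz by simp
  \<comment> \<open>For positive counts \<open>S\<close> may be so large that \<open>1 - S\<close>
    is rounded, but the result stays non-positive and is clipped to 0.\<close>
  have "\<exists>v0. rep (fadd p q (rmul y ?W $ 0) (flo 1)) v0 \<and> max 0 v0 = of_bool (m = 0)"
  proof (cases "m = 0")
    case True
    then have "S = 0"
      using z(3) by (simp add: counted_def)
    then show ?thesis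
      using rep_fadd[OF l0 rep_flo[OF representable_1]] representable_1 True by (intro exI[of _ 1]) simp
  next
    case False
    then have S1: "1 \<le> S"
      using z(3) by (simp add: counted_def)
    show ?thesis
    proof (cases "S = 1")
      case True
      then show ?thesis
        using rep_fadd[OF l0 rep_flo[OF representable_1]] False by (intro exI[of _ 0]) simp
    next
      case S: False
      then have eq: "fadd p q (rmul y ?W $ 0) (flo 1) = fround p q True (S - 1)"
        using fadd_eq_fround[OF l0 rep_flo[OF representable_1]] S1 by simp
      obtain e s where "fl_ok p q e s" "\<bar>S\<bar> = mag p q e s"
        using Sr by (auto simp: representable_def)
      then have "S - 1 < overflow_bound p q"
        using mag_less_overflow[of e s] by linarith
      then obtain r' where "rep (fround p q True (S - 1)) (- r')" "0 \<le> r'"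
        using rep_fround_approx[of "S - 1" True] S1 by (metis (full_types) diff_ge_0_iff_ge)
      then show ?thesis
        using eq False by (intro exI[of _ "- r'"]) simp
    qed
  qed
  then obtain v0 where v0: "rep (fadd p q (rmul y ?W $ 0) (flo 1)) v0" "max 0 v0 = of_bool (m = 0)"
    by blast
  define v where "v = (\<lambda>h::nat. if h = 0 then v0 else if h = 1 then 1 - real z else if h = 2 then real z + (1 - real k) else real z - real k)"
  have vs: "v 0 = v0" "v 1 = 1 - real z" "v 2 = real z + (1 - real k)" "v 3 = real z - real k"
    by (simp_all add: v_def)
  have ints: "1 - real z = of_int (1 - int z)" "real z + (1 - real k) = of_int (int z + 1 - int k)"
    "real z - real k = of_int (int z - int k)" "1 - real k = of_int (1 - int k)" "- real k = of_int (- int k)"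
    by simp_all
  have vh: "rep (fadd p q (rmul y ?W $ h) (flo (fst (snd (g h))))) (v h)" if "h < 4" for h
    using l4[OF that]
  proof (elim disjE)
    assume h: "h = 0"
    show ?thesis
      unfolding h vs using v0(1) by (simp add: g)
  next
    assume h: "h = 1"
    have "representable (- real z + 1)"
      using rz[of "1 - int z"] zk by simp
    then show ?thesis
      unfolding h vs using rep_fadd[OF l1 rep_flo[OF representable_1]] by (simp add: g del: One_nat_def)
  next
    assume h: "h = 2"
    have r: "representable (real z + (1 - real k))"
      unfolding ints(2) by (rule rz) (use zk k in simp)
    have r': "representable (1 - real k)"
      unfolding ints(4) by (rule rz) (use k in simp)
    show ?thesis
      unfolding h vs using rep_fadd[OF l2 rep_flo[OF r']] r by (simp add: g)
  next
    assume h: "h = 3"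
    have r: "representable (real z - real k)"
      unfolding ints(3) by (rule rz) (use zk k in simp)
    have r': "representable (- real k)"
      unfolding ints(5) by (rule rz) (use k in simp)
    show ?thesis
      unfolding h vs using rep_fadd[OF l3 rep_flo[OF r']] r by (simp add: g)
  qed
  have int: "\<exists>n::int. max 0 (v h) = of_int n" if "h < 4" for h
  proof -
    have "\<exists>n::int. max 0 (v 0) = of_int n"
      unfolding vs v0(2) by (intro exI[of _ "of_bool (m = 0)"]) simp
    moreover have "\<exists>n::int. max 0 (of_int a :: real) = of_int n" for a
      by (intro exI[of _ "max 0 a"]) (simp add: max_def)
    ultimately show ?thesis
      using l4[OF that] vs ints by metis
  qed
  have c: "snd (snd (g h)) \<in> {- 1, 0, 1}" if "h < 4" for h
    using l4[OF that] by (elim disjE) (simp_all add: g del: One_nat_def)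
  have four: "{..<4} = {0, 1, 2, 3 :: nat}"
    by auto
  have "(\<Sum>h<4. \<bar>max 0 (v h)\<bar>) \<le> real (2 * \<kappa> + 8)"
  proof -
    have "real z \<le> real \<kappa> + 2" "1 \<le> real k"
      using zk k by simp_all
    then have "max 0 (v 0) \<le> 1" "max 0 (v 1) \<le> 1" "max 0 (v 2) \<le> real \<kappa> + 2" "max 0 (v 3) \<le> real \<kappa> + 2"
      unfolding vs v0(2) by auto
    then show ?thesis
      unfolding four by (simp del: One_nat_def)
  qed
  also have "\<dots> < real (2 ^ p)"
    using \<kappa>_less by (intro iffD2[OF of_nat_less_iff]) simp
  finally have bound: "(\<Sum>h<4. \<bar>max 0 (v h)\<bar>) < 2 ^ p"
    by simp
  \<comment> \<open>For \<open>m = 0\<close> the units for [m = 0] and [z = 0] cancel. Otherwise the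
    result is [z = 0] + [z \<ge> k], and the two cannot both hold as
    \<open>k \<ge> 1\<close>.\<close>
  have "snd (snd (g 0)) * max 0 (v 0) + snd (snd (g 1)) * max 0 (v 1) + snd (snd (g 2)) * max 0 (v 2) +
      snd (snd (g 3)) * max 0 (v 3) = of_bool (k \<le> m)"
  proof -
    consider "m = 0" | "1 \<le> m" "m < k" | "k \<le> m" "1 \<le> m" "z = 0" | "k \<le> m" "1 \<le> m" "k \<le> z"
      using z(3) k unfolding counted_def by linarith
    then show ?thesis
    proof cases
      case 1
      then show ?thesis
        using z(3) k by (simp add: counted_def vs v0(2) g del: One_nat_def)
    next
      case 2
      then have "1 \<le> z" "z < k"
        using z(3) by (auto simp: counted_def)
      then show ?thesis
        using 2 by (simp add: vs v0(2) g del: One_nat_def)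
    next
      case 3
      then show ?thesis
        using k by (simp add: vs v0(2) g del: One_nat_def)
    next
      case 4
      then show ?thesis
        using k by (simp add: vs v0(2) g del: One_nat_def)
    qed
  qed
  then have r: "(\<Sum>h<4. snd (snd (g h)) * max 0 (v h)) = of_bool (k \<le> m)"
    unfolding four by (simp add: add.assoc del: One_nat_def)
  note step = unit_mlp_step[OF y coords_less(3)[OF i] disjI2[OF t] vh int c bound r]
  show "finv d (radd (mlp_row (unit_mlp (feat i) (gates dc i (Fm (GPre k \<phi>)))) y) y)"
    "\<And>u. u < d \<Longrightarrow> rv (radd (mlp_row (unit_mlp (feat i) (gates dc i (Fm (GPre k \<phi>)))) y) y $ u) =
      (if u = feat i then of_bool (k \<le> m) else 0) + rv (y $ u)"
    using step unfolding g_def by blast+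
qed

text \<open>The part common to encoder and decoder. The attention sublayers enter only through what
  they left in the scratch coordinates of node \<open>i\<close>, all other coordinates being
  unchanged.\<close>

lemma layer_mlp_step:
  assumes i: "i < N" and x: "Inv i G v x" and y: "finv d y"
    and agree: "\<And>t. t < d \<Longrightarrow> t \<noteq> scr i \<Longrightarrow> t \<noteq> scr' i \<Longrightarrow> rv (y $ t) = rv (x $ t)"
    and count: "\<And>k \<phi>. ns ! i = Fm (GPre k \<phi>) \<Longrightarrow> 1 \<le> k \<Longrightarrow>
      \<exists>z. rv (y $ scr i) = real z / 2 ^ (p - 1) \<and> counted k (card {u. u < bos G \<and> sat G u \<phi>}) z (rv (y $ scr' i))"
    and past: "\<And>\<phi>. ns ! i = Fm (PSuf \<phi>) \<Longrightarrow> dc \<Longrightarrow> rv (y $ scr i) = of_bool (\<not> sat G v (PSuf \<phi>) \<and> v \<noteq> bos G)"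
    and pre: "\<not> dc \<Longrightarrow> v < bos G"
  shows "Inv (Suc i) G v (radd (mlp_row (unit_mlp (feat i) (gates dc i (ns ! i))) y) y)"
proof -
  let ?y' = "radd (mlp_row (unit_mlp (feat i) (gates dc i (ns ! i))) y) y"
  have fi: "feat i < d"
    using coords_less i by simp
  have feat: "rv (y $ feat t) = of_bool (node_sat G v (ns ! t) \<and> (t < i \<or> atomic (ns ! t)))" if "t < N" for t
    using agree[of "feat t"] InvD(4)[OF x that] coords_less(3)[OF that] by (simp add: coords_distinct)
  have y0: "rv (y $ 0) = 1" and y1: "rv (y $ 1) = of_bool (v = bos G)"
    using agree[of 0] agree[of 1] InvD(2,3)[OF x] coords_less by (simp_all add: coords_nonzero)
  have dep: "ix n < N \<and> rv (y $ feat (ix n)) = of_bool (node_sat G v n)" if "n \<in> set (deps (ns ! i))" for n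
    using ix_dep[OF i that] feat[of "ix n"] i by auto
  have self: "rv (y $ feat i) = 0" if "\<not> atomic (ns ! i)"
    using feat[OF i] that by simp
  have main: "finv d ?y' \<and> (\<forall>u < d. rv (?y' $ u) =
      (if u = feat i then of_bool (node_sat G v (ns ! i) \<and> \<not> atomic (ns ! i)) else 0) + rv (y $ u))"
  proof (cases "ns ! i")
    case (BosNot \<phi>)
    have j: "ix (Fm \<phi>) < N" "rv (y $ feat (ix (Fm \<phi>))) = of_bool (sat G v \<phi>)"
      using dep[of "Fm \<phi>"] by (auto simp: BosNot)
    note s = only_step[OF y fi, of 0 "[(1, 1), (feat (ix (Fm \<phi>)), - 1)]" "of_bool (v = bos G) - of_bool (sat G v \<phi>)"]
    have "of_bool (v = bos G) - of_bool (sat G v \<phi>) = (1::real) \<longleftrightarrow> v = bos G \<and> \<not> sat G v \<phi>"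
      by auto
    then show ?thesis
      using s self j y1 coords_less by (auto simp: BosNot atomic_def)
  next
    case (Fm \<psi>)
    show ?thesis
    proof (cases \<psi>)
      case Bot
      then show ?thesis
        using only_step[OF y fi, of 0 "[]" 0] by (auto simp: Fm)
    next
      case (Prop a)
      then show ?thesis
        using only_step[OF y fi, of 0 "[]" 0] by (auto simp: Fm atomic_def)
    next
      case (Neg \<phi>)
      have j: "ix (Fm \<phi>) < N" "rv (y $ feat (ix (Fm \<phi>))) = of_bool (sat G v \<phi>)"
        using dep[of "Fm \<phi>"] by (auto simp: Fm Neg)
      note s = only_step[OF y fi, of 1 "[(feat (ix (Fm \<phi>)), - 1)]" "1 - of_bool (sat G v \<phi>)"]
      show ?thesis
        using s self j coords_less by (auto simp: Fm Neg atomic_def)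
    next
      case (Conj \<phi> \<chi>)
      have j: "ix (Fm \<phi>) < N" "rv (y $ feat (ix (Fm \<phi>))) = of_bool (sat G v \<phi>)"
        "ix (Fm \<chi>) < N" "rv (y $ feat (ix (Fm \<chi>))) = of_bool (sat G v \<chi>)"
        using dep[of "Fm \<phi>"] dep[of "Fm \<chi>"] by (auto simp: Fm Conj)
      note s = only_step[OF y fi, of "- 1" "[(feat (ix (Fm \<phi>)), 1), (feat (ix (Fm \<chi>)), 1)]"
          "of_bool (sat G v \<phi>) + of_bool (sat G v \<chi>) - 1"]
      show ?thesis
        using s self j coords_less by (auto simp: Fm Conj atomic_def)
    next
      case (GPre k \<phi>)
      show ?thesis
      proof (cases "k = 0")
        case True
        then show ?thesis
          using only_step[OF y fi, of 1 "[]" 1] self by (auto simp: Fm GPre atomic_def)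
      next
        case False
        then have k: "1 \<le> k" "k \<le> \<kappa>"
          using \<kappa>_GPre[of k \<phi>] i Fm GPre nth_mem[OF i] by auto
        obtain z where z: "rv (y $ scr i) = real z / 2 ^ (p - 1)"
          "counted k (card {u. u < bos G \<and> sat G u \<phi>}) z (rv (y $ scr' i))"
          using count k Fm GPre by blast
        have at: "\<not> atomic (ns ! i)"
          by (simp add: Fm GPre atomic_def)
        have "{u \<in> prefix_vertices G. sat G u \<phi>} = {u. u < bos G \<and> sat G u \<phi>}"
          by (auto simp: prefix_vertices_def)
        then have "node_sat G v (ns ! i) \<longleftrightarrow> k \<le> card {u. u < bos G \<and> sat G u \<phi>}"
          by (simp add: Fm GPre)
        then show ?thesis
          using count_gates_step[OF y i k z(1) refl z(2) self[OF at], where dc = dc and \<phi> = \<phi>] at unfolding Fm GPre by simp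
      qed
    next
      case (PSuf \<phi>)
      show ?thesis
      proof (cases dc)
        case True
        \<comment> \<open>At BOS nothing precedes in the suffix; the bias 1 is cancelled by the BOS
          flag and the pre-activation is 0.\<close>
        have "\<not> sat G v (PSuf \<phi>)" if "v = bos G"
          using that by (auto simp: suffix_vertices_def)
        moreover note s = only_step[OF y fi, of 1 "[(scr i, - 1), (1, - 1)]" "of_bool (sat G v (PSuf \<phi>))"]
        ultimately show ?thesis
          using past[of \<phi>] True self y1 coords_less i
          by (cases "v = bos G") (auto simp: Fm PSuf atomic_def simp del: sat.simps)
      next
        case False
        \<comment> \<open>An encoder vertex lies before every suffix vertex, so the constant gate 0
          is right.\<close>
        have "\<not> sat G v (PSuf \<phi>)"
          using pre[OF False] by (auto simp: suffix_vertices_def)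
        then show ?thesis
          using only_step[OF y fi, of 0 "[]" 0] False by (auto simp: Fm PSuf simp del: sat.simps)
      qed
    qed
  qed
  then have fin: "finv d ?y'" and val: "\<And>u. u < d \<Longrightarrow> rv (?y' $ u) =
      (if u = feat i then of_bool (node_sat G v (ns ! i) \<and> \<not> atomic (ns ! i)) else 0) + rv (y $ u)"
    by auto
  show ?thesis
    unfolding Inv_def
  proof (intro conjI allI impI)
    show "finv d ?y'"
      by (rule fin)
    show "rv (?y' $ 0) = 1" "rv (?y' $ 1) = of_bool (v = bos G)"
      using val[of 0] val[of 1] y0 y1 coords_less by (simp_all add: coords_nonzero)
    show "rv (?y' $ feat t) = of_bool (node_sat G v (ns ! t) \<and> (t < Suc i \<or> atomic (ns ! t)))" if "t < N" for t
      using val[OF coords_less(3)[OF that]] feat[OF that] by (cases "t = i") (auto simp: coords_distinct less_Suc_eq)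
    show "rv (?y' $ scr t) = 0" if "t < N" "Suc i \<le> t" for t
      using val[OF coords_less(4)[OF that(1)]] agree[OF coords_less(4)[OF that(1)]] InvD(5)[OF x that(1)] that
      by (simp add: coords_distinct)
    show "rv (?y' $ scr' t) = 0" if "t < N" "Suc i \<le> t" for t
      using val[OF coords_less(5)[OF that(1)]] agree[OF coords_less(5)[OF that(1)]] InvD(6)[OF x that(1)] that
      by (simp add: coords_distinct)
  qed
qed

end

section \<open>The invariant through encoder and decoder\<close>

lemma length_filter_map_upt: "length (filter P (map X [a..<b])) = card {u. a \<le> u \<and> u < b \<and> P (X u)}"
proof -
  have "length (filter P (map X [a..<b])) = card (set (filter (\<lambda>u. P (X u)) [a..<b]))"
    using distinct_card[of "filter (\<lambda>u. P (X u)) [a..<b]"] by (simp add: filter_map comp_def)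
  also have "set (filter (\<lambda>u. P (X u)) [a..<b]) = {u. a \<le> u \<and> u < b \<and> P (X u)}"
    by auto
  finally show ?thesis .
qed

context compilation
begin

text \<open>In the encoder the keys are rows of the current stage, \<open>a = i\<close>; in the
  cross-attention they are rows of the finished encoder, \<open>a = N\<close>. The argument of the
  node has an index below \<open>i\<close>, so its feature is final in both. The last conclusion
  keeps the bit that a preceding self-attention wrote for \<open>PSuf\<close>.\<close>

lemma count_attention_Inv:
  assumes D: "dkey D = 1" "dval D = 2" and i: "i < N" "i \<le> a" and X: "\<forall>u < bos G. Inv a G u (X u)"
    and y: "finv d y" "rv (y $ 0) = 1"
    and scr: "\<forall>k \<phi>. ns ! i = Fm (GPre k \<phi>) \<longrightarrow> rv (y $ scr i) = 0 \<and> rv (y $ scr' i) = 0"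
    and y': "y' = radd (multi_row D (count_attention i (ns ! i)) (map X [0..<bos G]) c y) y"
  shows "finv d y'" and "\<And>t. t < d \<Longrightarrow> t \<noteq> scr i \<Longrightarrow> t \<noteq> scr' i \<Longrightarrow> rv (y' $ t) = rv (y $ t)"
    and "\<And>k \<phi>. ns ! i = Fm (GPre k \<phi>) \<Longrightarrow> 1 \<le> k \<Longrightarrow> \<exists>z. rv (y' $ scr i) = real z / 2 ^ (p - 1) \<and>
      counted k (card {u. u < bos G \<and> sat G u \<phi>}) z (rv (y' $ scr' i))"
    and "\<And>t \<phi>. t < d \<Longrightarrow> ns ! i = Fm (PSuf \<phi>) \<Longrightarrow> rv (y' $ t) = rv (y $ t)"
proof -
  have xs01: "finv d (X u) \<and> rv (X u $ 0) = 1 \<and> (rv (X u $ 1) = 0 \<or> rv (X u $ 1) = 1)" if "u < bos G" for u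
    using InvD(1-3)[OF X[rule_format, OF that]] by simp
  have "finv d y' \<and> (\<forall>t < d. t \<noteq> scr i \<longrightarrow> t \<noteq> scr' i \<longrightarrow> rv (y' $ t) = rv (y $ t)) \<and>
    (\<forall>k \<phi>. ns ! i = Fm (GPre k \<phi>) \<longrightarrow> 1 \<le> k \<longrightarrow> (\<exists>z. rv (y' $ scr i) = real z / 2 ^ (p - 1) \<and>
      counted k (card {u. u < bos G \<and> sat G u \<phi>}) z (rv (y' $ scr' i)))) \<and>
    (\<forall>t < d. \<forall>\<phi>. ns ! i = Fm (PSuf \<phi>) \<longrightarrow> rv (y' $ t) = rv (y $ t))"
  proof (cases "\<exists>k \<phi>. ns ! i = Fm (GPre k \<phi>) \<and> 1 \<le> k")
    case True
    then obtain k \<phi> where n: "ns ! i = Fm (GPre k \<phi>)" and k1: "1 \<le> k"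
      by blast
    have k: "k \<le> \<kappa>"
      using \<kappa>_GPre[of k \<phi>] nth_mem[OF i(1)] n by simp
    define j where "j = ix (Fm \<phi>)"
    have j: "j < i" "ns ! j = Fm \<phi>"
      using ix_dep[OF i(1), of "Fm \<phi>"] by (auto simp: n j_def)
    have jN: "j < N"
      using j i by simp
    have feat: "rv (X u $ feat j) = of_bool (sat G u \<phi>)" if "u < bos G" for u
      using InvD(4)[OF X[rule_format, OF that] jN] j i by simp
    have xs: "\<forall>x \<in> set (map X [0..<bos G]). finv d x \<and> rv (x $ 0) = 1 \<and> (rv (x $ feat j) = 0 \<or> rv (x $ feat j) = 1)"
      using xs01 feat by auto
    have "{u. 0 \<le> u \<and> u < bos G \<and> rv (X u $ feat j) = 1} = {u. u < bos G \<and> sat G u \<phi>}"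
      using feat by auto
    then have m: "card {u. u < bos G \<and> sat G u \<phi>} = length (filter (\<lambda>x. rv (x $ feat j) = 1) (map X [0..<bos G]))"
      unfolding length_filter_map_upt by simp
    have y'': "y' = radd (multi_row D (count_mha i j k) (map X [0..<bos G]) c y) y"
      using y' n k1 by (simp add: j_def)
    obtain z S where "finv d y'" "\<And>t. t < d \<Longrightarrow> t \<noteq> scr i \<Longrightarrow> t \<noteq> scr' i \<Longrightarrow> rv (y' $ t) = rv (y $ t)"
      "rv (y' $ scr i) = real z / 2 ^ (p - 1)" "rv (y' $ scr' i) = S" "z \<le> \<kappa> + 2"
      "card {u. u < bos G \<and> sat G u \<phi>} = 0 \<Longrightarrow> z = 0 \<and> S = 0" "1 \<le> card {u. u < bos G \<and> sat G u \<phi>} \<Longrightarrow> 1 \<le> S"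
      "1 \<le> card {u. u < bos G \<and> sat G u \<phi>} \<Longrightarrow> card {u. u < bos G \<and> sat G u \<phi>} < k \<Longrightarrow> 1 \<le> z \<and> z < k"
      "k \<le> card {u. u < bos G \<and> sat G u \<phi>} \<Longrightarrow> z = 0 \<or> k \<le> z"
      using count_attention_step[OF D y conjunct1[OF scr[rule_format, OF n]] conjunct2[OF scr[rule_format, OF n]] i(1) jN k1 k xs m, where c = c]
      unfolding y'' by blast
    then show ?thesis
      using n by (auto simp: counted_def intro!: exI[of _ z])
  next
    case False
    then have null: "count_attention i (ns ! i) = null_mha"
      by (cases "(i, ns ! i)" rule: count_attention.cases) auto
    have "\<forall>x \<in> set (map X [0..<bos G]). finv d x \<and> rv (x $ 0) = 1 \<and> (rv (x $ 1) = 0 \<or> rv (x $ 1) = 1)"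
      using xs01 by auto
    note na = null_attention[OF D y this, where c = c]
    show ?thesis
      using na False unfolding y' null by auto
  qed
  then show "finv d y'" "\<And>t. t < d \<Longrightarrow> t \<noteq> scr i \<Longrightarrow> t \<noteq> scr' i \<Longrightarrow> rv (y' $ t) = rv (y $ t)"
    "\<And>k \<phi>. ns ! i = Fm (GPre k \<phi>) \<Longrightarrow> 1 \<le> k \<Longrightarrow> \<exists>z. rv (y' $ scr i) = real z / 2 ^ (p - 1) \<and>
      counted k (card {u. u < bos G \<and> sat G u \<phi>}) z (rv (y' $ scr' i))"
    "\<And>t \<phi>. t < d \<Longrightarrow> ns ! i = Fm (PSuf \<phi>) \<Longrightarrow> rv (y' $ t) = rv (y $ t)"
    by blast+
qed

text \<open>At BOS the list of earlier suffix rows is empty and the bit is 0. At later vertices BOS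
  is among the keys and receives the whole weight if \<phi> never held. The last conclusion leaves
  both scratch coordinates clear for the cross-attention of a \<open>GPre\<close> node.\<close>

lemma past_attention_Inv:
  assumes D: "dkey D = 1" "dval D = 2" and i: "i < N"
    and Y: "\<forall>u. bos G \<le> u \<and> u \<le> v \<longrightarrow> Inv i G u (Y u)" and v: "bos G \<le> v" "v < length G"
    and y': "y' = radd (multi_row D (past_attention i (ns ! i)) (map Y [bos G..<v]) c (Y v)) (Y v)"
  shows "finv d y'" and "\<And>t. t < d \<Longrightarrow> t \<noteq> scr i \<Longrightarrow> rv (y' $ t) = rv (Y v $ t)"
    and "\<And>\<phi>. ns ! i = Fm (PSuf \<phi>) \<Longrightarrow> rv (y' $ scr i) = of_bool (\<not> sat G v (PSuf \<phi>) \<and> v \<noteq> bos G)"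
    and "\<And>k \<phi> t. t < d \<Longrightarrow> ns ! i = Fm (GPre k \<phi>) \<Longrightarrow> rv (y' $ t) = rv (Y v $ t)"
proof -
  have Yv: "finv d (Y v)" "rv (Y v $ 0) = 1" "rv (Y v $ scr i) = 0"
    using InvD(1,2)[OF Y[rule_format, OF conjI[OF v(1) order_refl]]] InvD(5)[OF Y[rule_format, OF conjI[OF v(1) order_refl]] i] by auto
  have xs01: "finv d (Y u) \<and> rv (Y u $ 0) = 1 \<and> (rv (Y u $ 1) = 0 \<or> rv (Y u $ 1) = 1)" if "bos G \<le> u" "u < v" for u
    using InvD(1-3)[OF Y[rule_format, of u]] that by simp
  have "finv d y' \<and> (\<forall>t < d. t \<noteq> scr i \<longrightarrow> rv (y' $ t) = rv (Y v $ t)) \<and>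
    (\<forall>\<phi>. ns ! i = Fm (PSuf \<phi>) \<longrightarrow> rv (y' $ scr i) = of_bool (\<not> sat G v (PSuf \<phi>) \<and> v \<noteq> bos G)) \<and>
    (\<forall>t < d. \<forall>k \<phi>. ns ! i = Fm (GPre k \<phi>) \<longrightarrow> rv (y' $ t) = rv (Y v $ t))"
  proof (cases "\<exists>\<phi>. ns ! i = Fm (PSuf \<phi>)")
    case True
    then obtain \<phi> where n: "ns ! i = Fm (PSuf \<phi>)"
      by blast
    define j j' where "j = ix (Fm \<phi>)" and "j' = ix (BosNot \<phi>)"
    have j: "j < i" "ns ! j = Fm \<phi>" "j' < i" "ns ! j' = BosNot \<phi>"
      using ix_dep[OF i, of "Fm \<phi>"] ix_dep[OF i, of "BosNot \<phi>"] by (auto simp: n j_def j'_def)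
    have jN: "j < N" "j' < N" "j \<noteq> j'"
      using j i by auto
    have feat: "rv (Y u $ feat j) = of_bool (sat G u \<phi>)" "rv (Y u $ feat j') = of_bool (u = bos G \<and> \<not> sat G u \<phi>)"
      if "bos G \<le> u" "u < v" for u
      using InvD(4)[OF Y[rule_format, of u] jN(1)] InvD(4)[OF Y[rule_format, of u] jN(2)] j that by auto
    have xs: "\<forall>x \<in> set (map Y [bos G..<v]). finv d x \<and> rv (x $ 0) = 1 \<and> (rv (x $ feat j) = 0 \<or> rv (x $ feat j) = 1) \<and>
        (rv (x $ feat j') = 0 \<or> rv (x $ feat j') = 1) \<and> (rv (x $ feat j) = 0 \<or> rv (x $ feat j') = 0)"
      using xs01 feat by auto
    \<comment> \<open>Only BOS can satisfy \<open>BosNot \<phi>\<close>, which gives the uniqueness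
      that makes its weight exactly 1.\<close>
    have "{u. bos G \<le> u \<and> u < v \<and> rv (Y u $ feat j') = 1} \<subseteq> {bos G}"
      using feat by auto
    then have uniq: "length (filter (\<lambda>x. rv (x $ feat j') = 1) (map Y [bos G..<v])) \<le> 1"
      unfolding length_filter_map_upt using card_mono[of "{bos G}"] by fastforce
    have y'': "y' = radd (multi_row D (past_mha i j j') (map Y [bos G..<v]) c (Y v)) (Y v)"
      using y' n by (simp add: j_def j'_def)
    note step = past_attention_step[OF D Yv i jN xs uniq, where c = c, folded y'']
    have "((\<forall>x \<in> set (map Y [bos G..<v]). rv (x $ feat j) = 0) \<and> (\<exists>x \<in> set (map Y [bos G..<v]). rv (x $ feat j') = 1)) \<longleftrightarrow>
        (\<forall>u. bos G \<le> u \<and> u < v \<longrightarrow> \<not> sat G u \<phi>) \<and> bos G < v"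
      using feat by auto
    also have "\<dots> \<longleftrightarrow> \<not> sat G v (PSuf \<phi>) \<and> v \<noteq> bos G"
      using v by (auto simp: suffix_vertices_def)
    finally have "rv (y' $ scr i) = of_bool (\<not> sat G v (PSuf \<phi>) \<and> v \<noteq> bos G)"
      using step(2)[OF coords_less(4)[OF i]] by (simp only: simp_thms if_True)
    then show ?thesis
      using step n by (auto simp del: sat.simps)
  next
    case False
    then have null: "past_attention i (ns ! i) = null_mha"
      by (cases "(i, ns ! i)" rule: past_attention.cases) auto
    have "\<forall>x \<in> set (map Y [bos G..<v]). finv d x \<and> rv (x $ 0) = 1 \<and> (rv (x $ 1) = 0 \<or> rv (x $ 1) = 1)"
      using xs01 by auto
    note na = null_attention[OF D Yv(1,2) this, where c = c]
    show ?thesis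
      using na False unfolding y' null by auto
  qed
  then show "finv d y'" "\<And>t. t < d \<Longrightarrow> t \<noteq> scr i \<Longrightarrow> rv (y' $ t) = rv (Y v $ t)"
    "\<And>\<phi>. ns ! i = Fm (PSuf \<phi>) \<Longrightarrow> rv (y' $ scr i) = of_bool (\<not> sat G v (PSuf \<phi>) \<and> v \<noteq> bos G)"
    "\<And>k \<phi> t. t < d \<Longrightarrow> ns ! i = Fm (GPre k \<phi>) \<Longrightarrow> rv (y' $ t) = rv (Y v $ t)"
    by blast+
qed

lemma enc_row_Inv:
  assumes D: "dkey D = 1" "dval D = 2" and i: "i < N" and X: "\<forall>u < bos G. Inv i G u (X u)" and v: "v < bos G"
  shows "Inv (Suc i) G v (enc_row D (enc_layer_of i) (map X [0..<bos G]) (X v))"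
proof -
  define y' where "y' = radd (multi_row D (count_attention i (ns ! i)) (map X [0..<bos G]) 0 (X v)) (X v)"
  note Xv = X[rule_format, OF v]
  have scr: "\<forall>k \<phi>. ns ! i = Fm (GPre k \<phi>) \<longrightarrow> rv (X v $ scr i) = 0 \<and> rv (X v $ scr' i) = 0"
    using InvD(5,6)[OF Xv i] by simp
  note c = count_attention_Inv[OF D i order_refl X InvD(1,2)[OF Xv] scr y'_def]
  have "Inv (Suc i) G v (radd (mlp_row (unit_mlp (feat i) (gates False i (ns ! i))) y') y')"
    by (rule layer_mlp_step[OF i Xv]) (use c v in auto)
  then show ?thesis
    by (simp add: enc_row_def enc_layer_of_def y'_def Let_def)
qed

lemma dec_row_Inv:
  assumes D: "dkey D = 1" "dval D = 2" and i: "i < N" and X: "\<forall>u < bos G. Inv N G u (X u)"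
    and Y: "\<forall>u. bos G \<le> u \<and> u \<le> v \<longrightarrow> Inv i G u (Y u)" and v: "bos G \<le> v" "v < length G"
  shows "Inv (Suc i) G v (dec_row D (dec_layer_of i) (map X [0..<bos G]) (map Y [bos G..<v]) c (Y v))"
proof -
  define y' where "y' = radd (multi_row D (past_attention i (ns ! i)) (map Y [bos G..<v]) c (Y v)) (Y v)"
  define y'' where "y'' = radd (multi_row D (count_attention i (ns ! i)) (map X [0..<bos G]) 0 y') y'"
  note Yv = Y[rule_format, OF conjI[OF v(1) order_refl]]
  note pa = past_attention_Inv[OF D i Y v y'_def]
  have y0: "rv (y' $ 0) = 1"
    using pa(2)[of 0] InvD(2)[OF Yv] coords_less(1) by (simp add: coords_nonzero)
  have scr: "\<forall>k \<phi>. ns ! i = Fm (GPre k \<phi>) \<longrightarrow> rv (y' $ scr i) = 0 \<and> rv (y' $ scr' i) = 0"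
    using pa(4)[OF coords_less(4)[OF i]] pa(4)[OF coords_less(5)[OF i]] InvD(5,6)[OF Yv i] by simp
  have iN: "i \<le> N"
    using i by simp
  note ca = count_attention_Inv[OF D i iN X pa(1) y0 scr y''_def]
  have "Inv (Suc i) G v (radd (mlp_row (unit_mlp (feat i) (gates True i (ns ! i))) y'') y'')"
  proof (rule layer_mlp_step[OF i Yv])
    show "finv d y''"
      by (rule ca(1))
    show "rv (y'' $ t) = rv (Y v $ t)" if "t < d" "t \<noteq> scr i" "t \<noteq> scr' i" for t
      using ca(2)[OF that] pa(2)[OF that(1,2)] by simp
    show "\<exists>z. rv (y'' $ scr i) = real z / 2 ^ (p - 1) \<and>
        counted k (card {u. u < bos G \<and> sat G u \<phi>}) z (rv (y'' $ scr' i))"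
      if "ns ! i = Fm (GPre k \<phi>)" "1 \<le> k" for k \<phi>
      using ca(3)[OF that] .
    show "rv (y'' $ scr i) = of_bool (\<not> sat G v (PSuf \<phi>) \<and> v \<noteq> bos G)" if "ns ! i = Fm (PSuf \<phi>)" for \<phi>
      using ca(4)[OF coords_less(4)[OF i] that] pa(3)[OF that] by simp
  qed simp
  then show ?thesis
    by (simp add: dec_row_def dec_layer_of_def y'_def y''_def Let_def)
qed

text \<open>Coordinates that are 2 modulo 3 are those of the form \<open>feat i\<close>, with
  \<open>i\<close> recovered by the division; the scratch coordinates have the other
  residues.\<close>

definition embedding :: "'a option \<Rightarrow> flt vec" where
  "embedding l = vec d (\<lambda>t. flo (if t = 0 then 1 else if t = 1 then of_bool (l = None)
     else of_bool (t mod 3 = 2 \<and> (\<exists>a. ns ! ((t - 2) div 3) = Fm (Prop a) \<and> l = Some a))))"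

lemma embedding_Inv:
  assumes "two_sorted \<Sigma> G" "v < length G"
  shows "Inv 0 G v (embedding (G ! v))"
proof -
  let ?e = "\<lambda>l t. if t = 0 then 1 else if t = 1 then of_bool (l = None)
     else of_bool (t mod 3 = 2 \<and> (\<exists>a. ns ! ((t - 2) div 3) = Fm (Prop a) \<and> l = Some a)) :: real"
  have r: "rep (embedding l $ t) (?e l t)" if "t < d" for l t
    using that representable_1 by (auto simp: embedding_def intro!: rep_flo)
  have val: "rv (embedding l $ t) = ?e l t" if "t < d" for l t
    using r[OF that] by (rule rv_rep)
  have bos: "G ! v = None \<longleftrightarrow> v = bos G"
    using bos_props(2,3)[OF assms(1)] assms(2) by metis
  have feat: "rv (embedding (G ! v) $ feat t) = of_bool (node_sat G v (ns ! t) \<and> atomic (ns ! t))" if "t < N" for t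
  proof -
    have *: "feat t mod 3 = 2" "(feat t - 2) div 3 = t" "feat t \<noteq> 0" "feat t \<noteq> 1"
      by (simp_all add: feat_def mod_Suc)
    have "(\<exists>a. ns ! t = Fm (Prop a) \<and> G ! v = Some a) \<longleftrightarrow> node_sat G v (ns ! t) \<and> atomic (ns ! t)"
      by (auto simp: atomic_def)
    then show ?thesis
      using val[OF coords_less(3)[OF that], of "G ! v"] * by simp
  qed
  have scr: "rv (embedding (G ! v) $ scr t) = 0" "rv (embedding (G ! v) $ scr' t) = 0" if "t < N" for t
  proof -
    have "scr t mod 3 \<noteq> 2" "scr' t mod 3 \<noteq> 2"
      unfolding scr_def scr'_def by presburger+
    then show "rv (embedding (G ! v) $ scr t) = 0" "rv (embedding (G ! v) $ scr' t) = 0"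
      using val[OF coords_less(4)[OF that], of "G ! v"] val[OF coords_less(5)[OF that], of "G ! v"]
      by (simp_all add: coords_distinct coords_distinct_Suc)
  qed
  have "finv d (embedding (G ! v))"
    using r val by (simp add: finv_def) (simp add: embedding_def)
  then show ?thesis
    unfolding Inv_def using val[of 0 "G ! v"] val[of 1 "G ! v"] coords_less feat scr bos by simp
qed

section \<open>The compiled transformer\<close>

definition transformer_of :: "'a gptl list \<Rightarrow> 'a transformer" where
  "transformer_of \<phi>s = \<lparr>prec = p, expo = q,
     tdims = \<lparr>dmodel = d, dkey = 1, dval = 2, dff = 4, dout = length \<phi>s\<rparr>,
     emb = embedding, enc = map enc_layer_of [0..<N], dec = map dec_layer_of [0..<N],
     Wout = smat d (length \<phi>s) (\<lambda>i. [(feat (ix (Fm (\<phi>s ! i))), 1)]),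
     bout = vec (length \<phi>s) (\<lambda>_. fzero False)\<rparr>"

context
  fixes \<phi>s :: "'a gptl list" and \<Sigma> :: "'a set"
  assumes ne: "\<phi>s \<noteq> []" and mem: "\<And>\<phi>. \<phi> \<in> set \<phi>s \<Longrightarrow> Fm \<phi> \<in> set ns"
begin

abbreviation D where
  "D \<equiv> tdims (transformer_of \<phi>s)"

lemma D_simps: "dmodel D = d" "dkey D = 1" "dval D = 2" "dff D = 4" "dout D = length \<phi>s"
  by (simp_all add: transformer_of_def)

lemma wf_single:
  assumes "WQ H \<in> fmats p q d 1" "WK H \<in> fmats p q d 1" "WV H \<in> fmats p q d 2"
  shows "wf_mha p q D (single H ps)"
  using assms by (simp add: wf_mha_def D_simps single_def)

lemma wf_heads: "wf_mha p q D (single (count_head d j x) ps)" "wf_mha p q D (single (past_head d j j') ps)"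
  by (intro wf_single; simp add: count_head_def past_head_def score_query_def)+

lemma wf_count_attention: "wf_mha p q D (count_attention i n)"
  using wf_heads by (cases "(i, n)" rule: count_attention.cases) (auto simp: null_mha_def count_mha_def)

lemma wf_past_attention: "wf_mha p q D (past_attention i n)"
  using wf_heads by (cases "(i, n)" rule: past_attention.cases) (auto simp: null_mha_def past_mha_def)

lemma wf_unit_mlp: "wf_mlp p q D (unit_mlp t g)"
  by (auto simp: wf_mlp_def D_simps unit_mlp_def fvecs_def flo_def)

lemma wf_transformer_of: "wf_transformer \<Sigma> (transformer_of \<phi>s)"
proof -
  have "ns \<noteq> []"
    using ne mem[of "hd \<phi>s"] by (cases \<phi>s) auto
  then have N: "map enc_layer_of [0..<N] \<noteq> []" "map dec_layer_of [0..<N] \<noteq> []"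
    by auto
  have "embedding l \<in> fvecs p q d" for l
    by (auto simp: fvecs_def embedding_def flo_def)
  moreover have "1 \<le> length \<phi>s"
    using ne by (cases \<phi>s) auto
  moreover have "vec (length \<phi>s) (\<lambda>_. fzero False) \<in> fvecs p q (length \<phi>s)"
    by (auto simp: fvecs_def)
  ultimately show ?thesis
    using N p_pos q_pos coords_less(1) wf_count_attention wf_past_attention wf_unit_mlp
    unfolding wf_transformer_def Let_def D_simps
    by (auto simp: transformer_of_def enc_layer_of_def dec_layer_of_def)
qed

lemma encoder_Inv:
  assumes "two_sorted \<Sigma> G" "n \<le> N"
  shows "\<exists>X. rows (fold (encoder_layer E p q D) (map enc_layer_of [0..<n])
      (mat_of_rows d (map embedding (take (bos G) G)))) = map X [0..<bos G] \<and>
    dim_col (fold (encoder_layer E p q D) (map enc_layer_of [0..<n])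
      (mat_of_rows d (map embedding (take (bos G) G)))) = d \<and> (\<forall>u < bos G. Inv n G u (X u))"
  using assms(2)
proof (induction n)
  case 0
  have "rows (mat_of_rows d (map embedding (take (bos G) G))) = map embedding (take (bos G) G)"
    by (rule rows_mat_of_rows) (auto simp: embedding_def)
  also have "\<dots> = map (\<lambda>u. embedding (G ! u)) [0..<bos G]"
    using bos_props(1)[OF assms(1)] by (intro nth_equalityI) auto
  finally show ?case
    using embedding_Inv[OF assms(1)] bos_props(1)[OF assms(1)]
    by (intro exI[of _ "\<lambda>u. embedding (G ! u)"]) simp
next
  case (Suc n)
  let ?F = "fold (encoder_layer E p q D) (map enc_layer_of [0..<n]) (mat_of_rows d (map embedding (take (bos G) G)))"
  obtain X where X: "rows ?F = map X [0..<bos G]" "dim_col ?F = d" "\<forall>u < bos G. Inv n G u (X u)"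
    using Suc by auto
  have "rows (encoder_layer E p q D (enc_layer_of n) ?F) = map (enc_row D (enc_layer_of n) (rows ?F)) (rows ?F)"
    "dim_col (encoder_layer E p q D (enc_layer_of n) ?F) = d"
    using rows_encoder_layer[of D "enc_layer_of n" ?F] X(2) wf_count_attention wf_unit_mlp
    by (simp_all add: D_simps enc_layer_of_def)
  moreover have "Inv (Suc n) G u (enc_row D (enc_layer_of n) (map X [0..<bos G]) (X u))" if "u < bos G" for u
    using enc_row_Inv[of D n G X u] D_simps Suc.prems X(3) that by simp
  ultimately show ?case
    using X(1) by (intro exI[of _ "\<lambda>u. enc_row D (enc_layer_of n) (map X [0..<bos G]) (X u)"]) (simp add: comp_def)
qed

lemma decoder_Inv:
  assumes "two_sorted \<Sigma> G" "n \<le> N" and X: "rows XM = map X [0..<bos G]" "\<forall>u < bos G. Inv N G u (X u)"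
  shows "\<exists>Y. rows (fold (\<lambda>L. decoder_layer E p q D L XM) (map dec_layer_of [0..<n])
      (mat_of_rows d (map embedding (drop (bos G) G)))) = map Y [bos G..<length G] \<and>
    dim_col (fold (\<lambda>L. decoder_layer E p q D L XM) (map dec_layer_of [0..<n])
      (mat_of_rows d (map embedding (drop (bos G) G)))) = d \<and>
    (\<forall>u. bos G \<le> u \<and> u < length G \<longrightarrow> Inv n G u (Y u))"
  using assms(2)
proof (induction n)
  case 0
  have "rows (mat_of_rows d (map embedding (drop (bos G) G))) = map embedding (drop (bos G) G)"
    by (rule rows_mat_of_rows) (auto simp: embedding_def)
  also have "\<dots> = map (\<lambda>u. embedding (G ! u)) [bos G..<length G]"
    using bos_props(1)[OF assms(1)] by (intro nth_equalityI) auto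
  finally show ?case
    using embedding_Inv[OF assms(1)] by (intro exI[of _ "\<lambda>u. embedding (G ! u)"]) simp
next
  case (Suc n)
  let ?F = "fold (\<lambda>L. decoder_layer E p q D L XM) (map dec_layer_of [0..<n]) (mat_of_rows d (map embedding (drop (bos G) G)))"
  obtain Y where Y: "rows ?F = map Y [bos G..<length G]" "dim_col ?F = d"
    "\<forall>u. bos G \<le> u \<and> u < length G \<longrightarrow> Inv n G u (Y u)"
    using Suc by auto
  \<comment> \<open>The mask covers the vertex itself, so \<open>length G - v\<close> positions are
    masked; \<open>dec_row_Inv\<close> holds for every such number.\<close>
  define Y1 where "Y1 = (\<lambda>v. dec_row D (dec_layer_of n) (map X [0..<bos G]) (map Y [bos G..<v]) (length G - v) (Y v))"
  have wf: "wf_mha p q D (dec_self (dec_layer_of n))" "wf_mha p q D (dec_cross (dec_layer_of n))"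
    "wf_mlp p q D (dec_mlp (dec_layer_of n))" "1 \<le> dval D" "dim_col ?F = dmodel D"
    using wf_count_attention wf_past_attention wf_unit_mlp Y(2) by (simp_all add: D_simps dec_layer_of_def)
  note dl = decoder_layer_row[OF wf, where X = XM]
  have dim: "dim_row ?F = length G - bos G"
    using Y(1) by (metis length_map length_rows length_upt)
  have "rows (decoder_layer E p q D (dec_layer_of n) XM ?F) = map Y1 [bos G..<length G]"
  proof (rule nth_equalityI)
    fix i
    assume "i < length (rows (decoder_layer E p q D (dec_layer_of n) XM ?F))"
    then have i: "i < dim_row ?F"
      using dl(2) by simp
    have r: "row ?F i = Y (bos G + i)"
    proof -
      have "row ?F i = rows ?F ! i"
        using i by simp
      then show ?thesis
        unfolding Y(1) using i dim by simp
    qed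
    have t: "take i (rows ?F) = map Y [bos G..<bos G + i]"
      using i dim unfolding Y(1) take_map by simp
    have "row (decoder_layer E p q D (dec_layer_of n) XM ?F) i = Y1 (bos G + i)"
      unfolding dl(1)[OF i] Y1_def r t X(1) dim by simp
    then show "rows (decoder_layer E p q D (dec_layer_of n) XM ?F) ! i = map Y1 [bos G..<length G] ! i"
      using i dim dl(2) by simp
  qed (use dl(2) dim in simp)
  moreover have "Inv (Suc n) G u (Y1 u)" if "bos G \<le> u" "u < length G" for u
    unfolding Y1_def by (rule dec_row_Inv) (use D_simps Suc.prems X(2) Y(3) that in auto)
  moreover have "dim_col (decoder_layer E p q D (dec_layer_of n) XM ?F) = d"
    using dl(3) by (simp add: D_simps)
  ultimately show ?case
    by (intro exI[of _ Y1]) simp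
qed

lemma featurewise_output_transformer_of:
  assumes G: "two_sorted \<Sigma> G" and v: "v \<in> suffix_vertices G"
  shows "featurewise_output E (transformer_of \<phi>s) G v = Some (map (sat G v) \<phi>s)"
proof -
  let ?XM = "fold (encoder_layer E p q D) (map enc_layer_of [0..<N]) (mat_of_rows d (map embedding (take (bos G) G)))"
  let ?YM = "fold (\<lambda>L. decoder_layer E p q D L ?XM) (map dec_layer_of [0..<N]) (mat_of_rows d (map embedding (drop (bos G) G)))"
  let ?W = "smat d (length \<phi>s) (\<lambda>i. [(feat (ix (Fm (\<phi>s ! i))), 1)])"
  have v': "bos G \<le> v" "v < length G"
    using v by (auto simp: suffix_vertices_def)
  obtain X where X: "rows ?XM = map X [0..<bos G]" "\<forall>u < bos G. Inv N G u (X u)"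
    using encoder_Inv[OF G order_refl] by blast
  obtain Y where Y: "rows ?YM = map Y [bos G..<length G]" "\<forall>u. bos G \<le> u \<and> u < length G \<longrightarrow> Inv N G u (Y u)"
    using decoder_Inv[OF G order_refl X] by blast
  have I: "Inv N G v (Y v)"
    using Y(2) v' by blast
  have dim: "dim_row ?YM = length G - bos G"
    using Y(1) by (metis length_map length_rows length_upt)
  have i: "v - bos G < dim_row ?YM"
    using v' dim by simp
  have "row ?YM (v - bos G) = rows ?YM ! (v - bos G)"
    using i by simp
  also have "\<dots> = Y v"
    unfolding Y(1) using v' by simp
  finally have row: "row ?YM (v - bos G) = Y v" .
  have mat: "transformer_matrix E (transformer_of \<phi>s) G =
      fmat_add_bias p q (fmat_mult p q ?YM ?W) (vec (length \<phi>s) (\<lambda>_. fzero False))"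
    unfolding transformer_matrix_def Let_def D_simps by (simp add: transformer_of_def)
  let ?r = "radd (rmul (Y v) ?W) (vec (length \<phi>s) (\<lambda>_. fzero False))"
  have out: "transformer_row E (transformer_of \<phi>s) G v = list_of_vec ?r"
    unfolding transformer_row_def mat using i row by (simp add: row_fmat_add_bias row_fmat_mult)
  have rep: "rep (?r $ o') (of_bool (sat G v (\<phi>s ! o')))" if "o' < length \<phi>s" for o'
  proof -
    define j where "j = ix (Fm (\<phi>s ! o'))"
    have "Fm (\<phi>s ! o') \<in> set (take N ns)"
      using mem that by simp
    then have j: "j < N" "ns ! j = Fm (\<phi>s ! o')"
      unfolding j_def using ix_less[of "Fm (\<phi>s ! o')" N] by auto
    have f: "rv (Y v $ feat j) = of_bool (sat G v (\<phi>s ! o'))"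
      using InvD(4)[OF I j(1)] j by simp
    have "representable (1 * rv (Y v $ feat j))"
      unfolding f using representable_1 by simp
    then have "rep (rmul (Y v) ?W $ o') (1 * rv (Y v $ feat j))"
      using InvD(1)[OF I] that coords_less(3)[OF j(1)] representable_1 by (intro rep_rmul_single) (auto simp: j_def)
    then have l: "rep (rmul (Y v) ?W $ o') (of_bool (sat G v (\<phi>s ! o')))"
      unfolding f by simp
    show ?thesis
      using rep_fadd[OF l rep_fzero[of False]] rep_representable[OF l] that by (simp add: radd_def)
  qed
  have dimr: "dim_vec ?r = length \<phi>s"
    by (simp add: radd_def)
  have xs: "list_of_vec ?r = map (($) ?r) [0..<length \<phi>s]"
    using dimr by (intro nth_equalityI) simp_all
  have repr: "represents p q (?r $ o') (of_bool (sat G v (\<phi>s ! o')))" if "o' < length \<phi>s" for o'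
    using rep[OF that] by (simp add: rep_def)
  have uniq: "represents p q (?r $ o') 1 \<longleftrightarrow> sat G v (\<phi>s ! o')" if "o' < length \<phi>s" for o'
    using repr[OF that] by (auto simp: represents_def)
  have "\<forall>x \<in> set (list_of_vec ?r). represents p q x 0 \<or> represents p q x 1"
  proof
    fix x
    assume "x \<in> set (list_of_vec ?r)"
    then obtain o' where o': "o' < length \<phi>s" "x = ?r $ o'"
      unfolding xs by auto
    show "represents p q x 0 \<or> represents p q x 1"
      using repr[OF o'(1)] unfolding o'(2) by (cases "sat G v (\<phi>s ! o')") auto
  qed
  moreover have "map (\<lambda>x. represents p q x 1) (list_of_vec ?r) = map (sat G v) \<phi>s"
    unfolding xs using uniq by (intro nth_equalityI) auto
  moreover have "prec (transformer_of \<phi>s) = p" "expo (transformer_of \<phi>s) = q"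
    by (simp_all add: transformer_of_def)
  ultimately show ?thesis
    unfolding featurewise_output_def Let_def out by simp
qed

end

end

section \<open>Choice of the format and composition of the translations\<close>

lemma transformer_of_formulas:
  assumes E: "exp_approximation E" and \<phi>s: "wf_formulas \<Sigma> \<phi>s"
  shows "\<exists>T. wf_transformer \<Sigma> T \<and> equivalent \<Sigma> (formulas_output \<phi>s) (featurewise_output E T)"
proof -
  define ns where "ns = concat (map nodes \<phi>s)"
  \<comment> \<open>The inserted 0 covers formulas without \<open>GPre\<close>; the successor makes
    the bound positive, as the inactive head counts with threshold 1.\<close>
  define \<kappa> where "\<kappa> = Suc (Max (insert 0 {k. \<exists>\<phi>. Fm (GPre k \<phi>) \<in> set ns}))"
  \<comment> \<open>\<open>2 ^ p\<close> is \<open>2 ^ 6\<close> times the square of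
    \<open>2 ^ (\<kappa> + 2)\<close>, which dominates
    \<open>64 * (\<kappa> + 2) ^ 2\<close>.\<close>
  define p where "p = 2 * \<kappa> + 10"
  have ord: "ordered (concat (map nodes \<psi>s))" for \<psi>s :: "'a gptl list"
    by (induction \<psi>s) (auto intro: ordered_append simp: nodes_ordered)
  have "{k. \<exists>\<phi>. Fm (GPre k \<phi>) \<in> set ns} \<subseteq> (\<lambda>n. case n of Fm \<psi> \<Rightarrow> threshold \<psi> | BosNot \<psi> \<Rightarrow> 0) ` set ns"
    by (force intro: image_eqI[where x = "Fm (GPre k \<phi>)" for k \<phi>])
  then have fin: "finite {k. \<exists>\<phi>. Fm (GPre k \<phi>) \<in> set ns}"
    by (rule finite_subset) simp
  have bound: "64 * (\<kappa> + 2) ^ 2 \<le> (2::nat) ^ p"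
  proof -
    have "\<kappa> + 2 \<le> 2 ^ (\<kappa> + 2)"
      using less_exp[of "\<kappa> + 2"] by linarith
    then have "(\<kappa> + 2) ^ 2 \<le> (2 ^ (\<kappa> + 2)) ^ 2"
      by (rule power_mono) simp
    also have "(2 ^ (\<kappa> + 2)) ^ 2 = (2::nat) ^ (2 * \<kappa> + 4)"
    proof -
      have "(\<kappa> + 2) * 2 = 2 * \<kappa> + 4"
        by simp
      then show ?thesis
        unfolding power_mult[symmetric] by (simp only:)
    qed
    finally have "2 ^ 6 * (\<kappa> + 2) ^ 2 \<le> 2 ^ 6 * (2::nat) ^ (2 * \<kappa> + 4)"
      by (rule mult_le_mono2)
    also have "\<dots> = 2 ^ p"
      unfolding power_add[symmetric] by (simp add: p_def)
    finally show ?thesis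
      by simp
  qed
  have thr: "k \<le> \<kappa>" if "Fm (GPre k \<phi>) \<in> set ns" for k \<phi>
    unfolding \<kappa>_def using fin that by (intro le_SucI Max_ge) auto
  have p8: "8 \<le> p" "1 \<le> \<kappa>"
    by (simp_all add: p_def \<kappa>_def)
  interpret compilation p p E \<kappa> ns
    by unfold_locales (use bound thr p8 E ord in \<open>auto simp: ns_def\<close>)
  have ne: "\<phi>s \<noteq> []"
    using \<phi>s by (simp add: wf_formulas_def)
  have mem: "Fm \<phi> \<in> set ns" if "\<phi> \<in> set \<phi>s" for \<phi>
    using that nodes_ordered[of \<phi>] by (auto simp: ns_def)
  show ?thesis
    using wf_transformer_of[OF ne mem] featurewise_output_transformer_of[OF ne mem]
    unfolding equivalent_def formulas_output_def by (intro exI[of _ "transformer_of \<phi>s"]) auto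
qed

theorem theorem4:
  fixes \<Sigma> :: "'a set"
    and E :: "nat \<Rightarrow> nat \<Rightarrow> flt \<Rightarrow> flt"
    and nan :: "nat \<Rightarrow> nat \<Rightarrow> bool list"
  assumes "finite \<Sigma>"
    and "exp_approximation E"
    and "\<And>p q. length (nan p q) = 1 + q + p"
  shows "(\<forall>T. wf_transformer \<Sigma> T \<longrightarrow>
            (\<exists>\<phi>s. wf_formulas \<Sigma> \<phi>s \<and>
               equivalent \<Sigma> (bitwise_output E nan T) (formulas_output \<phi>s))) \<and>
         (\<forall>T. wf_transformer \<Sigma> T \<longrightarrow>
            (\<exists>A. wf_cpg \<Sigma> A \<and>
               equivalent \<Sigma> (bitwise_output E nan T) (cpg_output A))) \<and>
         (\<forall>\<phi>s. wf_formulas \<Sigma> \<phi>s \<longrightarrow>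
            (\<exists>T. wf_transformer \<Sigma> T \<and>
               equivalent \<Sigma> (formulas_output \<phi>s) (featurewise_output E T))) \<and>
         (\<forall>\<phi>s. wf_formulas \<Sigma> \<phi>s \<longrightarrow>
            (\<exists>A. wf_cpg \<Sigma> A \<and>
               equivalent \<Sigma> (formulas_output \<phi>s) (cpg_output A))) \<and>
         (\<forall>A. wf_cpg \<Sigma> A \<longrightarrow>
            (\<exists>T. wf_transformer \<Sigma> T \<and>
               equivalent \<Sigma> (cpg_output A) (featurewise_output E T))) \<and>
         (\<forall>A. wf_cpg \<Sigma> A \<longrightarrow>
            (\<exists>\<phi>s. wf_formulas \<Sigma> \<phi>s \<and>
               equivalent \<Sigma> (cpg_output A) (formulas_output \<phi>s)))"
proof -
  note E = assms(2) and nan = assms(3)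
  have trans: "equivalent \<Sigma> f h" if "equivalent \<Sigma> f g" "equivalent \<Sigma> g h" for f g h
    using that by (simp add: equivalent_def)
  have T_to_formulas: "\<exists>\<phi>s. wf_formulas \<Sigma> \<phi>s \<and> equivalent \<Sigma> (bitwise_output E nan T) (formulas_output \<phi>s)"
    if T: "wf_transformer \<Sigma> T" for T
  proof -
    \<comment> \<open>The format is that of the given transformer, about which nothing is known
      beyond positive parameters.\<close>
    interpret arithmetic "prec T" "expo T" E
      using T E by unfold_locales (auto simp: wf_transformer_def Let_def)
    show ?thesis
      by (rule formulas_of_transformer[OF assms(1) T refl refl nan])
  qed
  note A_to_formulas = formulas_of_cpg[OF assms(1)]
  note formulas_to_A = cpg_of_formulas[OF assms(1)]
  note formulas_to_T = transformer_of_formulas[OF E]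
  \<comment> \<open>The remaining two translations go through formulas. This composes although
    transformers are read bit-wise as sources and feature-wise as targets, because a transformer
    never occurs as the intermediate object.\<close>
  have T_to_A: "\<exists>A. wf_cpg \<Sigma> A \<and> equivalent \<Sigma> (bitwise_output E nan T) (cpg_output A)"
    if "wf_transformer \<Sigma> T" for T
    using T_to_formulas[OF that] formulas_to_A trans by meson
  have A_to_T: "\<exists>T. wf_transformer \<Sigma> T \<and> equivalent \<Sigma> (cpg_output A) (featurewise_output E T)"
    if "wf_cpg \<Sigma> A" for A
    using A_to_formulas[OF that] formulas_to_T trans by meson
  show ?thesis
    by (intro conjI allI impI; rule T_to_formulas T_to_A formulas_to_T formulas_to_A A_to_T A_to_formulas; assumption)
qed

end
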